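(* Let $(\mathcal{G},\partial P)$ be a simple polygonal subdivision graph (i.e. $\mathcal{G}$ is a simple graph), with subdivision complexity $\mathscr{C}(\mathcal{G},\partial P)=N$. Let $a,b$ be a pair of non-adjacent vertices in $\partial P$. Suppose that both $\Gamma_{a,b}$ and $\Gamma_{a,b}^*$ are non-empty. (1) (Duality) If $N=3$, i.e. $\mathcal{R}(P)$ is a triangulation, then $$\mathrm{EW}(\Gamma_{a,b},\partial P)\cdot\mathrm{EW}(\Gamma_{a,b}^*,\partial P)=1.$$ (2) (Quasi-duality) More generally, $$\frac{1}{(4N+1)^2}\le\mathrm{EW}(\Gamma_{a,b},\partial P)\cdot\mathrm{EW}(\Gamma_{a,b}^*,\partial P)\le 1.$$ Equivalently, $$1\le\mathrm{EL}(\Gamma_{a,b},\partial P)\cdot\mathrm{EL}(\Gamma_{a,b}^*,\partial P)\le(4N+1)^2.$$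
   Context: A polygon $P$ is a finite CW complex homeomorphic to a closed disk containing exactly one 2-cell and at least three 0-cells; 0-, 1-, 2-cells are called vertices, edges, faces. A polygonal subdivision of $P$ is a subdivision $\mathcal{R}(P)$ (a CW structure on the same space, each of whose closed cells lies in a closed cell of $P$) decomposing $P$ into $m\ge2$ closed 2-cells $P=\bigcup_{j=1}^mP_j$ such that each $P_j$ is a polygon with $n_j$ vertices, and no edge of $\partial P$ contains a vertex of $\mathcal{R}(P)$ in its interior. Let $\mathcal{G}$ be the 1-skeleton of $\mathcal{R}(P)$; the pair $(\mathcal{G},\partial P)$ is a polygonal subdivision graph, with subdivision complexity $\mathscr{C}(\mathcal{G},\partial P)=\max\{n_1,\dots,n_m\}$. A path in $\mathcal{G}$ is a sequence of vertices $v_0,\dots,v_{n+1}$ with $v_jv_{j+1}$ an edge for all $j$. A path $\gamma$ is proper if its endpoints lie on $\partial P$ and its interior is disjoint from $\partial P$. For non-adjacent vertices $a,b\in\partial P$, $\Gamma_{a,b}$ is the family of proper paths in $\mathcal{G}$ connecting $a$ and $b$, and $\Gamma_{a,b}^*$ is the family of proper paths in $\mathcal{G}$ separating $a$ and $b$, equivalently connecting the two components of $\partial P-\{a,b\}$. Let $\mathcal{V}$ be the vertex set of $\mathcal{G}$. A vertex metric is a function $\mu:\mathcal{V}\to[0,\infty)$; $\mathrm{area}(\mu)=\sum_{v\in\mathcal{V}}\mu(v)^2$; the length of a path $\gamma=(v_0,\dots,v_{n+1})$ is $l_\mu(\gamma)=\sum_{j=0}^{n+1}\mu(v_j)$. For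 a family of paths $\Gamma$, $\mu$ is $\Gamma$-admissible if $l_\mu(\gamma)\ge1$ for all $\gamma\in\Gamma$, and $\Gamma$-admissible relative to $\mathcal{W}\subseteq\mathcal{V}$ if moreover $\mu=0$ on $\mathcal{W}$. The relative vertex extremal width is $\mathrm{EW}(\Gamma,\mathcal{W})=\inf\{\mathrm{area}(\mu):\mu\text{ is }\Gamma\text{-admissible relative to }\mathcal{W}\}$, and $\mathrm{EL}(\Gamma,\mathcal{W})=1/\mathrm{EW}(\Gamma,\mathcal{W})$. Here $\mathcal{W}=\partial P$ means the set of vertices on $\partial P$. *)

theory Defs
  imports "HOL-Analysis.Analysis"
begin

section \<open>Finite CW complexes\<close>

text \<open>
  A cell structure on a space is given by the function sending \<open>n\<close> to the set of its
  \<^emph>\<open>open\<close> \<open>n\<close>-cells; the closed cell of \<open>e\<close> is the closure of \<open>e\<close>. In particular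
  a 0-cell is a singleton.
\<close>

type_synonym 'a cells = "nat \<Rightarrow> 'a set set"

definition unit_ball :: "nat \<Rightarrow> (nat \<Rightarrow> real) topology" where
  "unit_ball n = subtopology (Euclidean_space n) {x. (\<Sum>i<n. x i ^ 2) \<le> 1}"

definition open_unit_ball :: "nat \<Rightarrow> (nat \<Rightarrow> real) set" where
  "open_unit_ball n = {x \<in> topspace (Euclidean_space n). (\<Sum>i<n. x i ^ 2) < 1}"

definition unit_sphere :: "nat \<Rightarrow> (nat \<Rightarrow> real) set" where
  "unit_sphere n = {x \<in> topspace (Euclidean_space n). (\<Sum>i<n. x i ^ 2) = 1}"

definition characteristic_map ::
    "'a topology \<Rightarrow> 'a cells \<Rightarrow> nat \<Rightarrow> 'a set \<Rightarrow> ((nat \<Rightarrow> real) \<Rightarrow> 'a) \<Rightarrow> bool" where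
  "characteristic_map X C n e \<phi> \<longleftrightarrow>
     continuous_map (unit_ball n) X \<phi> \<and>
     homeomorphic_map (subtopology (unit_ball n) (open_unit_ball n)) (subtopology X e) \<phi> \<and>
     \<phi> ` unit_sphere n \<subseteq> (\<Union>m<n. \<Union>(C m))"

text \<open>The closure-finiteness and weak-topology axioms are automatic for finitely many cells.\<close>

definition finite_CW_complex :: "'a topology \<Rightarrow> 'a cells \<Rightarrow> bool" where
  "finite_CW_complex X C \<longleftrightarrow>
     Hausdorff_space X \<and>
     finite (SIGMA n:UNIV. C n) \<and>
     (\<Union>n. \<Union>(C n)) = topspace X \<and>
     (\<forall>m n. \<forall>d\<in>C m. \<forall>e\<in>C n. (m, d) \<noteq> (n, e) \<longrightarrow> d \<inter> e = {}) \<and>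
     (\<forall>n. \<forall>e\<in>C n. \<exists>\<phi>. characteristic_map X C n e \<phi>)"

definition restrict_cells :: "'a cells \<Rightarrow> 'a set \<Rightarrow> 'a cells" where
  "restrict_cells C S = (\<lambda>n. {e \<in> C n. e \<subseteq> S})"

definition vertices :: "'a cells \<Rightarrow> 'a set" where
  "vertices C = \<Union>(C 0)"

section \<open>Polygons and polygonal subdivisions\<close>

definition closed_disk :: "complex topology" where
  "closed_disk = top_of_set (cball 0 1)"

text \<open>
  By invariance of domain the image of the unit circle is the same for all homeomorphisms
  from the closed disk.
\<close>

definition disk_boundary :: "'a topology \<Rightarrow> 'a set" where
  "disk_boundary X = \<Union>{h ` sphere 0 1 | h. homeomorphic_map closed_disk X h}"

definition polygon :: "'a topology \<Rightarrow> 'a cells \<Rightarrow> bool" where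
  "polygon X C \<longleftrightarrow>
     finite_CW_complex X C \<and>
     closed_disk homeomorphic_space X \<and>
     card (C 2) = 1 \<and>
     card (vertices C) \<ge> 3"

definition subdivision :: "'a topology \<Rightarrow> 'a cells \<Rightarrow> 'a cells \<Rightarrow> bool" where
  "subdivision X C D \<longleftrightarrow>
     finite_CW_complex X D \<and>
     (\<forall>n. \<forall>d\<in>D n. \<exists>m. \<exists>c\<in>C m. X closure_of d \<subseteq> X closure_of c)"

text \<open>
  In the last condition \<open>e\<close> is an open 1-cell, i.e. the interior of the corresponding edge.
\<close>

definition polygonal_subdivision :: "'a topology \<Rightarrow> 'a cells \<Rightarrow> 'a cells \<Rightarrow> bool" where
  "polygonal_subdivision X C D \<longleftrightarrow>
     polygon X C \<and>
     subdivision X C D \<and>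
     card (D 2) \<ge> 2 \<and>
     topspace X = (\<Union>f\<in>D 2. X closure_of f) \<and>
     (\<forall>f\<in>D 2. polygon (subtopology X (X closure_of f)) (restrict_cells D (X closure_of f))) \<and>
     (\<forall>e\<in>C 1. e \<subseteq> disk_boundary X \<longrightarrow> e \<inter> vertices D = {})"

definition subdivision_complexity :: "'a topology \<Rightarrow> 'a cells \<Rightarrow> nat" where
  "subdivision_complexity X D =
     Max ((\<lambda>f. card (vertices (restrict_cells D (X closure_of f)))) ` D 2)"

section \<open>The 1-skeleton as a graph\<close>

definition edge_ends :: "'a topology \<Rightarrow> 'a set \<Rightarrow> 'a set" where
  "edge_ends X e = X closure_of e - e"

text \<open>Neither loops nor multiple edges.\<close>

definition simple_skeleton :: "'a topology \<Rightarrow> 'a cells \<Rightarrow> bool" where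
  "simple_skeleton X D \<longleftrightarrow>
     (\<forall>e\<in>D 1. card (edge_ends X e) = 2) \<and> inj_on (edge_ends X) (D 1)"

definition adjacent :: "'a topology \<Rightarrow> 'a cells \<Rightarrow> 'a \<Rightarrow> 'a \<Rightarrow> bool" where
  "adjacent X D u v \<longleftrightarrow> (\<exists>e\<in>D 1. edge_ends X e = {u, v})"

definition skeleton_path :: "'a topology \<Rightarrow> 'a cells \<Rightarrow> 'a list \<Rightarrow> bool" where
  "skeleton_path X D p \<longleftrightarrow>
     length p \<ge> 2 \<and> set p \<subseteq> vertices D \<and> successively (adjacent X D) p"

definition proper_path :: "'a topology \<Rightarrow> 'a cells \<Rightarrow> 'a list \<Rightarrow> bool" where
  "proper_path X D p \<longleftrightarrow>
     skeleton_path X D p \<and>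
     hd p \<in> disk_boundary X \<and> last p \<in> disk_boundary X \<and>
     set (butlast (tl p)) \<inter> disk_boundary X = {}"

definition connecting_paths :: "'a topology \<Rightarrow> 'a cells \<Rightarrow> 'a \<Rightarrow> 'a \<Rightarrow> 'a list set" where
  "connecting_paths X D a b = {p. proper_path X D p \<and> {hd p, last p} = {a, b}}"

definition separating_paths :: "'a topology \<Rightarrow> 'a cells \<Rightarrow> 'a \<Rightarrow> 'a \<Rightarrow> 'a list set" where
  "separating_paths X D a b =
     {p. proper_path X D p \<and>
         (\<exists>A B. A \<in> connected_components_of (subtopology X (disk_boundary X - {a, b})) \<and>
                B \<in> connected_components_of (subtopology X (disk_boundary X - {a, b})) \<and>
                A \<noteq> B \<and> hd p \<in> A \<and> last p \<in> B)}"

section \<open>Relative vertex extremal width and length\<close>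

definition area :: "'a set \<Rightarrow> ('a \<Rightarrow> real) \<Rightarrow> real" where
  "area V \<mu> = (\<Sum>v\<in>V. \<mu> v ^ 2)"

definition path_length :: "('a \<Rightarrow> real) \<Rightarrow> 'a list \<Rightarrow> real" where
  "path_length \<mu> p = (\<Sum>v\<leftarrow>p. \<mu> v)"

definition admissible :: "'a set \<Rightarrow> 'a list set \<Rightarrow> 'a set \<Rightarrow> ('a \<Rightarrow> real) \<Rightarrow> bool" where
  "admissible V \<Gamma> W \<mu> \<longleftrightarrow>
     (\<forall>v\<in>V. \<mu> v \<ge> 0) \<and> (\<forall>p\<in>\<Gamma>. path_length \<mu> p \<ge> 1) \<and> (\<forall>v\<in>W. \<mu> v = 0)"

text \<open>
  Values in \<open>[0, \<infinity>]\<close>: the infimum is \<open>\<infinity>\<close> if there is no admissible metric.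
\<close>

definition extremal_width :: "'a set \<Rightarrow> 'a list set \<Rightarrow> 'a set \<Rightarrow> ennreal" where
  "extremal_width V \<Gamma> W = (INF \<mu>\<in>{\<mu>. admissible V \<Gamma> W \<mu>}. ennreal (area V \<mu>))"

definition extremal_length :: "'a set \<Rightarrow> 'a list set \<Rightarrow> 'a set \<Rightarrow> ennreal" where
  "extremal_length V \<Gamma> W = 1 / extremal_width V \<Gamma> W"

definition EW :: "'a topology \<Rightarrow> 'a cells \<Rightarrow> 'a list set \<Rightarrow> ennreal" where
  "EW X D \<Gamma> = extremal_width (vertices D) \<Gamma> (vertices D \<inter> disk_boundary X)"

definition EL :: "'a topology \<Rightarrow> 'a cells \<Rightarrow> 'a list set \<Rightarrow> ennreal" where
  "EL X D \<Gamma> = extremal_length (vertices D) \<Gamma> (vertices D \<inter> disk_boundary X)"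

end

theory Submission
  imports Defs
begin

text \<open>
  Identify \<open>P\<close> with the closed unit disk. Two families of finite sets each member of which meets each
  member of the other have extremal widths with product at most \<open>1\<close>: test a minimiser for the first
  family against its perturbations by indicators of members of the second. Crossing of paths in
  the disk makes this applicable to \<open>\<Gamma>\<^sub>a\<^sub>b\<close> and \<open>\<Gamma>\<^sub>a\<^sub>b\<^sup>*\<close>, which is the upper bound.

  For the lower bound, put a centre into every face and join it to the vertices on the rim. Let \<open>\<tau>\<close> be
  admissible for the paths from \<open>a\<close> to \<open>b\<close> in the enlarged graph and \<open>M v\<close> the largest value of \<open>\<tau>\<close> at a centre
  next to \<open>v\<close>. For \<open>t\<close> in an interval of length \<open>1\<close>, the vertices whose interval of
  \<open>\<tau>\<close>-distances from \<open>a\<close>, fattened by \<open>M\<close>, contains \<open>t\<close> carry a path of \<open>\<Gamma>\<^sub>a\<^sub>b\<^sup>*\<close>: the sublevel set cuts an even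
  number of edges on every rim, and summing over the faces leaves a parity statement on \<open>\<partial>P\<close>.
  Integrating the \<open>\<mu>\<close>-length over \<open>t\<close> gives \<open>1 \<le> \<Sum>v. \<mu> v * (\<tau> v + 2 * M v)\<close>, hence by Cauchy--Schwarz
  \<open>area \<mu>\<close> is at least \<open>1 / (4 N + 1)\<close> times the inverse of the width of the enlarged family; the same holds with the two
  families exchanged, and the enlarged families again have product of widths at most \<open>1\<close>. If all faces are
  triangles, the vertices of a face are pairwise adjacent, so centres can be made too expensive to
  use and \<open>M\<close> disappears.
\<close>

section \<open>Densities blocking a family of sets\<close>

text \<open>The vertices of a large face need not be pairwise adjacent, so the vertices at a given
  distance from \<open>a\<close> need not carry a path. A centre bounds how far the distances on one
  rim can spread, and fattening by \<open>M\<close> makes up for this spread. Each centre value is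
  then charged with coefficient 2 to at most \<open>N\<close> vertices; Cauchy--Schwarz with weights
  1 and \<open>4 N\<close> turns this into the factor \<open>4 N + 1\<close>, paid once for each
  family, hence the square. For triangles a single level argument is enough. That both families are
  non-empty keeps the two terminal sets off a common face: otherwise a curve through the centre of
  that face would have to cross a path of the other family, which avoids centres. Topology is the
  other obstacle. Cells are known only through homeomorphisms and edges are arbitrary arcs, so the
  incidence of edges and faces has to be derived from invariance of domain, and crossing from the
  theorem on paths in a square. Infima are only approached; positive lower bounds stand in for the
  widths themselves.\<close>

definition adm :: "'n set set \<Rightarrow> ('n \<Rightarrow> real) \<Rightarrow> bool" where
  "adm \<G> \<tau> \<longleftrightarrow> (\<forall>n. 0 \<le> \<tau> n) \<and> (\<forall>G\<in>\<G>. 1 \<le> sum \<tau> G)"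

definition sqn :: "'n set \<Rightarrow> ('n \<Rightarrow> real) \<Rightarrow> real" where
  "sqn \<Omega> \<tau> = (\<Sum>n\<in>\<Omega>. (\<tau> n)\<^sup>2)"

lemma sqn_nonneg: "0 \<le> sqn \<Omega> \<tau>"
  by (simp add: sqn_def sum_nonneg)

text \<open>To first order in \<open>s\<close>, moving a near-minimiser \<open>\<tau>\<close>
  towards the indicator of \<open>H\<close> cannot push the area below the infimum \<open>A\<close>;
  this forces the \<open>\<tau>\<close>-length of \<open>H\<close> to be at least about
  \<open>A\<close>. So \<open>\<tau> / A\<close> is nearly admissible for \<open>\<H>\<close>, with
  area about \<open>1 / A\<close>.\<close>

lemma adm_product_le_1:
  fixes \<Omega> :: "'n set"
  assumes fin: "finite \<Omega>" and GO: "\<G> \<subseteq> Pow \<Omega>" and HO: "\<H> \<subseteq> Pow \<Omega>"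
    and meet: "\<And>G H. G \<in> \<G> \<Longrightarrow> H \<in> \<H> \<Longrightarrow> G \<inter> H \<noteq> {}"
    and lowG: "\<And>\<tau>. adm \<G> \<tau> \<Longrightarrow> \<alpha> \<le> sqn \<Omega> \<tau>"
    and lowH: "\<And>\<tau>. adm \<H> \<tau> \<Longrightarrow> \<beta> \<le> sqn \<Omega> \<tau>"
    and pos: "0 < \<alpha>" "0 < \<beta>"
  shows "\<alpha> * \<beta> \<le> 1"
proof -
  define S where "S = sqn \<Omega> ` {\<tau>. adm \<G> \<tau>}"
  define A where "A = Inf S"
  have ind: "adm \<G> (indicator H)" if "H \<in> \<H>" for H
  proof -
    have "1 \<le> (sum (indicator H) G :: real)" if "G \<in> \<G>" for G :: "'n set"
    proof -
      have "finite G" using GO fin that finite_subset by blast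
      moreover obtain x where "x \<in> G" "x \<in> H" using meet[OF \<open>G \<in> \<G>\<close> \<open>H \<in> \<H>\<close>] by blast
      ultimately show ?thesis
        using member_le_sum[of x G "indicator H :: _ \<Rightarrow> real"] by simp
    qed
    then show ?thesis by (simp add: adm_def)
  qed
  \<comment> \<open>For an empty family the zero density would be admissible, with area below
    \<open>\<beta>\<close>. A member of \<open>\<H>\<close> supplies the admissible indicator that
    makes \<open>S\<close> non-empty.\<close>
  have "\<H> \<noteq> {}"
  proof
    assume "\<H> = {}"
    then have "adm \<H> (\<lambda>_. 0)" by (simp add: adm_def)
    from lowH[OF this] pos show False by (simp add: sqn_def)
  qed
  then have S_ne: "S \<noteq> {}" using ind by (auto simp: S_def)
  have S_bdd: "bdd_below S" by (auto simp: S_def intro!: bdd_belowI[of _ 0] sqn_nonneg)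
  have "\<alpha> \<le> A" unfolding A_def using S_ne lowG by (intro cInf_greatest) (auto simp: S_def)
  with pos have Apos: "0 < A" by simp
  \<comment> \<open>Half of the second-order error: \<open>A\<close> comes from expanding
    \<open>(1 - s)^2 * A\<close>, the 1 from the slack \<open>s^2\<close> of the near-minimiser, and
    \<open>card \<Omega>\<close> from the area of the indicator.\<close>
  define K where "K = (A + 1 + card \<Omega>) / 2"
  have Kpos: "0 < K" using Apos by (simp add: K_def)
  have key: "\<beta> \<le> (A + s\<^sup>2) / (A - s * K)\<^sup>2" if s: "0 < s" "s < 1" "s * K < A" for s
  proof -
    \<comment> \<open>A slack of order \<open>s^2\<close> still vanishes after the division by
      \<open>s\<close> further down.\<close>
    have "\<exists>x\<in>S. x < A + s\<^sup>2"
      using cInf_less_iff[OF S_ne S_bdd, of "A + s\<^sup>2"] s by (auto simp: A_def)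
    then obtain \<tau> where \<tau>: "adm \<G> \<tau>" "sqn \<Omega> \<tau> < A + s\<^sup>2" by (auto simp: S_def)
    define \<eta> where "\<eta> = A - s * K"
    have \<eta>: "0 < \<eta>" using s by (simp add: \<eta>_def)
    have long: "\<eta> \<le> sum \<tau> H" if H: "H \<in> \<H>" for H
    proof -
      have HO': "H \<subseteq> \<Omega>" using HO H by auto
      then have finH: "finite H" using fin finite_subset by blast
      define \<sigma> where "\<sigma> = (\<lambda>n. (1 - s) * \<tau> n + s * indicator H n)"
      have "1 \<le> sum \<sigma> G" if "G \<in> \<G>" for G
      proof -
        have "sum \<sigma> G = (1 - s) * sum \<tau> G + s * sum (indicator H) G"
          by (simp add: \<sigma>_def sum.distrib sum_distrib_left)
        moreover have "(1 - s) * 1 \<le> (1 - s) * sum \<tau> G"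
          using \<tau>(1) that s by (intro mult_left_mono) (auto simp: adm_def)
        moreover have "s * 1 \<le> s * sum (indicator H) G"
          using ind[OF H] that s by (intro mult_left_mono) (auto simp: adm_def)
        ultimately show ?thesis by simp
      qed
      moreover have "0 \<le> \<sigma> n" for n
        using \<tau>(1) s by (auto simp: \<sigma>_def adm_def)
      ultimately have "adm \<G> \<sigma>" by (simp add: adm_def)
      then have "A \<le> sqn \<Omega> \<sigma>"
        unfolding A_def by (intro cInf_lower S_bdd) (simp add: S_def)
      also have "sqn \<Omega> \<sigma> = (\<Sum>n\<in>\<Omega>. (1-s)\<^sup>2 * (\<tau> n)\<^sup>2 + 2 * s * (1-s) * (if n \<in> H then \<tau> n else 0)
          + s\<^sup>2 * (if n \<in> H then 1 else 0))"
        unfolding sqn_def \<sigma>_def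
        by (intro sum.cong) (auto simp: indicator_def power2_eq_square algebra_simps)
      also have "\<dots> = (1-s)\<^sup>2 * sqn \<Omega> \<tau> + 2 * s * (1-s) * sum \<tau> H + s\<^sup>2 * card H"
        using HO' fin finH
        by (simp add: sum.distrib sum_distrib_left[symmetric] sum.inter_restrict[symmetric]
            Int_absorb1 sqn_def)
      also have "\<dots> \<le> (1-s)\<^sup>2 * (A + s\<^sup>2) + 2 * s * (1-s) * sum \<tau> H + s\<^sup>2 * card \<Omega>"
      proof -
        have "(1-s)\<^sup>2 * sqn \<Omega> \<tau> \<le> (1-s)\<^sup>2 * (A + s\<^sup>2)"
          using \<tau>(2) by (intro mult_left_mono) auto
        moreover have "s\<^sup>2 * card H \<le> s\<^sup>2 * card \<Omega>"
          using card_mono[OF fin HO'] by (intro mult_left_mono) auto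
        ultimately show ?thesis by simp
      qed
      finally have 1: "A \<le> (1-s)\<^sup>2 * (A + s\<^sup>2) + 2 * s * (1-s) * sum \<tau> H + s\<^sup>2 * card \<Omega>" .
      have "(1-s)\<^sup>2 * (A + s\<^sup>2) \<le> A - 2 * s * A + s\<^sup>2*A + s\<^sup>2"
      proof -
        have "(1-s)\<^sup>2 * s\<^sup>2 \<le> 1 * s\<^sup>2"
          using s by (intro mult_right_mono) (auto simp: power_le_one)
        then show ?thesis by (simp add: power2_eq_square algebra_simps)
      qed
      moreover have X0: "0 \<le> sum \<tau> H" using \<tau>(1) by (intro sum_nonneg) (auto simp: adm_def)
      have "2 * s * (1-s) * sum \<tau> H \<le> 2 * s * 1 * sum \<tau> H"
        using s X0 by (intro mult_right_mono mult_left_mono) auto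
      ultimately have "2 * s * A - s\<^sup>2*(A + 1 + card \<Omega>) \<le> 2 * s *  sum \<tau> H"
        using 1 by (simp add: algebra_simps)
      then have "2 * s * (A - s * K) \<le> 2 * s *  sum \<tau> H"
        by (simp add: K_def power2_eq_square field_simps)
      then show ?thesis using s by (simp add: \<eta>_def)
    qed
    have "adm \<H> (\<lambda>n. \<tau> n / \<eta>)"
      using \<tau>(1) \<eta> long by (auto simp: adm_def sum_divide_distrib[symmetric])
    then have "\<beta> \<le> sqn \<Omega> (\<lambda>n. \<tau> n / \<eta>)" by (rule lowH)
    also have "\<dots> = sqn \<Omega> \<tau> / \<eta>\<^sup>2"
      by (simp add: sqn_def power_divide sum_divide_distrib)
    also have "\<dots> \<le> (A + s\<^sup>2) / \<eta>\<^sup>2"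
      using \<tau>(2) \<eta> by (intro divide_right_mono) auto
    finally show ?thesis by (simp add: \<eta>_def)
  qed
  \<comment> \<open>As \<open>s\<close> tends to 0 the bound of \<open>key\<close> becomes
    \<open>A / A^2\<close>, that is \<open>1 / A\<close>.\<close>
  have lim: "((\<lambda>s. (A + s\<^sup>2) / (A - s * K)\<^sup>2) \<longlongrightarrow> (A + 0\<^sup>2) / (A - 0 * K)\<^sup>2) (at_right 0)"
    using Apos by (intro tendsto_intros) auto
  have "eventually (\<lambda>s. 0 < s \<and> s < min 1 (A / K)) (at_right 0)"
    using Apos Kpos eventually_at_right_less[of 0] eventually_at_right_real[of 0 "min 1 (A/K)"]
    by (auto elim: eventually_mono)
  then have "eventually (\<lambda>s. \<beta> \<le> (A + s\<^sup>2) / (A - s * K)\<^sup>2) (at_right 0)"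
    by eventually_elim (intro key; use Kpos in \<open>simp add: field_simps\<close>)
  then have "\<beta> \<le> (A + 0\<^sup>2) / (A - 0 * K)\<^sup>2"
    using lim by (intro tendsto_lowerbound[OF lim]) auto
  then have "\<beta> * A \<le> 1" using Apos by (simp add: power2_eq_square field_simps)
  moreover have "\<beta> * \<alpha> \<le> \<beta> * A" using pos \<open>\<alpha> \<le> A\<close> by (intro mult_left_mono) auto
  ultimately show ?thesis by (simp add: mult.commute)
qed

text \<open>Double counting of pairs of a face and a selected edge on it: an inner edge counts
  twice, a boundary edge once, so modulo 2 only the boundary edges remain.\<close>

lemma even_boundary_crossings:
  assumes fin: "finite \<E>" "finite F" and D: "\<And>f. f \<in> F \<Longrightarrow> D f \<subseteq> \<E>" and "B \<subseteq> \<E>"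
    and two: "\<And>e. e \<in> \<E> - B \<Longrightarrow> card {f\<in>F. e \<in> D f} = 2"
    and one: "\<And>e. e \<in> B \<Longrightarrow> card {f\<in>F. e \<in> D f} = 1"
    and ev: "\<And>f. f \<in> F \<Longrightarrow> even (card {e\<in>D f. P e})"
  shows "even (card {e\<in>B. P e})"
proof -
  define Q where "Q = {e\<in>\<E>. P e}"
  have finQ: "finite Q" using fin by (simp add: Q_def)
  have "(\<Sum>f\<in>F. card {e\<in>D f. P e}) = (\<Sum>f\<in>F. \<Sum>e\<in>Q. if e \<in> D f then 1 else 0)"
  proof (rule sum.cong)
    fix f assume f: "f \<in> F"
    have "{e\<in>D f. P e} = {e\<in>Q. e \<in> D f}" using D[OF f] by (auto simp: Q_def)
    then show "card {e\<in>D f. P e} = (\<Sum>e\<in>Q. if e \<in> D f then 1 else 0)"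
      using finQ by (simp add: sum.If_cases Int_def)
  qed simp
  also have "\<dots> = (\<Sum>e\<in>Q. \<Sum>f\<in>F. if e \<in> D f then 1 else 0)" by (rule sum.swap)
  also have "\<dots> = (\<Sum>e\<in>Q. card {f\<in>F. e \<in> D f})"
    using fin by (simp add: sum.If_cases Int_def)
  also have "\<dots> = (\<Sum>e\<in>Q \<inter> B. card {f\<in>F. e \<in> D f}) + (\<Sum>e\<in>Q - B. card {f\<in>F. e \<in> D f})"
    using finQ by (subst sum.Int_Diff[of Q _ B]) auto
  also have "(\<Sum>e\<in>Q \<inter> B. card {f\<in>F. e \<in> D f}) = card (Q \<inter> B)"
    using one by simp
  also have "(\<Sum>e\<in>Q - B. card {f\<in>F. e \<in> D f}) = 2 * card (Q - B)"
    using two by (simp add: Q_def)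
  finally have "(\<Sum>f\<in>F. card {e\<in>D f. P e}) = card (Q \<inter> B) + 2 * card (Q - B)" .
  moreover have "even (\<Sum>f\<in>F. card {e\<in>D f. P e})" using ev by (intro dvd_sum) auto
  ultimately have "even (card (Q \<inter> B))" by simp
  moreover have "Q \<inter> B = {e\<in>B. P e}" using \<open>B \<subseteq> \<E>\<close> by (auto simp: Q_def)
  ultimately show ?thesis by simp
qed

text \<open>The hypothesis is integrated over \<open>t\<close> from 0 to 1. Levels outside the unit
  interval add nonnegative terms, so each indicator may be integrated over the whole line, where it
  gives \<open>hi v - lo v\<close>.\<close>

lemma sum_mult_interval_length_ge_1:
  fixes \<mu> lo hi :: "'v \<Rightarrow> real"
  assumes fin: "finite W" and mu: "\<And>v. v \<in> W \<Longrightarrow> 0 \<le> \<mu> v"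
    and le: "\<And>v. v \<in> W \<Longrightarrow> lo v \<le> hi v"
    and ge: "\<And>t. 0 < t \<Longrightarrow> t \<le> 1 \<Longrightarrow> 1 \<le> (\<Sum>v\<in>{v\<in>W. lo v < t \<and> t \<le> hi v}. \<mu> v)"
  shows "1 \<le> (\<Sum>v\<in>W. \<mu> v * (hi v - lo v))"
proof -
  have int: "integrable lborel (\<lambda>t::real. indicator {a<..b} t :: real)" for a b :: real
    by (cases "a \<le> b") (auto simp: emeasure_lborel_Ioc)
  have "1 = integral\<^sup>L lborel (\<lambda>t::real. indicator {0<..1} t :: real)" by simp
  also have "\<dots> \<le> integral\<^sup>L lborel (\<lambda>t. \<Sum>v\<in>W. \<mu> v * indicator {lo v<..hi v} t)"
  proof (rule integral_mono)
    show "integrable lborel (\<lambda>t. \<Sum>v\<in>W. \<mu> v * indicator {lo v<..hi v} t)"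
      by (intro Bochner_Integration.integrable_sum integrable_mult_right int)
    fix t :: real
    have *: "(\<Sum>v\<in>W. \<mu> v * indicator {lo v<..hi v} t) = (\<Sum>v\<in>{v\<in>W. lo v < t \<and> t \<le> hi v}. \<mu> v)"
      using fin by (simp add: indicator_def sum.inter_filter[symmetric] if_distrib Int_def cong: if_cong)
    show "indicator {0<..1} t \<le> (\<Sum>v\<in>W. \<mu> v * indicator {lo v<..hi v} t)"
    proof (cases "0 < t \<and> t \<le> 1")
      case True then show ?thesis using ge * by simp
    next
      case False
      then show ?thesis using mu by (auto simp: indicator_def intro!: sum_nonneg)
    qed
  qed (rule int)
  also have "\<dots> = (\<Sum>v\<in>W. \<mu> v * (hi v - lo v))"
    using le by (subst Bochner_Integration.integral_sum) (auto intro!: sum.cong integrable_mult_right int)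
  finally show ?thesis .
qed

lemma sum_mult_square_le:
  fixes \<mu> p :: "'v \<Rightarrow> real"
  assumes "1 \<le> (\<Sum>v\<in>W. \<mu> v * p v)"
  shows "1 \<le> sqn W \<mu> * sqn W p"
proof -
  have "1\<^sup>2 \<le> (\<Sum>v\<in>W. \<mu> v * p v)\<^sup>2" using assms by (intro power_mono) auto
  also have "\<dots> \<le> sqn W \<mu> * sqn W p"
    unfolding sqn_def by (rule Cauchy_Schwarz_ineq_sum)
  finally show ?thesis by simp
qed

section \<open>Plane graphs\<close>

lemma cis_eq_imp_multiple: "cis x = cis y \<Longrightarrow> \<exists>n::int. x = y + 2 * pi * n"
  using sin_cos_eq_iff[of x y] by (simp add: complex_eq_iff)

lemma cis_neq_of_less:
  assumes "x < y" "y < x + 2 * pi" shows "cis x \<noteq> cis y"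
proof
  assume "cis x = cis y"
  then obtain n :: int where n: "y = x + 2 * pi * n" by (metis cis_eq_imp_multiple)
  then have "0 < 2 * pi * n" "2 * pi * n < 2 * pi * 1" using assms by auto
  then have "0 < n" "n < 1" by (simp_all add: zero_less_mult_iff)
  then show False by simp
qed

text \<open>Both paths are prolonged outside the disk by curves that spiral to the four cardinal
  points of the circle of radius 2; the theorem on crossing paths in a square then applies.\<close>

lemma disk_paths_meet:
  fixes f g :: "real \<Rightarrow> complex"
  assumes pf: "path f" and pg: "path g"
    and fD: "path_image f \<subseteq> cball 0 1" and gD: "path_image g \<subseteq> cball 0 1"
    and fs: "pathstart f = cis \<beta>" and ff: "pathfinish f = cis \<alpha>"
    and gs: "pathstart g = cis \<gamma>" and gf: "pathfinish g = cis \<delta>"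
    and ord: "\<beta> < \<gamma>" "\<gamma> < \<alpha>" "\<alpha> < \<delta>" "\<delta> < \<beta> + 2 * pi"
  shows "path_image f \<inter> path_image g \<noteq> {}"
proof -
  \<comment> \<open>A spiral from angle \<open>\<phi>\<close> on the unit circle to angle
    \<open>\<psi>\<close> on the circle of radius 2; its radius \<open>1 + s\<close> determines the
    parameter.\<close>
  define X where "X = (\<lambda>\<phi> \<psi> s. complex_of_real (1 + s) * cis (\<phi> + s * (\<psi> - \<phi>)))"
  have pX: "path (X \<phi> \<psi>)" for \<phi> \<psi> unfolding path_def X_def cis_conv_exp by (intro continuous_intros)
  have Xs: "pathstart (X \<phi> \<psi>) = cis \<phi>" and Xf: "pathfinish (X \<phi> \<psi>) = 2 * cis \<psi>" for \<phi> \<psi>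
    by (simp_all add: X_def pathstart_def pathfinish_def)
  have nX: "norm (X \<phi> \<psi> s) = 1 + s" if "0 \<le> s" for \<phi> \<psi> s
    using that by (simp add: X_def norm_mult del: of_real_add)
  have XD: "path_image (X \<phi> \<psi>) \<inter> cball 0 1 \<subseteq> {cis \<phi>}" for \<phi> \<psi>
  proof
    fix z assume "z \<in> path_image (X \<phi> \<psi>) \<inter> cball 0 1"
    then obtain s where s: "0 \<le> s" "s \<le> 1" "z = X \<phi> \<psi> s" "norm z \<le> 1"
      by (auto simp: path_image_def)
    then have "s = 0" using nX[of s \<phi> \<psi>] by simp
    then show "z \<in> {cis \<phi>}" using s by (simp add: X_def)
  qed
  \<comment> \<open>Equal radii mean equal parameters, and at each parameter the two angles keep
    their strict order within one full turn.\<close>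
  have XX: "path_image (X \<phi> \<psi>) \<inter> path_image (X \<phi>' \<psi>') = {}"
    if o: "\<phi> < \<phi>'" "\<phi>' < \<phi> + 2 * pi" "\<psi> < \<psi>'" "\<psi>' < \<psi> + 2 * pi" for \<phi> \<psi> \<phi>' \<psi>'
  proof (rule ccontr)
    assume "\<not> ?thesis"
    then obtain s s' where s: "0 \<le> s" "s \<le> 1" "0 \<le> s'" "s' \<le> 1" and eq: "X \<phi> \<psi> s = X \<phi>' \<psi>' s'"
      by (auto simp: path_image_def)
    from eq have "norm (X \<phi> \<psi> s) = norm (X \<phi>' \<psi>' s')" by simp
    then have ss: "s' = s" using nX s by simp
    have l: "\<phi> + s * (\<psi> - \<phi>) < \<phi>' + s * (\<psi>' - \<phi>')"
    proof -
      have "(1-s) * \<phi> + s * \<psi> < (1-s) * \<phi>' + s * \<psi>'"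
      proof (cases "s = 0")
        case False
        then have "s * \<psi> < s * \<psi>'" using s o by simp
        moreover have "(1-s) * \<phi> \<le> (1-s) * \<phi>'" using s o by (intro mult_left_mono) auto
        ultimately show ?thesis by simp
      qed (use o in simp)
      then show ?thesis by (simp add: algebra_simps)
    qed
    have r: "\<phi>' + s * (\<psi>' - \<phi>') < \<phi> + s * (\<psi> - \<phi>) + 2 * pi"
    proof -
      have "(1-s) * \<phi>' + s * \<psi>' < (1-s) * (\<phi> + 2 * pi) + s * (\<psi> + 2 * pi)"
      proof (cases "s = 0")
        case False
        then have "s * \<psi>' < s * (\<psi> + 2 * pi)" using s o by simp
        moreover have "(1-s) * \<phi>' \<le> (1-s) * (\<phi> + 2 * pi)" using s o by (intro mult_left_mono) auto
        ultimately show ?thesis by simp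
      qed (use o in simp)
      then show ?thesis by (simp add: algebra_simps)
    qed
    have "complex_of_real (1 + s) \<noteq> 0" using s by (simp del: of_real_add)
    then have "cis (\<phi> + s * (\<psi> - \<phi>)) = cis (\<phi>' + s * (\<psi>' - \<phi>'))"
      using eq ss by (simp add: X_def)
    with cis_neq_of_less[OF l r] show False by blast
  qed
  have cis3: "cis (3/2*pi) = - \<i>"
    using sin_3over2_pi cos_3over2_pi by (simp add: complex_eq_iff del: sin_3over2_pi cos_3over2_pi)
  \<comment> \<open>The given angles have the cyclic order of 0, \<open>pi/2\<close>,
    \<open>pi\<close>, \<open>3/2*pi\<close>, so the spirals are disjoint where needed,
    \<open>F\<close> runs from left to right and \<open>G\<close> from bottom to top.\<close>
  define a b c d where "a = X \<alpha> pi" and "b = X \<beta> 0" and "c = X \<gamma> (pi/2)" and "d = X \<delta> (3/2*pi)"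
  define F where "F = reversepath a +++ reversepath f +++ b"
  define G where "G = reversepath d +++ reversepath g +++ c"
  have pp: "path a" "path b" "path c" "path d" by (simp_all add: a_def b_def c_def d_def pX)
  have st: "pathstart a = cis \<alpha>" "pathstart b = cis \<beta>" "pathstart c = cis \<gamma>" "pathstart d = cis \<delta>"
    by (simp_all add: a_def b_def c_def d_def Xs)
  have fin: "pathfinish a = -2" "pathfinish b = 2" "pathfinish c = 2 * \<i>" "pathfinish d = - (2 * \<i>)"
    by (simp_all add: a_def b_def c_def d_def Xf cis3 cis3[simplified])
  have pF: "path F" "pathstart F = -2" "pathfinish F = 2"
    using pp st fin pf fs ff by (simp_all add: F_def)
  have pG: "path G" "pathstart G = - (2 * \<i>)" "pathfinish G = 2 * \<i>"
    using pp st fin pg gs gf by (simp_all add: G_def)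
  have iF: "path_image F = path_image a \<union> path_image f \<union> path_image b"
    using pp st pf fs ff by (simp add: F_def path_image_join Un_assoc)
  have iG: "path_image G = path_image d \<union> path_image g \<union> path_image c"
    using pp st pg gs gf by (simp add: G_def path_image_join Un_assoc)
  have XB: "path_image (X \<phi> \<psi>) \<subseteq> cball 0 2" for \<phi> \<psi>
    using nX by (force simp: path_image_def)
  have FB: "path_image F \<subseteq> cball 0 2" and GB: "path_image G \<subseteq> cball 0 2"
    using XB fD gD unfolding iF iG a_def b_def c_def d_def by (force simp: subset_iff)+
  define T :: "complex \<Rightarrow> real^2" where "T = (\<lambda>z. vector [Re z / 2, Im z / 2])"
  have contT: "continuous_on S T" for S
  proof -
    have "linear T"
      by (rule linearI) (auto simp: T_def vec_eq_iff forall_2 add_divide_distrib)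
    then show ?thesis by (simp add: linear_continuous_on linear_conv_bounded_linear)
  qed
  have injT: "T z = T w \<Longrightarrow> z = w" for z w
    unfolding T_def by (metis complex_eqI field_sum_of_halves vector_2(1) vector_2(2))
  have boxT: "T ` cball 0 2 \<subseteq> cbox (-1) 1"
  proof
    fix x assume "x \<in> T ` cball 0 2"
    then obtain z where z: "x = T z" "norm z \<le> 2" by auto
    have "\<bar>Re z\<bar> \<le> 2" "\<bar>Im z\<bar> \<le> 2"
      using z abs_Re_le_cmod[of z] abs_Im_le_cmod[of z] by linarith+
    then show "x \<in> cbox (-1) 1" by (auto simp: z T_def mem_box_cart forall_2)
  qed
  obtain y where y: "y \<in> path_image (T \<circ> F)" "y \<in> path_image (T \<circ> G)"
  proof (rule fashoda_unit_path[of "T \<circ> F" "T \<circ> G"])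
    show "path (T \<circ> F)" "path (T \<circ> G)" using pF pG contT by (auto intro: path_continuous_image)
    show "path_image (T \<circ> F) \<subseteq> cbox (-1) 1" "path_image (T \<circ> G) \<subseteq> cbox (-1) 1"
      using boxT FB GB by (auto simp: path_image_compose)
    show "pathstart (T \<circ> F) $ 1 = - 1" "pathfinish (T \<circ> F) $ 1 = 1"
      "pathstart (T \<circ> G) $ 2 = - 1" "pathfinish (T \<circ> G) $ 2 = 1"
      using pF pG by (simp_all add: pathstart_compose pathfinish_compose T_def)
  qed
  then obtain z where z: "z \<in> path_image F" "z \<in> path_image G"
    using injT by (auto simp: path_image_compose)
  have f_ends: "cis \<alpha> \<in> path_image f" "cis \<beta> \<in> path_image f"
    using pathfinish_in_path_image[of f] pathstart_in_path_image[of f] fs ff by auto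
  have g_ends: "cis \<gamma> \<in> path_image g" "cis \<delta> \<in> path_image g"
    using pathfinish_in_path_image[of g] pathstart_in_path_image[of g] gs gf by auto
  have disj: "path_image a \<inter> path_image d = {}" "path_image b \<inter> path_image c = {}"
    "path_image c \<inter> path_image a = {}" "path_image b \<inter> path_image d = {}"
    unfolding a_def b_def c_def d_def using ord pi_gt_zero by (intro XX; simp)+
  \<comment> \<open>Inside the closed disk a spiral consists of its foot alone, which is an end of
    the given path. Outside only spirals could meet, and \<open>disj\<close> excludes that.\<close>
  have onF: "z \<in> path_image f" if "z \<in> path_image a \<union> path_image b" "z \<in> cball 0 1"
  proof -
    have "z = cis \<alpha> \<or> z = cis \<beta>" using that XD unfolding a_def b_def by blast
    then show ?thesis using f_ends by auto
  qed
  have onG: "z \<in> path_image g" if "z \<in> path_image c \<union> path_image d" "z \<in> cball 0 1"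
  proof -
    have "z = cis \<gamma> \<or> z = cis \<delta>" using that XD unfolding c_def d_def by blast
    then show ?thesis using g_ends by auto
  qed
  have "z \<in> cball 0 1"
  proof (rule ccontr)
    assume no: "z \<notin> cball 0 1"
    then have "z \<in> path_image a \<or> z \<in> path_image b" "z \<in> path_image c \<or> z \<in> path_image d"
      using z fD gD unfolding iF iG by (meson UnE subsetD)+
    then show False using disj by (metis IntI empty_iff)
  qed
  then have "z \<in> path_image f" "z \<in> path_image g"
    using z onF onG unfolding iF iG by (meson UnE UnI1 UnI2)+
  then show ?thesis by blast
qed

definition ends :: "complex set \<Rightarrow> complex set" where
  "ends e = closure e - e"

text \<open>Edges are point sets without their ends, as open 1-cells are. \<open>arc\<close> rules
  out loops and \<open>inj_ends\<close> rules out multiple edges; the shape of the arcs is otherwise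
  arbitrary.\<close>

locale plane_graph =
  fixes V :: "complex set" and E :: "complex set set"
  assumes finV: "finite V" and finE: "finite E"
    and edge_arc: "\<And>e. e \<in> E \<Longrightarrow> \<exists>g. arc g \<and> pathstart g \<in> V \<and> pathfinish g \<in> V
          \<and> e = path_image g - {pathstart g, pathfinish g}"
    and edge_V: "\<And>e. e \<in> E \<Longrightarrow> e \<inter> V = {}"
    and edge_disj: "\<And>e e'. e \<in> E \<Longrightarrow> e' \<in> E \<Longrightarrow> e \<noteq> e' \<Longrightarrow> e \<inter> e' = {}"
    and inj_ends: "inj_on ends E"
begin

lemma edge_arcE:
  assumes "e \<in> E"
  obtains g where "arc g" "e = g ` {0<..<1}" "closure e = path_image g"
    "ends e = {pathstart g, pathfinish g}" "pathstart g \<noteq> pathfinish g"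
    "pathstart g \<in> V" "pathfinish g \<in> V"
proof -
  obtain g where g: "arc g" "pathstart g \<in> V" "pathfinish g \<in> V"
    "e = path_image g - {pathstart g, pathfinish g}"
    using edge_arc[OF assms] by blast
  have inj: "inj_on g {0..1}" and cont: "continuous_on {0..1} g"
    using g(1) by (auto simp: arc_def path_def)
  have "{0..1} = {0<..<1} \<union> {0, 1::real}" by auto
  then have pi: "path_image g = g ` {0<..<1} \<union> {pathstart g, pathfinish g}"
    by (auto simp: path_image_def pathstart_def pathfinish_def)
  have "pathstart g \<notin> g ` {0<..<1}" "pathfinish g \<notin> g ` {0<..<1}"
    by (auto simp: pathstart_def pathfinish_def dest: inj_onD[OF inj])
  then have e: "e = g ` {0<..<1}" using g(4) pi by auto
  have "g ` closure {0<..<1} \<subseteq> closure (g ` {0<..<1})"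
    by (rule image_closure_subset) (use cont closure_subset[of "g ` {0<..<1}"] in auto)
  then have "path_image g \<subseteq> closure e" by (simp add: e path_image_def)
  moreover have "closure e \<subseteq> path_image g"
    using g(1) by (intro closure_minimal) (auto simp: g(4) arc_imp_path closed_path_image)
  ultimately have cl: "closure e = path_image g" by auto
  then have en: "ends e = {pathstart g, pathfinish g}"
    using g(4) by (auto simp: ends_def pathstart_in_path_image pathfinish_in_path_image)
  have "pathstart g \<noteq> pathfinish g" using g(1) arc_distinct_ends by metis
  with that g e cl en show thesis by blast
qed

lemma
  assumes "e \<in> E"
  shows card_ends: "card (ends e) = 2" and ends_V: "ends e \<subseteq> V" and connected_edge: "connected e"
    and edge_ne: "e \<noteq> {}" and closure_edge: "closure e = e \<union> ends e"
proof -
  obtain g where g: "arc g" "e = g ` {0<..<1}" "closure e = path_image g"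
    "ends e = {pathstart g, pathfinish g}" "pathstart g \<noteq> pathfinish g"
    "pathstart g \<in> V" "pathfinish g \<in> V" using edge_arcE[OF assms] .
  show "card (ends e) = 2" "ends e \<subseteq> V" using g by auto
  have "continuous_on {0<..<1} g"
    using g(1) by (auto simp: arc_def path_def intro: continuous_on_subset)
  then show "connected e" using g(2) by (auto intro: connected_continuous_image)
  show "e \<noteq> {}" using g(2) by simp
  show "closure e = e \<union> ends e" using closure_subset by (auto simp: ends_def)
qed

lemma closure_edge_disj:
  assumes "e \<in> E" "e' \<in> E" "e \<noteq> e'" shows "e \<inter> closure e' = {}"
proof -
  have "e \<inter> ends e' \<subseteq> e \<inter> V" using ends_V[OF assms(2)] by (rule Int_mono[OF order_refl])
  then have "e \<inter> ends e' = {}" using edge_V[OF assms(1)] by simp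
  then show ?thesis
    using edge_disj[OF assms] by (simp add: closure_edge[OF assms(2)] Int_Un_distrib)
qed

text \<open>Off the vertices, the closure of \<open>e\<close> and the union of the closures of the
  other edges are disjoint. Both are closed since there are finitely many edges, so a connected set
  cannot meet both.\<close>

lemma connected_in_edge:
  assumes I: "connected I" "I \<subseteq> \<Union>E" "e \<in> E" "I \<inter> e \<noteq> {}"
  shows "I \<subseteq> e"
proof -
  let ?A = "closure e" and ?B = "\<Union>e'\<in>E - {e}. closure e'"
  have "?A \<inter> ?B \<inter> I = {}"
  proof (rule ccontr)
    assume "\<not> ?thesis"
    then obtain x e' where x: "x \<in> closure e" "e' \<in> E" "e' \<noteq> e" "x \<in> closure e'" "x \<in> I" by auto
    then obtain e'' where "e'' \<in> E" "x \<in> e''" using I by auto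
    with x closure_edge_disj[of e'' e] closure_edge_disj[of e'' e'] I(3) show False by blast
  qed
  moreover have "I \<subseteq> ?A \<union> ?B" using I(2) closure_subset by blast
  ultimately have "?A \<inter> I = {} \<or> ?B \<inter> I = {}"
    using finE by (intro connected_closedD[OF I(1)]) auto
  then have "?B \<inter> I = {}" using I(4) closure_subset by blast
  then show ?thesis using I(2) closure_subset by blast
qed

text \<open>By connectedness the open piece lies in one edge \<open>e\<close>. Pulled back to the
  parameter interval of \<open>e\<close> it is open, as an injective continuous image of an
  interval, and relatively closed, because its two end points are vertices and add nothing on
  \<open>e\<close>. Hence it is all of \<open>e\<close>.\<close>

lemma gap_edge:
  fixes \<gamma> :: "real \<Rightarrow> complex"
  assumes less: "s < s'" and cont: "continuous_on {s..s'} \<gamma>" and inj: "inj_on \<gamma> {s<..<s'}"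
    and V: "\<gamma> s \<in> V" "\<gamma> s' \<in> V" and noV: "\<gamma> ` {s<..<s'} \<inter> V = {}"
    and sub: "\<gamma> ` {s..s'} \<subseteq> V \<union> \<Union>E"
  shows "\<gamma> ` {s<..<s'} \<in> E" "ends (\<gamma> ` {s<..<s'}) = {\<gamma> s, \<gamma> s'}"
proof -
  let ?I = "\<gamma> ` {s<..<s'}"
  have cont': "continuous_on {s<..<s'} \<gamma>" using cont by (rule continuous_on_subset) auto
  have conn: "connected ?I" by (rule connected_continuous_image[OF cont']) simp
  have I_ne: "?I \<noteq> {}" using less by simp
  have "?I \<subseteq> \<gamma> ` {s..s'}" by auto
  then have I_sub: "?I \<subseteq> \<Union>E" using sub noV by blast
  then obtain e where e: "e \<in> E" "?I \<inter> e \<noteq> {}" using I_ne by blast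
  have Ie: "?I \<subseteq> e" using connected_in_edge[OF conn I_sub e] .
  obtain g where g: "arc g" "e = g ` {0<..<1}" "closure e = path_image g"
    using edge_arcE[OF e(1)] by metis
  obtain h where h: "homeomorphism {0..1} (path_image g) g h" using homeomorphism_arc[OF g(1)] .
  have hg: "h (g x) = x" if "0 \<le> x" "x \<le> 1" for x using h that by (auto simp: homeomorphism_def)
  have gh: "g (h y) = y" if "y \<in> path_image g" for y using h that by (auto simp: homeomorphism_def)
  have eP: "e \<subseteq> path_image g" by (metis g(3) closure_subset)
  have conth: "continuous_on (path_image g) h" using h by (auto simp: homeomorphism_def)
  have contg: "continuous_on {0..1} g" using h by (auto simp: homeomorphism_def)
  have "continuous_on {s<..<s'} (h \<circ> \<gamma>)"
    using cont' Ie eP by (intro continuous_on_compose[OF cont'] continuous_on_subset[OF conth]) auto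
  moreover have "inj_on (h \<circ> \<gamma>) {s<..<s'}"
  proof (rule comp_inj_on[OF inj])
    show "inj_on h ?I" using gh Ie eP by (intro inj_on_inverseI[of _ g]) auto
  qed
  ultimately have op: "open ((h \<circ> \<gamma>) ` {s<..<s'})"
    using injective_eq_1d_open_map_UNIV[of "{s<..<s'}" "h \<circ> \<gamma>"] by (auto simp: is_interval_oo)
  let ?O = "(h \<circ> \<gamma>) ` {s<..<s'}"
  let ?K = "\<gamma> ` {s..s'}"
  have K: "?K = ?I \<union> {\<gamma> s, \<gamma> s'}"
  proof -
    have "{s..s'} = {s<..<s'} \<union> {s, s'}" using less by auto
    then show ?thesis by auto
  qed
  have Ke: "?K \<inter> e = ?I" using K Ie edge_V[OF e(1)] V by auto
  have O: "?O = {0<..<1} \<inter> g -` ?K"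
  proof
    show "?O \<subseteq> {0<..<1} \<inter> g -` ?K"
    proof
      fix x assume "x \<in> ?O"
      then obtain r where r: "s < r" "r < s'" "x = h (\<gamma> r)" by auto
      then have "\<gamma> r \<in> e" using Ie by auto
      then obtain y where y: "0 < y" "y < 1" "\<gamma> r = g y" using g by auto
      then have "x = y" using r hg by simp
      moreover have "\<gamma> r \<in> ?K" using r by simp
      ultimately show "x \<in> {0<..<1} \<inter> g -` ?K" using y by simp
    qed
    show "{0<..<1} \<inter> g -` ?K \<subseteq> ?O"
    proof
      fix x assume x: "x \<in> {0<..<1} \<inter> g -` ?K"
      then have "g x \<in> ?K \<inter> e" using g by auto
      then have "g x \<in> ?I" using Ke by simp
      then have "h (g x) \<in> ?O" by auto
      then show "x \<in> ?O" using x hg by auto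
    qed
  qed
  have "closed ?K" using cont by (intro compact_imp_closed compact_continuous_image) auto
  then have "closedin (top_of_set {0<..<1}) ({0<..<1} \<inter> g -` ?K)"
    by (intro continuous_closedin_preimage continuous_on_subset[OF contg]) auto
  moreover have "openin (top_of_set {0<..<1}) ({0<..<1} \<inter> g -` ?K)"
    using op O by (metis Int_lower1 open_subset)
  moreover have "{0<..<1} \<inter> g -` ?K \<noteq> {}" using O I_ne by blast
  ultimately have "{0<..<1} \<inter> g -` ?K = {0<..<1}"
    using connected_clopen[of "{0<..<1::real}"] connected_Ioo by blast
  with O have "?O = {0<..<1}" by simp
  then have "e = g ` ?O" using g by simp
  also have "\<dots> = (\<lambda>r. g (h (\<gamma> r))) ` {s<..<s'}" by (simp add: image_comp o_def)
  also have "\<dots> = ?I" by (intro image_cong[OF refl] gh) (use Ie eP in blast)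
  finally have eI: "e = ?I" .
  show "?I \<in> E" using eI e by simp
  have "closure ?I = ?K"
  proof
    show "closure ?I \<subseteq> ?K" using \<open>closed ?K\<close> by (intro closure_minimal) auto
    have "\<gamma> ` closure {s<..<s'} \<subseteq> closure ?I"
    proof (rule image_closure_subset)
      show "continuous_on (closure {s<..<s'}) \<gamma>" using cont less by simp
    qed (simp_all add: closure_subset)
    then show "?K \<subseteq> closure ?I" using less by simp
  qed
  then have "ends ?I = (?I \<union> {\<gamma> s, \<gamma> s'}) - ?I" by (simp only: ends_def K)
  then show "ends ?I = {\<gamma> s, \<gamma> s'}" using V noV by blast
qed

end

section \<open>Loops in a plane graph\<close>

lemma even_sign_changes:
  fixes c :: "nat \<Rightarrow> bool"
  shows "even (card {i. i < n \<and> c i \<noteq> c (Suc i)}) \<longleftrightarrow> c 0 = c n"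
proof (induction n)
  case (Suc n)
  have "{i. i < Suc n \<and> c i \<noteq> c (Suc i)} =
      (if c n \<noteq> c (Suc n) then insert n {i. i < n \<and> c i \<noteq> c (Suc i)} else {i. i < n \<and> c i \<noteq> c (Suc i)})"
    by (auto simp: less_Suc_eq)
  then show ?case using Suc by auto
qed auto

locale graph_loop = plane_graph +
  fixes \<gamma> :: "real \<Rightarrow> complex"
  assumes cont: "continuous_on {0..1} \<gamma>" and closed_loop: "\<gamma> 0 = \<gamma> 1" and base: "\<gamma> 0 \<in> V"
    and inj: "inj_on \<gamma> {0..<1}" and in_graph: "\<gamma> ` {0..1} \<subseteq> V \<union> \<Union>E"
begin

definition marks :: "real list" where
  "marks = sorted_list_of_set {t\<in>{0..1}. \<gamma> t \<in> V}"

text \<open>The base point is marked at 0 and again at 1, so there is one edge fewer than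
  marks.\<close>

definition steps :: nat where "steps = length marks - 1"

definition gap :: "nat \<Rightarrow> complex set" where
  "gap i = \<gamma> ` {marks ! i<..<marks ! Suc i}"

lemma finite_times: "finite {t\<in>{0..1}. \<gamma> t \<in> V}"
proof -
  have "finite (\<gamma> -` V \<inter> {0..<1})" by (rule finite_vimage_IntI[OF finV inj])
  then have "finite (insert 1 (\<gamma> -` V \<inter> {0..<1}))" by simp
  then show ?thesis by (rule finite_subset[rotated]) auto
qed

lemma set_times: "set marks = {t\<in>{0..1}. \<gamma> t \<in> V}"
  unfolding marks_def by (rule set_sorted_list_of_set[OF finite_times])

lemma sorted_times: "sorted_wrt (<) marks"
  by (simp add: marks_def strict_sorted_list_of_set)

lemma times_ne: "{0, 1} \<subseteq> set marks"
  using base closed_loop by (simp add: set_times)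

lemma length_times: "length marks = Suc steps" and steps_pos: "0 < steps"
proof -
  have "card {0, 1::real} \<le> card (set marks)" using times_ne by (intro card_mono) auto
  also have "\<dots> \<le> length marks" by (rule card_length)
  finally have "2 \<le> length marks" by simp
  then show "length marks = Suc steps" "0 < steps" by (auto simp: steps_def)
qed

lemma times_less: "i < j \<Longrightarrow> j \<le> steps \<Longrightarrow> marks ! i < marks ! j"
  using sorted_times length_times by (simp add: sorted_wrt_iff_nth_less)

lemma times_mem: "i \<le> steps \<Longrightarrow> 0 \<le> marks ! i \<and> marks ! i \<le> 1 \<and> \<gamma> (marks ! i) \<in> V"
  using nth_mem[of i marks] set_times length_times by auto

lemma times_ex: "0 \<le> t \<Longrightarrow> t \<le> 1 \<Longrightarrow> \<gamma> t \<in> V \<Longrightarrow> \<exists>i\<le>steps. t = marks ! i"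
  using set_times length_times by (metis (mono_tags, lifting) atLeastAtMost_iff in_set_conv_nth less_Suc_eq_le mem_Collect_eq)

lemma times_0: "marks ! 0 = 0" and times_steps: "marks ! steps = 1"
proof -
  obtain i where i: "i \<le> steps" "0 = marks ! i" using times_ex[of 0] base by auto
  show "marks ! 0 = 0" using i times_less[of 0 i] times_mem[of 0] by (cases "i = 0") auto
  obtain j where j: "j \<le> steps" "1 = marks ! j" using times_ex[of 1] base closed_loop by auto
  show "marks ! steps = 1"
    using j times_less[of j steps] times_mem[of steps] by (cases "j = steps") auto
qed

lemma gap_no_time:
  assumes "i < steps" "marks ! i < t" "t < marks ! Suc i" shows "\<gamma> t \<notin> V"
proof
  assume "\<gamma> t \<in> V"
  moreover have "0 \<le> t" "t \<le> 1" using assms times_mem[of i] times_mem[of "Suc i"] by auto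
  ultimately obtain j where j: "j \<le> steps" "t = marks ! j" using times_ex by blast
  have "i < j" using assms j times_less[of j i] by (metis less_imp_le linorder_neqE_nat not_less_iff_gr_or_eq)
  moreover have "j < Suc i"
    using assms j times_less[of "Suc i" j] by (metis linorder_neqE_nat not_less_iff_gr_or_eq)
  ultimately show False by simp
qed

lemma gap_E: "i < steps \<Longrightarrow> gap i \<in> E"
  and ends_gap: "i < steps \<Longrightarrow> ends (gap i) = {\<gamma> (marks ! i), \<gamma> (marks ! Suc i)}"
proof -
  assume i: "i < steps"
  have r: "0 \<le> marks ! i" "marks ! Suc i \<le> 1" using times_mem[of i] times_mem[of "Suc i"] i by auto
  have sub: "{marks ! i..marks ! Suc i} \<subseteq> {0..1}" "{marks ! i<..<marks ! Suc i} \<subseteq> {0..<1}"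
    using r by auto
  have *: "marks ! i < marks ! Suc i" "continuous_on {marks ! i..marks ! Suc i} \<gamma>"
    "inj_on \<gamma> {marks ! i<..<marks ! Suc i}" "\<gamma> (marks ! i) \<in> V" "\<gamma> (marks ! Suc i) \<in> V"
    "\<gamma> ` {marks ! i<..<marks ! Suc i} \<inter> V = {}" "\<gamma> ` {marks ! i..marks ! Suc i} \<subseteq> V \<union> \<Union>E"
  proof -
    show "marks ! i < marks ! Suc i" using times_less i by simp
    show "continuous_on {marks ! i..marks ! Suc i} \<gamma>" by (rule continuous_on_subset[OF cont sub(1)])
    show "inj_on \<gamma> {marks ! i<..<marks ! Suc i}" by (rule inj_on_subset[OF inj sub(2)])
    show "\<gamma> (marks ! i) \<in> V" "\<gamma> (marks ! Suc i) \<in> V"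
      using times_mem[of i] times_mem[of "Suc i"] i by auto
    show "\<gamma> ` {marks ! i<..<marks ! Suc i} \<inter> V = {}" using gap_no_time[OF i] by auto
    show "\<gamma> ` {marks ! i..marks ! Suc i} \<subseteq> V \<union> \<Union>E" using image_mono[OF sub(1)] in_graph by (rule order_trans)
  qed
  show "gap i \<in> E" "ends (gap i) = {\<gamma> (marks ! i), \<gamma> (marks ! Suc i)}"
    unfolding gap_def using gap_edge[OF *] by auto
qed

lemma gap_ex:
  assumes "0 \<le> t" "t \<le> 1" "\<gamma> t \<notin> V"
  shows "\<exists>i<steps. marks ! i < t \<and> t < marks ! Suc i"
proof -
  define j where "j = (LEAST j. j \<le> steps \<and> t \<le> marks ! j)"
  have ex: "steps \<le> steps \<and> t \<le> marks ! steps" using assms times_steps by simp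
  have j: "j \<le> steps" "t \<le> marks ! j" using LeastI[of "\<lambda>j. j \<le> steps \<and> t \<le> marks ! j", OF ex] by (auto simp: j_def)
  have "marks ! j \<noteq> t" using j assms times_mem[of j] by auto
  then have tj: "t < marks ! j" using j by simp
  then have "j \<noteq> 0" using times_0 assms by (metis not_less)
  then obtain i where i: "j = Suc i" by (cases j) auto
  have "\<not> (i \<le> steps \<and> t \<le> marks ! i)" using not_less_Least[of i "\<lambda>j. j \<le> steps \<and> t \<le> marks ! j"] i by (auto simp: j_def)
  then show ?thesis using i j tj by (intro exI[of _ i]) auto
qed

text \<open>A point of an edge is passed strictly between two consecutive marks, and by
  \<open>gap_edge\<close> that stretch of the loop is the entire edge.\<close>

lemma loop_edges: "{e\<in>E. e \<inter> \<gamma> ` {0..1} \<noteq> {}} = gap ` {..<steps}"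
proof
  show "{e\<in>E. e \<inter> \<gamma> ` {0..1} \<noteq> {}} \<subseteq> gap ` {..<steps}"
  proof
    fix e assume "e \<in> {e\<in>E. e \<inter> \<gamma> ` {0..1} \<noteq> {}}"
    then obtain t where t: "e \<in> E" "0 \<le> t" "t \<le> 1" "\<gamma> t \<in> e" by auto
    then have "\<gamma> t \<notin> V" using edge_V by blast
    then obtain i where i: "i < steps" "marks ! i < t" "t < marks ! Suc i" using gap_ex t by blast
    then have "\<gamma> t \<in> gap i" by (auto simp: gap_def)
    then have "e = gap i" using t edge_disj[of e "gap i"] gap_E[OF i(1)] by blast
    then show "e \<in> gap ` {..<steps}" using i by auto
  qed
  show "gap ` {..<steps} \<subseteq> {e\<in>E. e \<inter> \<gamma> ` {0..1} \<noteq> {}}"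
  proof
    fix e assume "e \<in> gap ` {..<steps}"
    then obtain i where i: "i < steps" "e = gap i" by auto
    have "{marks ! i<..<marks ! Suc i} \<subseteq> {0..1}"
      using times_mem[of i] times_mem[of "Suc i"] i by auto
    then have "gap i \<subseteq> \<gamma> ` {0..1}" by (auto simp: gap_def)
    then show "e \<in> {e\<in>E. e \<inter> \<gamma> ` {0..1} \<noteq> {}}"
      using gap_E[OF i(1)] edge_ne[OF gap_E[OF i(1)]] by (simp add: i(2) Int_absorb2)
  qed
qed

lemma gap_subset: "i < steps \<Longrightarrow> gap i \<subseteq> \<gamma> ` {0..1}"
  using times_mem[of i] times_mem[of "Suc i"] by (force simp: gap_def)

lemma edge_subset_loop: "e \<in> E \<Longrightarrow> e \<inter> \<gamma> ` {0..1} \<noteq> {} \<Longrightarrow> e \<subseteq> \<gamma> ` {0..1}"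
  using loop_edges gap_subset by blast

lemma edges_in_loop: "{e\<in>E. e \<subseteq> \<gamma> ` {0..1}} = gap ` {..<steps}"
proof
  show "gap ` {..<steps} \<subseteq> {e\<in>E. e \<subseteq> \<gamma> ` {0..1}}" using gap_E gap_subset by auto
  show "{e\<in>E. e \<subseteq> \<gamma> ` {0..1}} \<subseteq> gap ` {..<steps}"
    unfolding loop_edges[symmetric] using edge_ne by (auto simp: Int_absorb2)
qed

lemma inj_gap: "inj_on gap {..<steps}"
proof -
  have "gap i \<noteq> gap j" if ij: "i < j" "j < steps" for i j
  proof
    assume eq: "gap i = gap j"
    obtain s where s: "marks ! i < s" "s < marks ! Suc i" using dense times_less[of i "Suc i"] ij by auto
    then have "\<gamma> s \<in> gap j" using eq by (auto simp: gap_def)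
    then obtain s' where s': "marks ! j < s'" "s' < marks ! Suc j" "\<gamma> s = \<gamma> s'" by (auto simp: gap_def)
    have "marks ! Suc i \<le> marks ! j" using ij times_less[of "Suc i" j] by (cases "Suc i = j") auto
    moreover have "0 \<le> s" using s times_mem[of i] ij by auto
    moreover have "s' < 1" using s' times_mem[of "Suc j"] ij by auto
    ultimately show False using s s' inj_onD[OF inj, of s s'] by auto
  qed
  then show ?thesis by (intro linorder_inj_onI) auto
qed

text \<open>Membership in \<open>K\<close> of the successive vertices flips exactly along the
  counted edges, and after a full turn it is back at its initial value.\<close>

lemma even_loop_cut: "even (card {e\<in>E. e \<subseteq> \<gamma> ` {0..1} \<and> card (ends e \<inter> K) = 1})"
proof -
  let ?c = "\<lambda>i. \<gamma> (marks ! i) \<in> K"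
  have "{e\<in>E. e \<subseteq> \<gamma> ` {0..1} \<and> card (ends e \<inter> K) = 1} = gap ` {i. i < steps \<and> ?c i \<noteq> ?c (Suc i)}"
  proof -
    have "{e\<in>E. e \<subseteq> \<gamma> ` {0..1} \<and> card (ends e \<inter> K) = 1} = {e\<in>gap ` {..<steps}. card (ends e \<inter> K) = 1}"
      unfolding edges_in_loop[symmetric] by blast
    moreover have cc: "card (ends (gap i) \<inter> K) = 1 \<longleftrightarrow> ?c i \<noteq> ?c (Suc i)" if "i < steps" for i
    proof -
      have "\<gamma> (marks ! i) \<noteq> \<gamma> (marks ! Suc i)"
        using card_ends[OF gap_E[OF that]] ends_gap[OF that] by auto
      then show ?thesis using ends_gap[OF that] by (auto simp: Int_insert_left)
    qed
    from cc have "{e\<in>gap ` {..<steps}. card (ends e \<inter> K) = 1} = gap ` {i. i < steps \<and> ?c i \<noteq> ?c (Suc i)}"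
      by auto
    ultimately show ?thesis by simp
  qed
  then have "card {e\<in>E. e \<subseteq> \<gamma> ` {0..1} \<and> card (ends e \<inter> K) = 1} = card {i. i < steps \<and> ?c i \<noteq> ?c (Suc i)}"
    using card_image[OF inj_on_subset[OF inj_gap]] by (metis (no_types, lifting) lessThan_iff mem_Collect_eq subsetI)
  then show ?thesis using even_sign_changes[of steps ?c] times_0 times_steps closed_loop by simp
qed

lemma loop_vertices: "V \<inter> \<gamma> ` {0..1} = (\<lambda>i. \<gamma> (marks ! i)) ` {..<steps}"
proof
  show "V \<inter> \<gamma> ` {0..1} \<subseteq> (\<lambda>i. \<gamma> (marks ! i)) ` {..<steps}"
  proof
    fix v assume "v \<in> V \<inter> \<gamma> ` {0..1}"
    then obtain i where i: "i \<le> steps" "v = \<gamma> (marks ! i)" using times_ex by fastforce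
    show "v \<in> (\<lambda>i. \<gamma> (marks ! i)) ` {..<steps}"
    proof (cases "i = steps")
      case True
      then have "v = \<gamma> (marks ! 0)" using i times_0 times_steps closed_loop by simp
      then show ?thesis using steps_pos by blast
    qed (use i in auto)
  qed
  show "(\<lambda>i. \<gamma> (marks ! i)) ` {..<steps} \<subseteq> V \<inter> \<gamma> ` {0..1}" using times_mem by fastforce
qed

lemma inj_loop_vertices: "inj_on (\<lambda>i. \<gamma> (marks ! i)) {..<steps}"
proof (rule linorder_inj_onI)
  fix i j assume ij: "i < j" "i \<in> {..<steps}" "j \<in> {..<steps}"
  then have "marks ! i < marks ! j" "marks ! j < marks ! steps" by (auto intro!: times_less)
  then show "\<gamma> (marks ! i) \<noteq> \<gamma> (marks ! j)"
    using inj_onD[OF inj, of "marks ! i" "marks ! j"] times_mem[of i] times_steps ij by auto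
qed auto

text \<open>One step would be an edge with a single end, and two steps would be two edges with the
  same ends.\<close>

lemma steps_ge_3: "3 \<le> steps"
proof (rule ccontr)
  assume "\<not> ?thesis"
  then consider "steps = 1" | "steps = 2" using steps_pos by linarith
  then show False
  proof cases
    case 1
    then have "ends (gap 0) = {\<gamma> 0}" using ends_gap[of 0] times_0 times_steps closed_loop by auto
    then show False using card_ends[OF gap_E[of 0]] 1 by simp
  next
    case 2
    then have "marks ! Suc (Suc 0) = 1" using times_steps by (simp add: numeral_2_eq_2)
    then have "ends (gap 0) = ends (gap 1)"
      using ends_gap[of 0] ends_gap[of 1] times_0 closed_loop 2 by auto
    then have "gap 0 = gap 1" using inj_onD[OF inj_ends, of "gap 0" "gap 1"] gap_E 2 by simp
    then show False using inj_onD[OF inj_gap, of 0 1] 2 by simp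
  qed
qed

text \<open>By \<open>steps_ge_3\<close> there are exactly three vertices, and on a loop of length
  three any two are consecutive.\<close>

lemma triangle_loop:
  assumes "card (V \<inter> \<gamma> ` {0..1}) \<le> 3" "u \<in> V \<inter> \<gamma> ` {0..1}" "w \<in> V \<inter> \<gamma> ` {0..1}" "u \<noteq> w"
  shows "\<exists>e\<in>E. e \<subseteq> \<gamma> ` {0..1} \<and> ends e = {u, w}"
proof -
  have "card (V \<inter> \<gamma> ` {0..1}) = steps" using card_image[OF inj_loop_vertices] loop_vertices by simp
  then have st: "steps = Suc (Suc (Suc 0))" using assms(1) steps_ge_3 by simp
  have t3: "marks ! Suc (Suc (Suc 0)) = 1" using times_steps st by simp
  let ?v = "\<lambda>i. \<gamma> (marks ! i)"
  have e: "ends (gap 0) = {?v 0, ?v 1}" "ends (gap 1) = {?v 1, ?v 2}" "ends (gap 2) = {?v 2, ?v 0}"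
    using ends_gap[of 0] ends_gap[of 1] ends_gap[of 2] st t3 times_0 closed_loop
    by (auto simp: numeral_2_eq_2)
  have g: "gap 0 \<in> E \<and> gap 0 \<subseteq> \<gamma> ` {0..1}" "gap 1 \<in> E \<and> gap 1 \<subseteq> \<gamma> ` {0..1}"
    "gap 2 \<in> E \<and> gap 2 \<subseteq> \<gamma> ` {0..1}"
    using gap_E gap_subset st by (auto simp: numeral_2_eq_2)
  have "{..<steps} = {0, 1, 2}" using st by auto
  then have "u \<in> {?v 0, ?v 1, ?v 2}" "w \<in> {?v 0, ?v 1, ?v 2}" using assms loop_vertices by auto
  then show ?thesis using e g assms(4) by (metis doubleton_eq_iff insertE singletonD)
qed

text \<open>A second vertex \<open>\<gamma> \<beta>\<close> splits the loop into two arcs; the two edges at the base point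
  lead into different arcs, and no edge joins the two arcs.\<close>

context
  fixes \<beta> assumes \<beta>: "0 < \<beta>" "\<beta> < 1" "\<gamma> \<beta> \<in> V"
    and nonadj: "\<And>e. e \<in> E \<Longrightarrow> ends e \<noteq> {\<gamma> 0, \<gamma> \<beta>}"
begin

lemma loop_edge_sides:
  assumes "e \<in> E" "e \<subseteq> \<gamma> ` {0..1}" "ends e = {u, w}" "u \<in> \<gamma> ` {0<..<\<beta>}"
  shows "w \<notin> \<gamma> ` {\<beta><..<1}"
proof
  assume w: "w \<in> \<gamma> ` {\<beta><..<1}"
  have "e \<in> gap ` {..<steps}" using assms by (simp add: edges_in_loop[symmetric])
  then obtain i where i: "i < steps" "e = gap i" by auto
  obtain s where s: "0 < s" "s < \<beta>" "u = \<gamma> s" using assms by auto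
  obtain s' where s': "\<beta> < s'" "s' < 1" "w = \<gamma> s'" using w by auto
  have uw: "u \<in> V" "w \<in> V" using ends_V[OF assms(1)] assms(3) by auto
  obtain j where j: "j \<le> steps" "s = marks ! j" using times_ex[of s] s uw \<beta> by auto
  obtain j' where j': "j' \<le> steps" "s' = marks ! j'" using times_ex[of s'] s' uw \<beta> by auto
  have jl: "j < steps" "j' < steps" using s s' j j' times_steps \<beta> by (auto simp: le_less)
  have en: "{\<gamma> (marks ! i), \<gamma> (marks ! Suc i)} = {u, w}" using ends_gap i assms(3) by auto
  have *: "k = j \<or> k = j'" if "k < steps" "\<gamma> (marks ! k) \<in> {u, w}" for k
    using that inj_onD[OF inj_loop_vertices, of k j] inj_onD[OF inj_loop_vertices, of k j'] jl s s' j j' by auto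
  have ii: "i = j \<or> i = j'" using * i en by auto
  \<comment> \<open>The last edge ends at the base point, which belongs to neither arc.\<close>
  have "Suc i < steps"
  proof (rule ccontr)
    assume "\<not> ?thesis"
    then have "Suc i = steps" using i by simp
    then have "\<gamma> 0 \<in> {u, w}" using en times_steps closed_loop by auto
    then have "0 = j \<or> 0 = j'" using *[of 0] times_0 steps_pos by simp
    then show False using s s' j j' times_0 \<beta> by auto
  qed
  then have "Suc i = j \<or> Suc i = j'" using * en by auto
  then have ij: "i = j \<and> Suc i = j' \<or> i = j' \<and> Suc i = j" using ii by auto
  have "j < j'" using s s' j j' times_less[of j' j] by (metis jl(1) le_less less_trans linorder_neqE_nat not_less_iff_gr_or_eq)
  then have "i = j" "Suc i = j'" using ij by auto
  \<comment> \<open>The edge would run from one arc to the other between consecutive marks, yet the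
    vertex at \<open>\<beta>\<close> lies strictly in between.\<close>
  then show False using gap_no_time[OF i(1), of \<beta>] s s' j j' \<beta> by auto
qed

lemma base_edges:
  obtains e0 e1 u0 u1 where "e0 \<in> E" "e1 \<in> E" "e0 \<noteq> e1"
    "ends e0 = {\<gamma> 0, u0}" "ends e1 = {\<gamma> 0, u1}" "u0 \<in> \<gamma> ` {0<..<\<beta>}" "u1 \<in> \<gamma> ` {\<beta><..<1}"
    "{e\<in>E. e \<subseteq> \<gamma> ` {0..1} \<and> \<gamma> 0 \<in> ends e} = {e0, e1}"
proof -
  obtain b where b: "b \<le> steps" "\<beta> = marks ! b" using times_ex[of \<beta>] \<beta> by auto
  obtain m where m: "steps = Suc m" "1 \<le> m" using steps_ge_3 by (cases steps) auto
  let ?e0 = "gap 0" and ?e1 = "gap m" and ?u0 = "\<gamma> (marks ! 1)" and ?u1 = "\<gamma> (marks ! m)"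
  have en: "ends ?e0 = {\<gamma> 0, ?u0}" "ends ?e1 = {\<gamma> 0, ?u1}"
    using ends_gap[of 0] ends_gap[of m] m times_0 times_steps closed_loop by auto
  have E: "?e0 \<in> E" "?e1 \<in> E" using gap_E m by auto
  have bne: "b \<noteq> 0" "b \<noteq> steps" using b \<beta> times_0 times_steps by (metis less_irrefl)+
  \<comment> \<open>If the second vertex were the first or the last inner mark, an edge would join
    it to the base point.\<close>
  have "b \<noteq> 1" "b \<noteq> m" using en E nonadj b by auto
  then have "1 < b" "b < m" using bne b m by auto
  then have o: "0 < marks ! 1" "marks ! 1 < \<beta>" "\<beta> < marks ! m" "marks ! m < 1"
    using times_less[of 0 1] times_less[of 1 b] times_less[of b m] times_less[of m steps] m b
      times_0 times_steps by auto
  have "?e0 \<noteq> ?e1" using inj_onD[OF inj_gap, of 0 m] m by auto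
  moreover have "{e\<in>E. e \<subseteq> \<gamma> ` {0..1} \<and> \<gamma> 0 \<in> ends e} = {?e0, ?e1}"
  proof
    show "{e\<in>E. e \<subseteq> \<gamma> ` {0..1} \<and> \<gamma> 0 \<in> ends e} \<subseteq> {?e0, ?e1}"
    proof
      fix e assume e: "e \<in> {e\<in>E. e \<subseteq> \<gamma> ` {0..1} \<and> \<gamma> 0 \<in> ends e}"
      then have "e \<in> gap ` {..<steps}" by (simp add: edges_in_loop[symmetric])
      then obtain i where i: "i < steps" "e = gap i" by auto
      then have "\<gamma> 0 = \<gamma> (marks ! i) \<or> \<gamma> 0 = \<gamma> (marks ! Suc i)" using e ends_gap by auto
      then have "i = 0 \<or> Suc i = steps"
        using inj_onD[OF inj_loop_vertices, of 0 i] inj_onD[OF inj_loop_vertices, of 0 "Suc i"]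
          times_0 i steps_pos by (metis lessThan_iff less_Suc_eq_0_disj nat.distinct(1) not_less_eq less_antisym)
      then show "e \<in> {?e0, ?e1}" using i m by auto
    qed
    show "{?e0, ?e1} \<subseteq> {e\<in>E. e \<subseteq> \<gamma> ` {0..1} \<and> \<gamma> 0 \<in> ends e}"
      using E en gap_subset m by auto
  qed
  ultimately show thesis using that E en o by force
qed

end

end

text \<open>A chart around the point is glued from two half rectangles, one mapped by each disk in
  polar coordinates and matched along the common arc by \<open>w\<close>, which is \<open>k\<close>
  inverted on the arc of \<open>h\<close>. It is injective because the open disk of \<open>h\<close>
  misses the disk of \<open>k\<close>, so invariance of domain makes its image open.\<close>

lemma glued_disks_interior:
  fixes h k :: "complex \<Rightarrow> complex"
  assumes h: "continuous_on (cball 0 1) h" "inj_on h (cball 0 1)"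
    and k: "continuous_on (cball 0 1) k" "inj_on k (cball 0 1)"
    and disj: "h ` ball 0 1 \<inter> k ` cball 0 1 = {}"
    and \<delta>: "0 < \<delta>" "\<And>\<theta>. \<bar>\<theta> - \<theta>0\<bar> < \<delta> \<Longrightarrow> h (cis \<theta>) \<in> k ` sphere 0 1"
  shows "h (cis \<theta>0) \<in> interior (h ` cball 0 1 \<union> k ` cball 0 1)"
proof -
  \<comment> \<open>The bound \<open>pi\<close> keeps the angles used within one open full turn,
    where \<open>cis\<close> is injective.\<close>
  define d where "d = min \<delta> pi"
  have d: "0 < d" "d \<le> \<delta>" "d \<le> pi" using \<delta> by (auto simp: d_def)
  define w where "w = (\<lambda>\<theta>. inv_into (cball 0 1) k (h (cis \<theta>)))"
  have kw: "k (w \<theta>) = h (cis \<theta>)" and nw: "norm (w \<theta>) = 1" if "\<bar>\<theta> - \<theta>0\<bar> < d" for \<theta>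
  proof -
    have "\<bar>\<theta> - \<theta>0\<bar> < \<delta>" using that d by simp
    from \<delta>(2)[OF this] obtain y where y: "norm y = 1" "h (cis \<theta>) = k y" by auto
    then have "w \<theta> = y" unfolding w_def y(2) by (intro inv_into_f_f k(2)) simp
    with y show "k (w \<theta>) = h (cis \<theta>)" "norm (w \<theta>) = 1" by simp_all
  qed
  have contw: "continuous_on {\<theta>0-d<..<\<theta>0+d} w"
  proof -
    have c1: "continuous_on (k ` cball 0 1) (inv_into (cball 0 1) k)"
      using k by (intro continuous_on_inv) auto
    have c2: "continuous_on {\<theta>0-d<..<\<theta>0+d} (\<lambda>\<theta>. h (cis \<theta>))"
      unfolding cis_conv_exp
      by (rule continuous_on_compose2[OF h(1)]) (auto intro!: continuous_intros simp flip: cis_conv_exp)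
    have c3: "h (cis \<theta>) \<in> k ` cball 0 1" if "\<bar>\<theta> - \<theta>0\<bar> < d" for \<theta>
    proof -
      have "\<bar>\<theta> - \<theta>0\<bar> < \<delta>" using that d by simp
      from \<delta>(2)[OF this] show ?thesis by auto
    qed
    have "(\<lambda>\<theta>. h (cis \<theta>)) ` {\<theta>0-d<..<\<theta>0+d} \<subseteq> k ` cball 0 1"
      by (rule image_subsetI, rule c3) (simp add: abs_less_iff; linarith)
    then show ?thesis unfolding w_def by (rule continuous_on_compose2[OF c1 c2])
  qed
  define S where "S = {z. \<theta>0 - d < Re z \<and> Re z < \<theta>0 + d \<and> -1 < Im z \<and> Im z < 1}"
  have opS: "open S"
  proof -
    have "S = {z. \<theta>0 - d < Re z} \<inter> {z. Re z < \<theta>0 + d} \<inter> {z. -1 < Im z} \<inter> {z. Im z < 1}"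
      by (auto simp: S_def)
    then show ?thesis
      by (auto intro!: open_Int open_halfspace_Re_gt open_halfspace_Re_lt open_halfspace_Im_gt open_halfspace_Im_lt)
  qed
  have SRe: "\<bar>Re z - \<theta>0\<bar> < d" if "z \<in> S" for z using that by (auto simp: S_def)
  \<comment> \<open>\<open>Im z\<close> acts as a signed distance from the common arc: on the lower
    side \<open>k\<close> is used at radius \<open>1 + Im z\<close>, on the upper side
    \<open>h\<close> at radius \<open>1 - Im z\<close>. On the real axis both agree by the choice of
    \<open>w\<close>.\<close>
  define G where "G = (\<lambda>z. if Im z \<le> 0 then k (complex_of_real (1 + Im z) * w (Re z))
     else h (complex_of_real (1 - Im z) * cis (Re z)))"
  have contG: "continuous_on S G"
    unfolding G_def
  proof (rule continuous_on_cases_le)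
    have "continuous_on {z\<in>S. Im z \<le> 0} (\<lambda>z. w (Re z))"
      by (rule continuous_on_compose2[OF contw]) (auto simp: S_def intro!: continuous_intros)
    then show "continuous_on {z \<in> S. Im z \<le> 0} (\<lambda>z. k (complex_of_real (1 + Im z) * w (Re z)))"
    proof (intro continuous_on_compose2[OF k(1)] continuous_intros)
      show "(\<lambda>z. complex_of_real (1 + Im z) * w (Re z)) ` {z \<in> S. Im z \<le> 0} \<subseteq> cball 0 1"
      proof safe
        fix z assume z: "z \<in> S" "Im z \<le> 0"
        then have "norm (complex_of_real (1 + Im z) * w (Re z)) = \<bar>1 + Im z\<bar>"
          using nw[OF SRe] by (simp add: norm_mult del: of_real_add)
        then show "complex_of_real (1 + Im z) * w (Re z) \<in> cball 0 1"
          using z by (auto simp: S_def)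
      qed
    qed
    show "continuous_on {z \<in> S. 0 \<le> Im z} (\<lambda>z. h (complex_of_real (1 - Im z) * cis (Re z)))"
    proof (rule continuous_on_compose2[OF h(1)])
      show "continuous_on {z \<in> S. 0 \<le> Im z} (\<lambda>z. complex_of_real (1 - Im z) * cis (Re z))"
        unfolding cis_conv_exp by (intro continuous_intros)
      show "(\<lambda>z. complex_of_real (1 - Im z) * cis (Re z)) ` {z \<in> S. 0 \<le> Im z} \<subseteq> cball 0 1"
        by (auto simp: norm_mult S_def simp del: of_real_diff)
    qed
    fix z assume "z \<in> S" "Im z = 0"
    then show "k (complex_of_real (1 + Im z) * w (Re z)) = h (complex_of_real (1 - Im z) * cis (Re z))"
      using kw[OF SRe] by simp
  qed (intro continuous_intros)
  have lowG: "norm (complex_of_real (1 + Im z) * w (Re z)) = 1 + Im z" if "z \<in> S" for z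
    using that nw[OF SRe] by (auto simp: norm_mult S_def simp del: of_real_add)
  have upG: "norm (complex_of_real (1 - Im z) * cis (Re z)) = 1 - Im z" if "z \<in> S" for z
    using that by (auto simp: norm_mult S_def simp del: of_real_diff)
  have cis_inj: "Re z = Re z'" if z: "z \<in> S" "z' \<in> S" "cis (Re z) = cis (Re z')" for z z'
  proof -
    have "\<not> Re x < Re y" if "x \<in> S" "y \<in> S" "cis (Re x) = cis (Re y)" for x y
    proof
      assume "Re x < Re y"
      moreover have "Re y < Re x + 2 * pi"
        using SRe[OF that(1)] SRe[OF that(2)] d(3) by linarith
      ultimately show False using cis_neq_of_less that(3) by blast
    qed
    from this[of z z'] this[of z' z] z show ?thesis by simp
  qed
  have mixed: False if "z \<in> S" "z' \<in> S" "Im z \<le> 0" "0 < Im z'" "G z = G z'" for z z'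
  proof -
    have "complex_of_real (1 + Im z) * w (Re z) \<in> cball 0 1"
      using lowG[OF that(1)] that(3) by (simp del: of_real_add)
    then have "k (complex_of_real (1 + Im z) * w (Re z)) \<in> k ` cball 0 1" by (rule imageI)
    then have "G z \<in> k ` cball 0 1" using that(3) by (simp only: G_def if_True)
    moreover have "complex_of_real (1 - Im z') * cis (Re z') \<in> ball 0 1"
      using upG[OF that(2)] that(4) by (simp del: of_real_diff)
    then have "G z' \<in> h ` ball 0 1" using that by (simp add: G_def del: of_real_diff)
    ultimately show False using disj that(5) by auto
  qed
  have injG: "inj_on G S"
  proof (rule inj_onI)
    fix z z' assume z: "z \<in> S" "z' \<in> S" "G z = G z'"
    consider "Im z \<le> 0" "Im z' \<le> 0" | "0 < Im z" "0 < Im z'"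
      using mixed[of z z'] mixed[of z' z] z by force
    then show "z = z'"
    proof cases
      case 1
      let ?a = "complex_of_real (1 + Im z) * w (Re z)" and ?b = "complex_of_real (1 + Im z') * w (Re z')"
      have "k ?a = k ?b" using z 1 by (simp add: G_def)
      moreover have "norm ?a \<le> 1" "norm ?b \<le> 1" using lowG[OF z(1)] lowG[OF z(2)] 1 by linarith+
      ultimately have ab: "?a = ?b" using k(2) by (auto dest: inj_onD)
      then have im: "Im z = Im z'" using lowG[OF z(1)] lowG[OF z(2)] by simp
      have "complex_of_real (1 + Im z) \<noteq> 0" using z(1) by (simp add: S_def del: of_real_add)
      then have "w (Re z) = w (Re z')" using ab im by simp
      then have "h (cis (Re z)) = h (cis (Re z'))" using kw[OF SRe[OF z(1)]] kw[OF SRe[OF z(2)]] by simp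
      then have "cis (Re z) = cis (Re z')" using h(2) by (auto dest!: inj_onD)
      then show ?thesis using cis_inj[OF z(1,2)] im by (simp add: complex_eq_iff)
    next
      case 2
      let ?a = "complex_of_real (1 - Im z) * cis (Re z)" and ?b = "complex_of_real (1 - Im z') * cis (Re z')"
      have "h ?a = h ?b" using z 2 by (simp add: G_def)
      moreover have "norm ?a \<le> 1" "norm ?b \<le> 1" using upG[OF z(1)] upG[OF z(2)] 2 by linarith+
      ultimately have ab: "?a = ?b" using h(2) by (auto dest: inj_onD)
      then have im: "Im z = Im z'" using upG[OF z(1)] upG[OF z(2)] by simp
      have "complex_of_real (1 - Im z) \<noteq> 0" using z(1) by (simp add: S_def del: of_real_diff)
      then have "cis (Re z) = cis (Re z')" using ab im by simp
      then show ?thesis using cis_inj[OF z(1,2)] im by (simp add: complex_eq_iff)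
    qed
  qed
  have op: "open (G ` S)" by (rule invariance_of_domain[OF contG opS injG])
  have "G ` S \<subseteq> h ` cball 0 1 \<union> k ` cball 0 1"
  proof safe
    fix z assume z: "z \<in> S" "G z \<notin> k ` cball 0 1"
    show "G z \<in> h ` cball 0 1"
    proof (cases "Im z \<le> 0")
      case True
      then have "G z \<in> k ` cball 0 1"
        using lowG[OF z(1)] by (simp add: G_def del: of_real_add)
      then show ?thesis using z by simp
    next
      case False
      then show ?thesis using upG[OF z(1)] by (simp add: G_def del: of_real_diff)
    qed
  qed
  then have "G ` S \<subseteq> interior (h ` cball 0 1 \<union> k ` cball 0 1)" using op by (rule interior_maximal)
  moreover have "complex_of_real \<theta>0 \<in> S" using d by (simp add: S_def)
  moreover have "G (complex_of_real \<theta>0) = h (cis \<theta>0)" using kw[of \<theta>0] d by (simp add: G_def)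
  ultimately show ?thesis by (metis image_subset_iff)
qed

section \<open>Simple closed curves running in a plane graph\<close>

context plane_graph begin

text \<open>A circle without vertices would lie in a single edge. Read in the parameter of that edge
  it would be a continuous real function, injective on the half-open interval, with equal values at
  both ends.\<close>

lemma circle_meets_V:
  fixes k :: "complex \<Rightarrow> complex"
  assumes k: "continuous_on (sphere 0 1) k" "inj_on k (sphere 0 1)" "k ` sphere 0 1 \<subseteq> V \<union> \<Union>E"
  shows "\<exists>\<theta>. k (cis \<theta>) \<in> V"
proof (rule ccontr)
  assume no: "\<not> ?thesis"
  define q where "q = (\<lambda>t. k (cis (2 * pi * t)))"
  have contq: "continuous_on T q" for T
    unfolding q_def cis_conv_exp
    by (rule continuous_on_compose2[OF k(1)]) (auto intro!: continuous_intros simp flip: cis_conv_exp)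
  have "range q \<subseteq> \<Union>E"
  proof
    fix x assume "x \<in> range q"
    then obtain t where t: "x = k (cis (2 * pi * t))" by (auto simp: q_def)
    have "cis (2 * pi * t) \<in> sphere 0 1" by simp
    then have "x \<in> V \<union> \<Union>E" using k(3) t by blast
    then show "x \<in> \<Union>E" using no t by blast
  qed
  moreover obtain e where e: "e \<in> E" "q 0 \<in> e" using calculation by blast
  moreover have "connected (range q)" by (rule connected_continuous_image[OF contq]) simp
  ultimately have qe: "range q \<subseteq> e" using connected_in_edge[of "range q" e] by blast
  obtain g where g: "arc g" "e = g ` {0<..<1}" "closure e = path_image g"
    using edge_arcE[OF e(1)] by metis
  obtain p where p: "homeomorphism {0..1} (path_image g) g p" using homeomorphism_arc[OF g(1)] .
  have eP: "e \<subseteq> path_image g" by (metis g(3) closure_subset)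
  have contp: "continuous_on (path_image g) p" using p by (auto simp: homeomorphism_def)
  have injp: "inj_on p (path_image g)" using p by (intro inj_on_inverseI[of _ g]) (auto simp: homeomorphism_def)
  define r where "r = p \<circ> q"
  have contr: "continuous_on {0..1} r"
    unfolding r_def using qe eP by (intro continuous_on_compose contq continuous_on_subset[OF contp]) auto
  have injq: "inj_on q {0..<1}"
  proof (rule linorder_inj_onI)
    fix s t :: real assume st: "s < t" "s \<in> {0..<1}" "t \<in> {0..<1}"
    then have "2 * pi * t < 2 * pi * 1" "2 * pi * s \<ge> 0" by auto
    then have "2 * pi * t < 2 * pi * s + 2 * pi" by linarith
    then have "cis (2 * pi * s) \<noteq> cis (2 * pi * t)" using st by (intro cis_neq_of_less) auto
    then show "q s \<noteq> q t" unfolding q_def using k(2) by (auto dest!: inj_onD)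
  qed auto
  have injr: "inj_on r {0..<1}"
    unfolding r_def using qe eP by (intro comp_inj_on[OF injq] inj_on_subset[OF injp]) auto
  have r01: "r 0 = r 1" by (simp add: r_def q_def)
  \<comment> \<open>Injectivity makes \<open>r\<close> monotone, so it moves strictly away from
    \<open>r 0\<close> and cannot come back to that value at 1.\<close>
  have mono: "r 0 < r x \<and> r x < r y \<or> r y < r x \<and> r x < r 0" if "0 < x" "x < y" "y < 1" for x y
    using that continuous_on_subset[OF contr] inj_on_subset[OF injr]
    by (intro continuous_inj_imp_mono) (auto simp: subset_iff)
  have lim: "(r \<longlongrightarrow> r 1) (at 1 within {0..1})" using contr by (simp add: continuous_on_def)
  have ev: "eventually (\<lambda>y. y \<in> {1/2<..<1}) (at_left (1::real))"
    using eventually_at_left_real[of "1/2" 1] by simp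
  have lim': "(r \<longlongrightarrow> r 0) (at_left 1)"
  proof -
    have "at_left (1::real) = at 1 within {0..1}" by (rule at_within_Icc_at_left[symmetric]) simp
    then show ?thesis using lim r01 by simp
  qed
  consider "r 0 < r (1/2)" | "r (1/2) < r 0"
    using mono[of "1/4" "1/2"] by force
  then show False
  proof cases
    case 1
    have "eventually (\<lambda>y. r (1/2) \<le> r y) (at_left 1)"
      using ev by eventually_elim (use mono[of "1/2"] 1 in force)
    then have "r (1/2) \<le> r 0" by (intro tendsto_lowerbound[OF lim']) auto
    then show False using 1 by simp
  next
    case 2
    have "eventually (\<lambda>y. r y \<le> r (1/2)) (at_left 1)"
      using ev by eventually_elim (use mono[of "1/2"] 2 in force)
    then have "r 0 \<le> r (1/2)" by (intro tendsto_upperbound[OF lim']) auto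
    then show False using 2 by simp
  qed
qed

text \<open>Rotating the parametrisation by \<open>\<theta>\<close> puts a vertex at the base point,
  as \<open>graph_loop\<close> demands.\<close>

lemma circle_loop:
  fixes k :: "complex \<Rightarrow> complex"
  assumes k: "continuous_on (sphere 0 1) k" "inj_on k (sphere 0 1)" "k ` sphere 0 1 \<subseteq> V \<union> \<Union>E"
    and V: "k (cis \<theta>) \<in> V"
  shows "graph_loop V E (\<lambda>t. k (cis (\<theta> + 2 * pi * t)))"
    and "(\<lambda>t. k (cis (\<theta> + 2 * pi * t))) ` {0..1} = k ` sphere 0 1"
proof -
  have surj: "(\<lambda>t. cis (\<theta> + 2 * pi * t)) ` {0..1} = sphere 0 1"
  proof
    show "sphere 0 1 \<subseteq> (\<lambda>t. cis (\<theta> + 2 * pi * t)) ` {0..1}"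
    proof
      fix z :: complex assume "z \<in> sphere 0 1"
      then have "norm z = 1" by simp
      then have "z \<noteq> 0" by auto
      then have z: "z = cis (Arg z)" using cis_Arg[of z] \<open>norm z = 1\<close> by (simp add: sgn_eq)
      define m where "m = \<lfloor>(Arg z - \<theta>) / (2*pi)\<rfloor>"
      define t where "t = (Arg z - \<theta>) / (2*pi) - m"
      have t: "0 \<le> t" "t \<le> 1" unfolding t_def m_def by linarith+
      have "Arg z = (\<theta> + 2 * pi * t) + 2 * pi * m" by (simp add: t_def field_simps)
      then have "cis (Arg z) = cis (\<theta> + 2 * pi * t) * cis (2 * pi * m)" by (simp only: cis_mult)
      then have "z = cis (\<theta> + 2 * pi * t)" using z cis_multiple_2pi[of "real_of_int m"] by simp
      then show "z \<in> (\<lambda>t. cis (\<theta> + 2 * pi * t)) ` {0..1}" using t by auto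
    qed
  qed auto
  show im: "(\<lambda>t. k (cis (\<theta> + 2 * pi * t))) ` {0..1} = k ` sphere 0 1"
    by (subst surj[symmetric]) (simp add: image_comp o_def)
  show "graph_loop V E (\<lambda>t. k (cis (\<theta> + 2 * pi * t)))"
  proof
    show "continuous_on {0..1} (\<lambda>t. k (cis (\<theta> + 2 * pi * t)))"
      unfolding cis_conv_exp
      by (rule continuous_on_compose2[OF k(1)]) (auto intro!: continuous_intros simp flip: cis_conv_exp)
    have "cis (\<theta> + 2 * pi) = cis \<theta>" by (simp add: complex_eq_iff)
    then show "k (cis (\<theta> + 2 * pi * 0)) = k (cis (\<theta> + 2 * pi * 1))" by simp
    show "k (cis (\<theta> + 2 * pi * 0)) \<in> V" using V by simp
    show "inj_on (\<lambda>t. k (cis (\<theta> + 2 * pi * t))) {0..<1}"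
    proof (rule linorder_inj_onI)
      fix s t :: real assume st: "s < t" "s \<in> {0..<1}" "t \<in> {0..<1}"
      then have "2 * pi * t < 2 * pi * 1" "2 * pi * s \<ge> 0" by auto
      then have "\<theta> + 2 * pi * t < \<theta> + 2 * pi * s + 2 * pi" by linarith
      then have "cis (\<theta> + 2 * pi * s) \<noteq> cis (\<theta> + 2 * pi * t)" using st by (intro cis_neq_of_less) auto
      then show "k (cis (\<theta> + 2 * pi * s)) \<noteq> k (cis (\<theta> + 2 * pi * t))"
        using k(2) by (auto dest!: inj_onD)
    qed auto
    show "(\<lambda>t. k (cis (\<theta> + 2 * pi * t))) ` {0..1} \<subseteq> V \<union> \<Union>E" using im k(3) by simp
  qed
qed

lemma edge_on_circle:
  fixes k :: "complex \<Rightarrow> complex"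
  assumes "continuous_on (sphere 0 1) k" "inj_on k (sphere 0 1)" "k ` sphere 0 1 \<subseteq> V \<union> \<Union>E"
    and "e \<in> E" "e \<inter> k ` sphere 0 1 \<noteq> {}"
  shows "e \<subseteq> k ` sphere 0 1"
proof -
  obtain \<theta> where "k (cis \<theta>) \<in> V" using circle_meets_V assms by blast
  from circle_loop[OF assms(1-3) this] graph_loop.edge_subset_loop assms(4,5) show ?thesis
    by (metis (no_types, lifting))
qed

lemma even_circle_cut:
  fixes k :: "complex \<Rightarrow> complex"
  assumes "continuous_on (sphere 0 1) k" "inj_on k (sphere 0 1)" "k ` sphere 0 1 \<subseteq> V \<union> \<Union>E"
  shows "even (card {e\<in>E. e \<subseteq> k ` sphere 0 1 \<and> card (ends e \<inter> K) = 1})"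
proof -
  obtain \<theta> where "k (cis \<theta>) \<in> V" using circle_meets_V assms by blast
  from graph_loop.even_loop_cut[OF circle_loop(1)[OF assms this]] circle_loop(2)[OF assms this]
  show ?thesis by simp
qed

lemma triangle_circle:
  fixes k :: "complex \<Rightarrow> complex"
  assumes "continuous_on (sphere 0 1) k" "inj_on k (sphere 0 1)" "k ` sphere 0 1 \<subseteq> V \<union> \<Union>E"
    and "card (V \<inter> k ` sphere 0 1) \<le> 3" "u \<in> V \<inter> k ` sphere 0 1" "w \<in> V \<inter> k ` sphere 0 1" "u \<noteq> w"
  shows "\<exists>e\<in>E. e \<subseteq> k ` sphere 0 1 \<and> ends e = {u, w}"
proof -
  obtain \<theta> where \<theta>: "k (cis \<theta>) \<in> V" using circle_meets_V assms by blast
  note c = circle_loop[OF assms(1-3) \<theta>]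
  show ?thesis using graph_loop.triangle_loop[OF c(1)] assms(4-7) unfolding c(2) by blast
qed

end

section \<open>Subdivisions of the disk\<close>

text \<open>Invariance of domain is applied twice: to \<open>g\<close> on the open disk, and to its
  inverse on the interior of the image.\<close>

lemma interior_disk_image:
  fixes g :: "complex \<Rightarrow> complex"
  assumes cont: "continuous_on (cball 0 1) g" and inj: "inj_on g (cball 0 1)"
  shows "interior (g ` cball 0 1) = g ` ball 0 1"
proof
  have "open (g ` ball 0 1)"
    using continuous_on_subset[OF cont ball_subset_cball] inj_on_subset[OF inj ball_subset_cball]
    by (intro invariance_of_domain) auto
  then show "g ` ball 0 1 \<subseteq> interior (g ` cball 0 1)"
    by (intro interior_maximal image_mono ball_subset_cball)
  show "interior (g ` cball 0 1) \<subseteq> g ` ball 0 1"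
  proof
    fix x assume x: "x \<in> interior (g ` cball 0 1)"
    let ?U = "interior (g ` cball 0 1)" and ?i = "inv_into (cball 0 1) g"
    have U: "?U \<subseteq> g ` cball 0 1" by (rule interior_subset)
    have "continuous_on (g ` cball 0 1) ?i" using cont inj by (intro continuous_on_inv) auto
    then have "continuous_on ?U ?i" using U by (rule continuous_on_subset)
    moreover have "inj_on ?i ?U" using U by (rule inj_on_inv_into)
    ultimately have "open (?i ` ?U)" by (intro invariance_of_domain) auto
    moreover have "?i ` ?U \<subseteq> cball 0 1" using U inv_into_into[of _ g "cball 0 1"] by blast
    ultimately have "?i ` ?U \<subseteq> interior (cball 0 1)" by (intro interior_maximal)
    then have "?i x \<in> ball 0 1" using x by auto
    moreover have "g (?i x) = x" using x U by (intro f_inv_into_f) auto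
    ultimately show "x \<in> g ` ball 0 1" by (metis imageI)
  qed
qed

text \<open>The open 2-cell \<open>C f\<close> may be smaller than the interior of its closure, which is a disk slit along
  edges; hence the separate parametrisation \<open>h f\<close> of the closed face.\<close>

locale disc_map = plane_graph +
  fixes F :: "'f set" and h :: "'f \<Rightarrow> complex \<Rightarrow> complex" and C :: "'f \<Rightarrow> complex set"
    and c :: "'f \<Rightarrow> complex"
  assumes finF: "finite F"
    and V_disk: "V \<subseteq> cball 0 1" and E_disk: "\<And>e. e \<in> E \<Longrightarrow> e \<subseteq> cball 0 1"
    and cont_h: "\<And>f. f \<in> F \<Longrightarrow> continuous_on (cball 0 1) (h f)"
    and inj_h: "\<And>f. f \<in> F \<Longrightarrow> inj_on (h f) (cball 0 1)"
    and cover: "(\<Union>f\<in>F. h f ` cball 0 1) = cball 0 1"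
    and h_disj: "\<And>f g. f \<in> F \<Longrightarrow> g \<in> F \<Longrightarrow> f \<noteq> g \<Longrightarrow> h f ` ball 0 1 \<inter> h g ` cball 0 1 = {}"
    and rim_graph: "\<And>f. f \<in> F \<Longrightarrow> h f ` sphere 0 1 \<subseteq> V \<union> \<Union>E"
    and C_ball: "\<And>f. f \<in> F \<Longrightarrow> C f \<subseteq> h f ` ball 0 1"
    and C_graph: "\<And>f. f \<in> F \<Longrightarrow> C f \<inter> (V \<union> \<Union>E) = {}"
    and c_C: "\<And>f. f \<in> F \<Longrightarrow> c f \<in> C f"
    and spoke: "\<And>f v. f \<in> F \<Longrightarrow> v \<in> V \<Longrightarrow> v \<in> h f ` sphere 0 1 \<Longrightarrow>
      \<exists>\<gamma>. path \<gamma> \<and> pathstart \<gamma> = c f \<and> pathfinish \<gamma> = v \<and> path_image \<gamma> \<subseteq> insert v (C f)"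
begin

definition VF :: "'f \<Rightarrow> complex set" where "VF f = V \<inter> h f ` sphere 0 1"
definition EF :: "'f \<Rightarrow> complex set set" where "EF f = {e\<in>E. e \<subseteq> h f ` sphere 0 1}"
text \<open>An edge along a slit inside a closed face lies on no rim. Such edges are left out here
  because the incidence counts below hold for rim edges only.\<close>

definition EG :: "complex set set" where "EG = (\<Union>f\<in>F. EF f)"
definition EB :: "complex set set" where "EB = {e\<in>E. e \<subseteq> sphere 0 1}"

lemma cont_rim: "f \<in> F \<Longrightarrow> continuous_on (sphere 0 1) (h f)"
  and inj_rim: "f \<in> F \<Longrightarrow> inj_on (h f) (sphere 0 1)"
  using continuous_on_subset[OF cont_h sphere_cball] inj_on_subset[OF inj_h sphere_cball] by auto

lemma ball_rim_disj: "f \<in> F \<Longrightarrow> h f ` ball 0 1 \<inter> h f ` sphere 0 1 = {}"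
  using inj_h[of f] by (force dest: inj_onD)

lemma open_h_ball: "f \<in> F \<Longrightarrow> open (h f ` ball 0 1)"
  by (metis interior_disk_image[OF cont_h inj_h] open_interior)

lemma compact_h: "f \<in> F \<Longrightarrow> compact (h f ` cball 0 1)"
  using cont_h by (intro compact_continuous_image) auto

lemma h_ball_subset: "f \<in> F \<Longrightarrow> h f ` ball 0 1 \<subseteq> ball 0 1"
proof -
  assume f: "f \<in> F"
  then have "h f ` ball 0 1 \<subseteq> cball 0 1" using cover by force
  then have "h f ` ball 0 1 \<subseteq> interior (cball 0 1)" using open_h_ball[OF f] by (rule interior_maximal)
  then show ?thesis by simp
qed

lemma interior_h: "f \<in> F \<Longrightarrow> interior (h f ` cball 0 1) \<subseteq> h f ` ball 0 1"
  using interior_disk_image[OF cont_h inj_h] by simp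

lemma cball_split: "h f ` cball 0 1 = h f ` ball 0 1 \<union> h f ` sphere 0 1"
proof -
  have "cball 0 1 = ball 0 1 \<union> sphere (0::complex) 1" by auto
  then show ?thesis by (metis image_Un)
qed

lemma sphere_graph: "sphere 0 1 \<subseteq> V \<union> \<Union>E"
proof
  fix x :: complex assume x: "x \<in> sphere 0 1"
  then have "x \<in> cball 0 1" by simp
  then obtain f where f: "f \<in> F" "x \<in> h f ` cball 0 1" using cover by blast
  moreover have "x \<notin> h f ` ball 0 1" using h_ball_subset[OF f(1)] x by auto
  ultimately show "x \<in> V \<union> \<Union>E" using cball_split rim_graph[OF f(1)] by blast
qed

lemma edge_on_rim: "f \<in> F \<Longrightarrow> e \<in> E \<Longrightarrow> e \<inter> h f ` sphere 0 1 \<noteq> {} \<Longrightarrow> e \<in> EF f"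
  using edge_on_circle[OF cont_rim inj_rim rim_graph] by (simp add: EF_def)

lemma edge_on_sphere: "e \<in> E \<Longrightarrow> e \<inter> sphere 0 1 \<noteq> {} \<Longrightarrow> e \<in> EB"
  using edge_on_circle[of "\<lambda>x. x" e] sphere_graph by (simp add: EB_def)

text \<open>A point on the rim of one face lies in the open disk of no face, so a closed face
  containing it has it on its rim, and \<open>edge_on_rim\<close> then gives the whole edge.\<close>

lemma edge_in_face:
  assumes "f \<in> F" "e \<in> EG" "x \<in> e" "x \<in> h f ` cball 0 1" shows "e \<in> EF f"
proof -
  obtain g where g: "g \<in> F" "e \<in> EF g" using assms(2) by (auto simp: EG_def)
  then have xg: "x \<in> h g ` sphere 0 1" "e \<in> E" using assms(3) by (auto simp: EF_def)
  have "x \<notin> h f ` ball 0 1"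
  proof (cases "f = g")
    case True then show ?thesis using ball_rim_disj[OF g(1)] xg by blast
  next
    case False
    then show ?thesis using h_disj[OF assms(1) g(1) False] xg sphere_cball by blast
  qed
  then have "x \<in> h f ` sphere 0 1" using assms(4) cball_split by blast
  then show ?thesis using edge_on_rim[OF assms(1) xg(2)] assms(3) by blast
qed

lemma EB_EG: "EB \<subseteq> EG"
proof
  fix e assume e: "e \<in> EB"
  then have eE: "e \<in> E" "e \<subseteq> sphere 0 1" by (auto simp: EB_def)
  then obtain x where "x \<in> e" using edge_ne[OF eE(1)] by blast
  then have x: "x \<in> e" "norm x = 1" using eE(2) by auto
  then have "x \<in> cball 0 1" by simp
  then obtain f where f: "f \<in> F" "x \<in> h f ` cball 0 1" using cover by blast
  moreover have "x \<notin> h f ` ball 0 1" using h_ball_subset[OF f(1)] x by auto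
  ultimately have "x \<in> h f ` sphere 0 1" using cball_split by blast
  then have "e \<in> EF f" using edge_on_rim[OF f(1) eE(1)] x by blast
  then show "e \<in> EG" using f by (auto simp: EG_def)
qed

lemma EG_E: "EG \<subseteq> E" by (auto simp: EG_def EF_def)

text \<open>Near \<open>x\<close> the rim of \<open>f\<close> consists of points of \<open>e\<close>
  only, and these lie on the rim of \<open>g\<close> as well; so the two closed disks share an arc
  around \<open>x\<close> and \<open>glued_disks_interior\<close> applies.\<close>

lemma two_faces_interior:
  assumes f: "f \<in> F" "e \<in> EF f" and g: "g \<in> F" "e \<in> EF g" "f \<noteq> g" and x: "x \<in> e"
  shows "x \<in> interior (h f ` cball 0 1 \<union> h g ` cball 0 1)"
proof -
  have eE: "e \<in> E" and ef: "e \<subseteq> h f ` sphere 0 1" and eg: "e \<subseteq> h g ` sphere 0 1"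
    using f g by (auto simp: EF_def)
  obtain p where p: "norm p = 1" "x = h f p" using ef x by auto
  then have "p \<noteq> 0" by auto
  then have pA: "p = cis (Arg p)" using cis_Arg[of p] p by (simp add: sgn_eq)
  \<comment> \<open>Vertices and the closures of all other edges: a closed set missing
    \<open>x\<close>, hence avoided by a short stretch of the rim of \<open>f\<close> around
    \<open>x\<close>.\<close>
  let ?R = "V \<union> (\<Union>e'\<in>E - {e}. closure e')"
  have "closed (\<Union>e'\<in>E - {e}. closure e')" using finE by (intro closed_UN) auto
  then have clR: "closed ?R" by (intro closed_Un finite_imp_closed[OF finV])
  have "x \<notin> ?R"
    using x edge_V[OF eE] closure_edge_disj[OF eE] by blast
  have cont: "continuous_on UNIV (\<lambda>\<theta>. h f (cis \<theta>))"
    unfolding cis_conv_exp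
    by (rule continuous_on_compose2[OF cont_rim[OF f(1)]]) (auto intro!: continuous_intros simp flip: cis_conv_exp)
  have "open ((\<lambda>\<theta>. h f (cis \<theta>)) -` (- ?R))"
    using cont clR open_vimage by (metis open_Compl)
  moreover have "Arg p \<in> (\<lambda>\<theta>. h f (cis \<theta>)) -` (- ?R)" using \<open>x \<notin> ?R\<close> p pA by simp
  ultimately obtain \<delta> where \<delta>: "0 < \<delta>" "ball (Arg p) \<delta> \<subseteq> (\<lambda>\<theta>. h f (cis \<theta>)) -` (- ?R)"
    using openE by metis
  have "h f (cis \<theta>) \<in> h g ` sphere 0 1" if "\<bar>\<theta> - Arg p\<bar> < \<delta>" for \<theta>
  proof -
    have "\<theta> \<in> ball (Arg p) \<delta>" using that by (simp add: dist_real_def abs_minus_commute)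
    then have no: "h f (cis \<theta>) \<notin> ?R" using \<delta> by blast
    have "h f (cis \<theta>) \<in> h f ` sphere 0 1" by simp
    then have "h f (cis \<theta>) \<in> V \<union> \<Union>E" using rim_graph[OF f(1)] by blast
    then obtain e' where e': "e' \<in> E" "h f (cis \<theta>) \<in> e'" using no by blast
    then have "e' = e" using no closure_subset[of e'] by blast
    then show ?thesis using e' eg by blast
  qed
  then have "h f (cis (Arg p)) \<in> interior (h f ` cball 0 1 \<union> h g ` cball 0 1)"
    by (intro glued_disks_interior[where \<delta> = \<delta>] cont_h inj_h f g h_disj \<delta>) auto
  then show ?thesis using p pA by simp
qed

text \<open>With a second face, a point of the edge would be interior to the union of two closed
  faces, hence to the closed disk.\<close>

lemma boundary_edge_face:
  assumes e: "e \<in> EB" shows "card {f\<in>F. e \<in> EF f} = 1"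
proof -
  obtain f where f: "f \<in> F" "e \<in> EF f" using e EB_EG by (auto simp: EG_def)
  have "g = f" if g: "g \<in> F" "e \<in> EF g" for g
  proof (rule ccontr)
    assume ne: "g \<noteq> f"
    obtain x where x: "x \<in> e" using edge_ne e by (auto simp: EB_def)
    have "x \<in> interior (h f ` cball 0 1 \<union> h g ` cball 0 1)"
      using two_faces_interior[OF f g _ x] ne by simp
    moreover have "h f ` cball 0 1 \<union> h g ` cball 0 1 \<subseteq> cball 0 1" using cover f g by blast
    ultimately have "x \<in> interior (cball 0 1)" using interior_mono by blast
    then show False using x e by (auto simp: EB_def)
  qed
  then have "{f\<in>F. e \<in> EF f} = {f}" using f by blast
  then show ?thesis by simp
qed

text \<open>If only one face had the edge on its rim, the remaining closed faces would stay away
  from \<open>x\<close>, and \<open>x\<close> would be interior to that face instead of on its rim.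
  If there were three, the open disk of the third would accumulate at \<open>x\<close>, although a
  neighbourhood of \<open>x\<close> is filled by the first two.\<close>

lemma inner_edge_faces:
  assumes e: "e \<in> EG - EB" shows "card {f\<in>F. e \<in> EF f} = 2"
proof -
  obtain f where f: "f \<in> F" "e \<in> EF f" using e by (auto simp: EG_def)
  have eE: "e \<in> E" using f by (simp add: EF_def)
  obtain x where x: "x \<in> e" using edge_ne[OF eE] by auto
  have x_ball: "x \<in> ball 0 1" using x e E_disk[OF eE] edge_on_sphere[OF eE] by force
  have "\<exists>g\<in>F. e \<in> EF g \<and> g \<noteq> f"
  proof (rule ccontr)
    assume no: "\<not> ?thesis"
    let ?R = "\<Union>g\<in>F - {f}. h g ` cball 0 1"
    have "closed ?R" using finF compact_h compact_imp_closed by (intro closed_UN) auto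
    moreover have "x \<notin> ?R" using no edge_in_face[of _ e x] e x by blast
    moreover have "ball 0 1 - ?R \<subseteq> h f ` cball 0 1"
    proof
      fix y assume y: "y \<in> ball 0 1 - ?R"
      then have "y \<in> (\<Union>f\<in>F. h f ` cball 0 1)" unfolding cover by auto
      then show "y \<in> h f ` cball 0 1" using y by blast
    qed
    ultimately have "x \<in> interior (h f ` cball 0 1)"
      using x_ball interior_maximal[of "ball 0 1 - ?R" "h f ` cball 0 1"] open_Diff[OF open_ball] by blast
    then have "x \<in> h f ` ball 0 1" using interior_h[OF f(1)] by blast
    then show False using ball_rim_disj[OF f(1)] x f(2) by (auto simp: EF_def)
  qed
  then obtain g where g: "g \<in> F" "e \<in> EF g" "g \<noteq> f" by blast
  have "k = f \<or> k = g" if k: "k \<in> F" "e \<in> EF k" for k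
  proof (rule ccontr)
    assume ne: "\<not> ?thesis"
    let ?O = "interior (h f ` cball 0 1 \<union> h g ` cball 0 1)"
    have xO: "x \<in> ?O" using two_faces_interior[OF f g(1,2) _ x] g(3) by simp
    have xk: "x \<in> h k ` sphere 0 1" using x k by (auto simp: EF_def)
    have "h k ` closure (ball 0 1) \<subseteq> closure (h k ` ball 0 1)"
    proof (rule image_closure_subset)
      show "continuous_on (closure (ball 0 1)) (h k)" using cont_h[OF k(1)] by simp
    qed (simp_all add: closure_subset)
    then have "h k ` sphere 0 1 \<subseteq> closure (h k ` ball 0 1)" using sphere_cball[of "0::complex" 1] by force
    then have "x \<in> closure (h k ` ball 0 1)" using xk by blast
    then have "?O \<inter> h k ` ball 0 1 \<noteq> {}"
      using xO open_Int_closure_eq_empty[OF open_interior, of "h f ` cball 0 1 \<union> h g ` cball 0 1" "h k ` ball 0 1"] by blast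
    moreover have "?O \<subseteq> h f ` cball 0 1 \<union> h g ` cball 0 1" by (rule interior_subset)
    ultimately show False using h_disj[OF k(1) f(1)] h_disj[OF k(1) g(1)] ne by blast
  qed
  then have "{f\<in>F. e \<in> EF f} = {f, g}" using f g by blast
  then show ?thesis using g(3) by simp
qed

lemma even_face_cut: "f \<in> F \<Longrightarrow> even (card {e\<in>EF f. card (ends e \<inter> K) = 1})"
  using even_circle_cut[OF cont_rim inj_rim rim_graph, of f K] by (simp add: EF_def conj_assoc)

lemma triangle_face:
  "f \<in> F \<Longrightarrow> card (VF f) \<le> 3 \<Longrightarrow> u \<in> VF f \<Longrightarrow> w \<in> VF f \<Longrightarrow> u \<noteq> w \<Longrightarrow> \<exists>e\<in>EF f. ends e = {u, w}"
  using triangle_circle[OF cont_rim inj_rim rim_graph, of f u w] by (auto simp: EF_def VF_def)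

lemma ends_VF: assumes "f \<in> F" "e \<in> EF f" shows "ends e \<subseteq> VF f"
proof -
  have e: "e \<in> E" "e \<subseteq> h f ` sphere 0 1" using assms by (auto simp: EF_def)
  have "closed (h f ` sphere 0 1)"
    using cont_rim[OF assms(1)] by (intro compact_imp_closed compact_continuous_image) auto
  then have "closure e \<subseteq> h f ` sphere 0 1" using e by (intro closure_minimal)
  then show ?thesis using ends_V[OF e(1)] closure_edge[OF e(1)] by (auto simp: VF_def)
qed

lemma ends_EB: assumes "e \<in> EB" shows "ends e \<subseteq> V \<inter> sphere 0 1"
proof -
  have e: "e \<in> E" "e \<subseteq> sphere 0 1" using assms by (auto simp: EB_def)
  then have "closure e \<subseteq> sphere 0 1" by (intro closure_minimal) auto
  then show ?thesis using ends_V[OF e(1)] closure_edge[OF e(1)] by auto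
qed

lemma C_disj: "f \<in> F \<Longrightarrow> g \<in> F \<Longrightarrow> f \<noteq> g \<Longrightarrow> C f \<inter> C g = {}"
  using C_ball[of f] C_ball[of g] h_disj[of f g] ball_subset_cball[of "0::complex" 1] by blast

lemma inj_c: "inj_on c F"
  by (rule inj_onI) (metis C_disj c_C IntI empty_iff)

definition incident :: "complex \<Rightarrow> complex \<Rightarrow> bool" where
  "incident u v \<longleftrightarrow> (\<exists>f\<in>F. u = c f \<and> v \<in> VF f \<or> v = c f \<and> u \<in> VF f)"

definition joined :: "complex \<Rightarrow> complex \<Rightarrow> bool" where
  "joined u v \<longleftrightarrow> (\<exists>e\<in>E. ends e = {u, v}) \<or> incident u v"

text \<open>Depends on the node set only and is larger than a curve along the list: all edges
  spanned by the nodes and the whole open cell of every centre used. Disjointness of drawings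
  thereby reduces to disjointness of node sets.\<close>

definition drawing :: "complex list \<Rightarrow> complex set" where
  "drawing p = set p \<union> \<Union>{e\<in>E. ends e \<subseteq> set p} \<union> \<Union>{C f | f. f \<in> F \<and> c f \<in> set p}"

lemma joined_path:
  assumes "joined u v"
  shows "\<exists>\<gamma>. path \<gamma> \<and> pathstart \<gamma> = u \<and> pathfinish \<gamma> = v \<and> path_image \<gamma> \<subseteq> drawing [u, v]"
  using assms unfolding joined_def
proof
  assume "\<exists>e\<in>E. ends e = {u, v}"
  then obtain e where e: "e \<in> E" "ends e = {u, v}" by auto
  obtain g where g: "arc g" "closure e = path_image g" "ends e = {pathstart g, pathfinish g}"
    using edge_arcE[OF e(1)] by metis
  have "path_image g \<subseteq> drawing [u, v]"
    using g(2) closure_edge[OF e(1)] e by (auto simp: drawing_def)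
  moreover have "pathstart g = u \<and> pathfinish g = v \<or> pathstart g = v \<and> pathfinish g = u"
    using e(2) g(3) by (auto simp: doubleton_eq_iff)
  moreover have "path g" using g(1) by (rule arc_imp_path)
  ultimately show ?thesis
    by (metis path_image_reversepath path_reversepath pathfinish_reversepath pathstart_reversepath)
next
  assume "incident u v"
  then consider f where "f \<in> F" "u = c f" "v \<in> VF f" | f where "f \<in> F" "v = c f" "u \<in> VF f"
    by (auto simp: incident_def)
  then show ?thesis
  proof cases
    case 1
    then obtain \<gamma> where "path \<gamma>" "pathstart \<gamma> = u" "pathfinish \<gamma> = v" "path_image \<gamma> \<subseteq> insert v (C f)"
      using spoke[of f v] by (auto simp: VF_def)
    moreover have "insert v (C f) \<subseteq> drawing [u, v]" using 1 by (auto simp: drawing_def)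
    ultimately show ?thesis by blast
  next
    case 2
    then obtain \<gamma> where \<gamma>: "path \<gamma>" "pathstart \<gamma> = v" "pathfinish \<gamma> = u" "path_image \<gamma> \<subseteq> insert u (C f)"
      using spoke[of f u] by (auto simp: VF_def)
    have "insert u (C f) \<subseteq> drawing [u, v]" using 2 by (auto simp: drawing_def)
    then have "path (reversepath \<gamma>) \<and> pathstart (reversepath \<gamma>) = u \<and> pathfinish (reversepath \<gamma>) = v \<and>
        path_image (reversepath \<gamma>) \<subseteq> drawing [u, v]" using \<gamma> by auto
    then show ?thesis by blast
  qed
qed

lemma drawing_mono: "set p \<subseteq> set q \<Longrightarrow> drawing p \<subseteq> drawing q"
  unfolding drawing_def by blast

lemma drawing_path:
  "p \<noteq> [] \<Longrightarrow> successively joined p \<Longrightarrow>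
   \<exists>\<gamma>. path \<gamma> \<and> pathstart \<gamma> = hd p \<and> pathfinish \<gamma> = last p \<and> path_image \<gamma> \<subseteq> drawing p"
proof (induction p rule: induct_list012)
  case (2 u)
  have "path (linepath u u) \<and> pathstart (linepath u u) = u \<and> pathfinish (linepath u u) = u
      \<and> path_image (linepath u u) \<subseteq> drawing [u]"
    by (auto simp: drawing_def)
  then show ?case by auto
next
  case (3 u v p)
  then obtain \<gamma> where \<gamma>: "path \<gamma>" "pathstart \<gamma> = v" "pathfinish \<gamma> = last (v # p)" "path_image \<gamma> \<subseteq> drawing (v # p)"
    by auto
  obtain \<eta> where \<eta>: "path \<eta>" "pathstart \<eta> = u" "pathfinish \<eta> = v" "path_image \<eta> \<subseteq> drawing [u, v]"
    using joined_path[of u v] 3 by auto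
  have "path_image (\<eta> +++ \<gamma>) \<subseteq> drawing (u # v # p)"
    using \<gamma> \<eta> drawing_mono[of "[u, v]" "u # v # p"] drawing_mono[of "v # p" "u # v # p"]
    by (auto simp: path_image_join)
  then have "path (\<eta> +++ \<gamma>) \<and> pathstart (\<eta> +++ \<gamma>) = hd (u # v # p)
      \<and> pathfinish (\<eta> +++ \<gamma>) = last (u # v # p) \<and> path_image (\<eta> +++ \<gamma>) \<subseteq> drawing (u # v # p)"
    using \<gamma> \<eta> by auto
  then show ?case by blast
qed auto

lemma drawing_disk: "set p \<subseteq> V \<union> c ` F \<Longrightarrow> drawing p \<subseteq> cball 0 1"
proof -
  assume p: "set p \<subseteq> V \<union> c ` F"
  have C: "C f \<subseteq> cball 0 1" if "f \<in> F" for f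
    using C_ball[OF that] h_ball_subset[OF that] by (meson ball_subset_cball order_trans)
  have "c f \<in> cball 0 1" if "f \<in> F" for f using C[OF that] c_C[OF that] by blast
  then have "set p \<subseteq> cball 0 1" using p V_disk by blast
  then show ?thesis using C E_disk unfolding drawing_def by blast
qed

text \<open>Vertices, open edges and open cells are pairwise disjoint, so a common point comes from
  a common node, a common edge or a common cell. A common edge would have its ends in both node
  sets, and a common cell its centre.\<close>

lemma drawing_disj:
  assumes p: "set p \<subseteq> V \<union> c ` F" and q: "set q \<subseteq> V \<union> c ` F" and pq: "set p \<inter> set q = {}"
  shows "drawing p \<inter> drawing q = {}"
proof -
  have V_C: "x \<notin> C f" if "x \<in> V \<union> \<Union>E" "f \<in> F" for x f using C_graph[OF that(2)] that(1) by blast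
  have V_E: "x \<notin> e" if "x \<in> V" "e \<in> E" for x e using edge_V[OF that(2)] that(1) by blast
  have c_E: "c f \<notin> e" "c f \<notin> V" if "e \<in> E" "f \<in> F" for e f
    using C_graph[OF that(2)] c_C[OF that(2)] that(1) by blast+
  have c_C': "g = f" if "c f \<in> C g" "f \<in> F" "g \<in> F" for f g
    using C_disj[OF that(2,3)] c_C[OF that(2)] that(1) by blast
  have CC: "g = f" if "x \<in> C f" "x \<in> C g" "f \<in> F" "g \<in> F" for f g x
    using C_disj[OF that(3,4)] that by blast
  have EE: "e = e'" if "x \<in> e" "x \<in> e'" "e \<in> E" "e' \<in> E" for e e' x
    using edge_disj[OF that(3,4)] that by blast
  have en: "\<not> (ends e \<subseteq> set p \<and> ends e \<subseteq> set q)" if "e \<in> E" for e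
  proof
    assume "ends e \<subseteq> set p \<and> ends e \<subseteq> set q"
    then have "ends e = {}" using pq by blast
    then show False using card_ends[OF that] by simp
  qed
  \<comment> \<open>A vertex or centre lying on a drawing is one of its nodes, because edges contain
    neither and each cell contains just its own centre.\<close>
  have node: "x \<in> set r" if x: "x \<in> drawing r" "x \<in> V \<union> c ` F" and r: "set r \<subseteq> V \<union> c ` F" for x r
    using x(1) unfolding drawing_def
  proof (elim UnE)
    assume "x \<in> \<Union>{e\<in>E. ends e \<subseteq> set r}"
    then obtain e where "e \<in> E" "x \<in> e" by blast
    then show ?thesis using x(2) V_E c_E by blast
  next
    assume "x \<in> \<Union>{C f |f. f \<in> F \<and> c f \<in> set r}"
    then obtain f where f: "f \<in> F" "c f \<in> set r" "x \<in> C f" by blast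
    then obtain g where g: "g \<in> F" "x = c g" using x(2) V_C by blast
    then show ?thesis using c_C'[of g f] f by simp
  qed
  show ?thesis
  proof (rule ccontr)
    assume "\<not> ?thesis"
    then obtain x where x: "x \<in> drawing p" "x \<in> drawing q" by blast
    have nn: "x \<notin> V \<union> c ` F" using node[OF x(1) _ p] node[OF x(2) _ q] pq by blast
    have xp: "(\<exists>e\<in>E. ends e \<subseteq> set p \<and> x \<in> e) \<or> (\<exists>f\<in>F. c f \<in> set p \<and> x \<in> C f)"
      using x(1) nn p unfolding drawing_def by blast
    have xq: "(\<exists>e\<in>E. ends e \<subseteq> set q \<and> x \<in> e) \<or> (\<exists>f\<in>F. c f \<in> set q \<and> x \<in> C f)"
      using x(2) nn q unfolding drawing_def by blast
    show False
      using xp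
    proof
      assume "\<exists>e\<in>E. ends e \<subseteq> set p \<and> x \<in> e"
      then obtain e where e: "e \<in> E" "ends e \<subseteq> set p" "x \<in> e" by blast
      then have "\<not> (\<exists>f\<in>F. c f \<in> set q \<and> x \<in> C f)" using V_C by blast
      then obtain e' where e': "e' \<in> E" "ends e' \<subseteq> set q" "x \<in> e'" using xq by blast
      then have "e' = e" using EE e by blast
      then show False using en e e' by blast
    next
      assume "\<exists>f\<in>F. c f \<in> set p \<and> x \<in> C f"
      then obtain f where f: "f \<in> F" "c f \<in> set p" "x \<in> C f" by blast
      then have "\<not> (\<exists>e\<in>E. ends e \<subseteq> set q \<and> x \<in> e)" using V_C by blast
      then obtain g where g: "g \<in> F" "c g \<in> set q" "x \<in> C g" using xq by blast
      then have "g = f" using CC f by blast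
      then show False using f g pq by blast
    qed
  qed
qed

end

section \<open>Shortcuts and distance levels\<close>

text \<open>A shortest list from \<open>A\<close> to \<open>B\<close> inside \<open>set w\<close>
  works: a repeated entry could be cut out, and an inner entry in \<open>A\<close> or in
  \<open>B\<close> would allow a later start or an earlier stop.\<close>

lemma successively_shortcut:
  assumes "successively R w" "w \<noteq> []" "hd w \<in> A" "last w \<in> B" "A \<inter> B = {}"
  obtains q where "successively R q" "2 \<le> length q" "hd q \<in> A" "last q \<in> B" "distinct q"
    "set q \<subseteq> set w" "set (butlast (tl q)) \<inter> (A \<union> B) = {}"
proof -
  let ?P = "\<lambda>q. successively R q \<and> q \<noteq> [] \<and> hd q \<in> A \<and> last q \<in> B \<and> set q \<subseteq> set w"
  have "?P w" using assms by simp
  then obtain q where q: "?P q" and least: "\<And>q'. ?P q' \<Longrightarrow> length q \<le> length q'"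
    using ex_has_least_nat[of ?P w length] by blast
  obtain x m where qm: "q = x # m" using q by (cases q) auto
  have "m \<noteq> []" using q qm assms(5) by auto
  then obtain m' y where my: "m = m' @ [y]" by (metis append_butlast_last_id)
  have "distinct q"
  proof (rule ccontr)
    assume "\<not> distinct q"
    then obtain xs ys zs z where d: "q = xs @ [z] @ ys @ [z] @ zs" using not_distinct_decomp by blast
    have "successively R (xs @ [z] @ zs)"
      using q unfolding d by (auto simp: successively_append_iff successively_Cons)
    moreover have "hd (xs @ [z] @ zs) = hd q" "last (xs @ [z] @ zs) = last q"
      unfolding d by (auto simp: hd_append)
    moreover have "set (xs @ [z] @ zs) \<subseteq> set w" using q d by auto
    ultimately have "?P (xs @ [z] @ zs)" using q by auto
    from least[OF this] show False by (simp add: d)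
  qed
  moreover have "z \<notin> A \<union> B" if "z \<in> set m'" for z
  proof
    obtain us vs where uv: "m' = us @ z # vs" using split_list[OF \<open>z \<in> set m'\<close>] by blast
    then have q': "q = x # us @ z # vs @ [y]" using qm my by simp
    assume "z \<in> A \<union> B"
    then show False
    proof
      assume "z \<in> A"
      then have "?P (z # vs @ [y])" using q unfolding q' by (auto simp: successively_append_iff successively_Cons)
      from least[OF this] show False by (simp add: q')
    next
      assume "z \<in> B"
      have "q = (x # us @ [z]) @ (vs @ [y])" using q' by simp
      then have "successively R (x # us @ [z])" using q successively_append_iff by metis
      then have "?P (x # us @ [z])" using \<open>z \<in> B\<close> q q' by auto
      from least[OF this] show False by (simp add: q')
    qed
  qed
  moreover have "set (butlast (tl q)) = set m'" using qm my by simp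
  ultimately show thesis using that[of q] q qm my by auto
qed

section \<open>Reachability along the frontier of a vertex set\<close>

context disc_map begin

definition VG :: "complex set" where "VG = (\<Union>f\<in>F. VF f)"
definition adjG :: "complex \<Rightarrow> complex \<Rightarrow> bool" where
  "adjG u v \<longleftrightarrow> (\<exists>e\<in>EG. ends e = {u, v})"
definition reach :: "complex set \<Rightarrow> complex \<Rightarrow> complex \<Rightarrow> bool" where
  "reach S u v \<longleftrightarrow> (\<exists>w. w \<noteq> [] \<and> hd w = u \<and> last w = v \<and> successively adjG w \<and> set w \<subseteq> S)"

lemma reach_refl: "u \<in> S \<Longrightarrow> reach S u u"
  unfolding reach_def by (rule exI[of _ "[u]"]) simp

lemma reach_step:
  assumes "reach S u v" "adjG v x" "x \<in> S" shows "reach S u x"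
proof -
  obtain w where "w \<noteq> []" "hd w = u" "last w = v" "successively adjG w" "set w \<subseteq> S"
    using assms(1) by (auto simp: reach_def)
  then show ?thesis
    unfolding reach_def using assms(2,3)
    by (intro exI[of _ "w @ [x]"]) (auto simp: successively_append_iff)
qed

lemma adjG_sym: "adjG u v \<Longrightarrow> adjG v u"
  by (auto simp: adjG_def insert_commute)

lemma ends_pair:
  assumes "e \<in> E" obtains u v where "ends e = {u, v}" "u \<noteq> v"
  using card_ends[OF assms] by (auto simp: card_2_iff)

lemma card_Int_ends: "u \<noteq> v \<Longrightarrow> card ({u, v} \<inter> K) = 1 \<longleftrightarrow> (u \<in> K) \<noteq> (v \<in> K)"
  by (auto simp: Int_insert_left)

text \<open>In use, \<open>U\<close> is a sublevel set and \<open>S\<close> the set of vertices near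
  the level. On every rim the crossing edges with reachable outer end form the cut of a suitable
  vertex set \<open>K\<close>, so their number is even; summation over the faces leaves the boundary
  edges.\<close>

lemma even_reach_crossings:
  assumes face: "\<And>f. f \<in> F \<Longrightarrow> VF f - U \<subseteq> S \<or> VF f \<inter> U \<subseteq> S"
    and cross: "\<And>u v. adjG u v \<Longrightarrow> u \<in> U \<Longrightarrow> v \<notin> U \<Longrightarrow> v \<in> S"
  shows "even (card {e\<in>EB. \<exists>u v. ends e = {u, v} \<and> u \<in> U \<and> v \<notin> U \<and> reach S p v})"
proof (rule even_boundary_crossings[where \<E> = EG and F = F and D = EF])
  fix f assume f: "f \<in> F"
  let ?P = "\<lambda>e. \<exists>u v. ends e = {u, v} \<and> u \<in> U \<and> v \<notin> U \<and> reach S p v"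
  have ad: "adjG u v" if "e \<in> EF f" "ends e = {u, v}" for e u v
    using that f by (auto simp: adjG_def EG_def)
  have VFe: "u \<in> VF f" "v \<in> VF f" if "e \<in> EF f" "ends e = {u, v}" for e u v
    using ends_VF[OF f that(1)] that(2) by auto
  show "even (card {e\<in>EF f. ?P e})"
    using face[OF f]
  proof
    assume out: "VF f - U \<subseteq> S"
    \<comment> \<open>All outer vertices of the face are in \<open>S\<close>, so two adjacent ones
      are both reachable or both not; the cut of \<open>K\<close> thus contains no edge between
      outer vertices.\<close>
    define K where "K = {v\<in>VF f. v \<notin> U \<and> reach S p v}"
    have "?P e \<longleftrightarrow> card (ends e \<inter> K) = 1" if e: "e \<in> EF f" for e
    proof -
      have eE: "e \<in> E" using e by (simp add: EF_def)
      obtain u v where uv: "ends e = {u, v}" "u \<noteq> v" using ends_pair[OF eE] .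
      have one: "x \<in> U" if "ends e = {x, y}" "y \<in> K" "x \<notin> K" for x y
      proof (rule ccontr)
        assume "x \<notin> U"
        then have "x \<in> S" using out VFe(1)[OF e that(1)] by blast
        moreover have "reach S p y" using that(2) by (simp add: K_def)
        ultimately have "reach S p x" using reach_step[of S p y x] adjG_sym[OF ad[OF e that(1)]] by blast
        then show False using that(3) \<open>x \<notin> U\<close> VFe(1)[OF e that(1)] by (simp add: K_def)
      qed
      have vu: "ends e = {v, u}" using uv(1) by (simp add: insert_commute)
      show ?thesis
        unfolding uv(1) card_Int_ends[OF uv(2)]
      proof
        assume "\<exists>x y. {u, v} = {x, y} \<and> x \<in> U \<and> y \<notin> U \<and> reach S p y"
        then obtain x y where xy: "{u, v} = {x, y}" "x \<in> U" "y \<notin> U" "reach S p y" by blast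
        then have "y \<in> K" "x \<notin> K" using VFe(2)[OF e, of x y] uv(1) by (auto simp: K_def)
        then show "(u \<in> K) \<noteq> (v \<in> K)" using xy(1) by (auto simp: doubleton_eq_iff)
      next
        assume "(u \<in> K) \<noteq> (v \<in> K)"
        then consider "u \<in> K" "v \<notin> K" | "v \<in> K" "u \<notin> K" by blast
        then show "\<exists>x y. {u, v} = {x, y} \<and> x \<in> U \<and> y \<notin> U \<and> reach S p y"
        proof cases
          case 1
          then have "v \<in> U" using one[OF vu] by blast
          then show ?thesis using 1 by (intro exI[of _ v] exI[of _ u]) (auto simp: K_def)
        next
          case 2
          then have "u \<in> U" using one[OF uv(1)] by blast
          then show ?thesis using 2 by (intro exI[of _ u] exI[of _ v]) (auto simp: K_def)
        qed
      qed
    qed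
    then have "{e\<in>EF f. ?P e} = {e\<in>EF f. card (ends e \<inter> K) = 1}" by blast
    then show ?thesis using even_face_cut[OF f] by simp
  next
    assume inn: "VF f \<inter> U \<subseteq> S"
    \<comment> \<open>Here the inner vertices of the face are in \<open>S\<close>. An inner vertex
      passes its reachability on to the outer end of a crossing edge by \<open>cross\<close>, and
      receives it back, so both sides give the same edges.\<close>
    define K where "K = {u\<in>VF f. u \<in> U \<and> reach S p u}"
    have "?P e \<longleftrightarrow> card (ends e \<inter> K) = 1" if e: "e \<in> EF f" for e
    proof -
      have eE: "e \<in> E" using e by (simp add: EF_def)
      obtain u v where uv: "ends e = {u, v}" "u \<noteq> v" using ends_pair[OF eE] .
      have one: "y \<notin> U \<and> reach S p y" if "ends e = {x, y}" "x \<in> K" "y \<notin> K" for x y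
      proof -
        note VFy = VFe(2)[OF e that(1)] and adxy = ad[OF e that(1)]
        have "y \<notin> U"
        proof
          assume "y \<in> U"
          then have "y \<in> S" using inn VFy by blast
          moreover have "reach S p x" using that(2) by (simp add: K_def)
          ultimately have "reach S p y" using reach_step[of S p x y] adxy by blast
          then show False using that(3) \<open>y \<in> U\<close> VFy by (simp add: K_def)
        qed
        moreover have "y \<in> S" using cross[OF adxy] that(2) calculation by (simp add: K_def)
        ultimately show ?thesis using that(2) adxy reach_step[of S p x y] by (simp add: K_def)
      qed
      have vu: "ends e = {v, u}" using uv(1) by (simp add: insert_commute)
      show ?thesis
        unfolding uv(1) card_Int_ends[OF uv(2)]
      proof
        assume "\<exists>x y. {u, v} = {x, y} \<and> x \<in> U \<and> y \<notin> U \<and> reach S p y"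
        then obtain x y where xy: "{u, v} = {x, y}" "x \<in> U" "y \<notin> U" "reach S p y" by blast
        have exy: "ends e = {x, y}" using xy(1) uv(1) by simp
        have "x \<in> S" using inn VFe(1)[OF e exy] xy(2) by blast
        then have "reach S p x" using reach_step[of S p y x] xy(4) adjG_sym[OF ad[OF e exy]] by blast
        then have "x \<in> K" "y \<notin> K" using VFe(1)[OF e exy] xy by (auto simp: K_def)
        then show "(u \<in> K) \<noteq> (v \<in> K)" using xy(1) by (auto simp: doubleton_eq_iff)
      next
        assume "(u \<in> K) \<noteq> (v \<in> K)"
        then consider "u \<in> K" "v \<notin> K" | "v \<in> K" "u \<notin> K" by blast
        then show "\<exists>x y. {u, v} = {x, y} \<and> x \<in> U \<and> y \<notin> U \<and> reach S p y"
        proof cases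
          case 1
          have "u \<in> U" using 1 by (simp add: K_def)
          then show ?thesis using one[OF uv(1) 1] by (intro exI[of _ u] exI[of _ v]) simp
        next
          case 2
          have "v \<in> U" using 2 by (simp add: K_def)
          then show ?thesis using one[OF vu 2] by (intro exI[of _ v] exI[of _ u]) (simp add: insert_commute)
        qed
      qed
    qed
    then have "{e\<in>EF f. ?P e} = {e\<in>EF f. card (ends e \<inter> K) = 1}" by blast
    then show ?thesis using even_face_cut[OF f] by simp
  qed
next
  show "finite EG" using finE EG_E by (rule rev_finite_subset)
  show "EF f \<subseteq> EG" if "f \<in> F" for f using that by (auto simp: EG_def)
qed (use finF EB_EG inner_edge_faces boundary_edge_face in auto)

text \<open>Only two boundary edges leave \<open>U\<close>. The first is counted because
  \<open>p1\<close> reaches itself, and an even count then includes the second.\<close>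

lemma reach_terminal:
  assumes face: "\<And>f. f \<in> F \<Longrightarrow> VF f - U \<subseteq> S \<or> VF f \<inter> U \<subseteq> S"
    and cross: "\<And>u v. adjG u v \<Longrightarrow> u \<in> U \<Longrightarrow> v \<notin> U \<Longrightarrow> v \<in> S"
    and EBc: "{e\<in>EB. \<exists>u v. ends e = {u, v} \<and> u \<in> U \<and> v \<notin> U} = {e1, e2}" and ne: "e1 \<noteq> e2"
    and e1: "ends e1 = {s1, p1}" "s1 \<in> U" "p1 \<notin> U" and e2: "ends e2 = {s2, p2}" "s2 \<in> U" "p2 \<notin> U"
    and p1: "p1 \<in> S"
  shows "reach S p1 p2"
proof -
  let ?X = "{e\<in>EB. \<exists>u v. ends e = {u, v} \<and> u \<in> U \<and> v \<notin> U \<and> reach S p1 v}"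
  have ev: "even (card ?X)" by (rule even_reach_crossings[OF face cross])
  have "?X \<subseteq> {e1, e2}" unfolding EBc[symmetric] by blast
  moreover have "e1 \<in> ?X" using EBc e1 reach_refl[OF p1] by blast
  ultimately have "e2 \<in> ?X"
  proof -
    assume *: "?X \<subseteq> {e1, e2}" "e1 \<in> ?X"
    show "e2 \<in> ?X"
    proof (rule ccontr)
      assume "e2 \<notin> ?X"
      with * have "?X = {e1}" by blast
      then show False using ev by simp
    qed
  qed
  then obtain u v where "{s2, p2} = {u, v}" "u \<in> U" "v \<notin> U" "reach S p1 v" using e2(1) by auto
  then show ?thesis using e2 by (auto simp: doubleton_eq_iff)
qed

section \<open>Distances in the graph enlarged by the face centres\<close>

definition adjT :: "complex \<Rightarrow> complex \<Rightarrow> bool" where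
  "adjT u v \<longleftrightarrow> adjG u v \<or> incident u v"

definition inner_nodes :: "complex set" where
  "inner_nodes = (VG - sphere 0 1) \<union> c ` F"

definition tpath :: "complex set \<Rightarrow> complex list \<Rightarrow> bool" where
  "tpath S p \<longleftrightarrow> p \<noteq> [] \<and> hd p \<in> S \<and> successively adjT p \<and> set (tl p) \<subseteq> inner_nodes"

text \<open>Terminals lie on the circle and carry no weight, so the source is dropped by
  \<open>tl\<close> and the list stops one step before \<open>S'\<close>. Requiring a non-empty
  \<open>tl p\<close> keeps the empty set out of the family, which makes the constant density 1
  admissible.\<close>

definition TP :: "complex set \<Rightarrow> complex set \<Rightarrow> complex set set" where
  "TP S S' = {set (tl p) | p. tpath S p \<and> tl p \<noteq> [] \<and> (\<exists>y\<in>S'. adjT (last p) y)}"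

text \<open>The inserted 2 caps the distance and keeps the infimum defined at nodes that no path
  reaches. Any value above all levels \<open>t\<close> up to 1 would serve.\<close>

definition tdist :: "complex set \<Rightarrow> (complex \<Rightarrow> real) \<Rightarrow> complex \<Rightarrow> real" where
  "tdist S \<tau> n = Inf (insert 2 {sum \<tau> (set (tl p)) | p. tpath S p \<and> last p = n})"

context
  fixes \<tau> :: "complex \<Rightarrow> real" assumes tau: "\<And>n. 0 \<le> \<tau> n"
begin

lemma tdist_le: "tpath S p \<Longrightarrow> last p = n \<Longrightarrow> tdist S \<tau> n \<le> sum \<tau> (set (tl p))"
  and tdist_le_2: "tdist S \<tau> n \<le> 2"
proof -
  have "bdd_below (insert 2 {sum \<tau> (set (tl p)) | p. tpath S p \<and> last p = n})"
    using tau by (intro bdd_belowI[of _ 0]) (auto intro: sum_nonneg)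
  then show "tpath S p \<Longrightarrow> last p = n \<Longrightarrow> tdist S \<tau> n \<le> sum \<tau> (set (tl p))" "tdist S \<tau> n \<le> 2"
    unfolding tdist_def by (auto intro!: cInf_lower)
qed

lemma tdist_greatest:
  assumes "k \<le> 2" "\<And>p. tpath S p \<Longrightarrow> last p = n \<Longrightarrow> k \<le> sum \<tau> (set (tl p))"
  shows "k \<le> tdist S \<tau> n"
  unfolding tdist_def using assms by (intro cInf_greatest) auto

lemma tdist_step:
  assumes "adjT n n'" "n' \<in> inner_nodes"
  shows "tdist S \<tau> n' \<le> tdist S \<tau> n + \<tau> n'"
proof -
  have "tdist S \<tau> n' - \<tau> n' \<le> tdist S \<tau> n"
  proof (rule tdist_greatest)
    show "tdist S \<tau> n' - \<tau> n' \<le> 2" using tdist_le_2[of S n'] tau[of n'] by linarith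
    fix p assume p: "tpath S p" "last p = n"
    then have "tpath S (p @ [n'])"
      using assms by (auto simp: tpath_def successively_append_iff)
    then have "tdist S \<tau> n' \<le> sum \<tau> (set (tl (p @ [n'])))" by (intro tdist_le) auto
    also have "tl (p @ [n']) = tl p @ [n']" using p by (cases p) (auto simp: tpath_def)
    also have "sum \<tau> (set (tl p @ [n'])) \<le> sum \<tau> (set (tl p)) + \<tau> n'"
      using tau by (cases "n' \<in> set (tl p)") (auto simp: insert_absorb)
    finally show "tdist S \<tau> n' - \<tau> n' \<le> sum \<tau> (set (tl p))" by simp
  qed
  then show ?thesis by simp
qed

lemma tdist_source:
  assumes "s \<in> S" "adjT s n" "n \<in> inner_nodes" shows "tdist S \<tau> n \<le> \<tau> n"
proof -
  have "tpath S [s, n]" using assms by (auto simp: tpath_def)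
  from tdist_le[OF this] show ?thesis by simp
qed

lemma tdist_sink:
  assumes "adm (TP S S') \<tau>" "n \<in> inner_nodes" "n \<notin> S" "y \<in> S'" "adjT n y"
  shows "1 \<le> tdist S \<tau> n"
proof (rule tdist_greatest)
  fix p assume p: "tpath S p" "last p = n"
  then have "tl p \<noteq> []" using assms(3) by (cases p) (auto simp: tpath_def)
  then have "set (tl p) \<in> TP S S'" using p assms(4,5) by (auto simp: TP_def)
  then show "1 \<le> sum \<tau> (set (tl p))" using assms(1) by (simp add: adm_def)
qed simp

end

lemma c_inner: "f \<in> F \<Longrightarrow> c f \<in> inner_nodes" by (simp add: inner_nodes_def)

lemma c_ball: "f \<in> F \<Longrightarrow> c f \<in> ball 0 1"
  using c_C C_ball h_ball_subset by blast

lemma inner_nodes_sphere: "inner_nodes \<inter> sphere 0 1 = {}"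
  using c_ball by (force simp: inner_nodes_def)

lemma incident_c: "f \<in> F \<Longrightarrow> v \<in> VF f \<Longrightarrow> adjT (c f) v \<and> adjT v (c f)"
  by (auto simp: adjT_def incident_def)

lemma adjG_VF: assumes "adjG u v" obtains f where "f \<in> F" "u \<in> VF f" "v \<in> VF f"
  using assms ends_VF by (fastforce simp: adjG_def EG_def)

text \<open>Feeds \<open>reach_terminal\<close> with the sublevel set \<open>U\<close> of the
  distance from \<open>S\<close>. The point is that on every face the outer vertices, or else the
  inner ones, all lie within the fattened range of the level; the centre, adjacent to the whole rim,
  controls the spread. For a face with pairwise adjacent vertices the centre is not consulted, which
  is why \<open>M\<close> is then unconstrained there.\<close>

lemma level_reach:
  assumes S: "S \<subseteq> sphere 0 1" and S': "S' \<subseteq> sphere 0 1"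
    and sep: "\<And>f. f \<in> F \<Longrightarrow> VF f \<inter> S = {} \<or> VF f \<inter> S' = {}"
    and adm: "adm (TP S S') \<tau>" and t: "0 < t" "t \<le> 1"
    and M0: "\<And>v. 0 \<le> M v"
    and M: "\<And>f. f \<in> F \<Longrightarrow> (\<forall>v\<in>VF f. \<tau> (c f) \<le> M v) \<or>
       (\<forall>u\<in>VF f. \<forall>v\<in>VF f. u \<noteq> v \<longrightarrow> adjG u v)"
    and EBc: "{e\<in>EB. \<exists>u v. ends e = {u, v} \<and> u \<in> S \<and> v \<notin> S} = {e1, e2}" and ne: "e1 \<noteq> e2"
    and e1: "ends e1 = {s1, p1}" "s1 \<in> S" "p1 \<notin> S \<union> S'" and e2: "ends e2 = {s2, p2}" "s2 \<in> S" "p2 \<notin> S \<union> S'"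
    and p1: "p1 \<in> VG \<inter> sphere 0 1" and p2: "p2 \<in> VG \<inter> sphere 0 1"
  shows "reach {v\<in>VG. v \<notin> S \<union> S' \<and> (v \<notin> sphere 0 1 \<longrightarrow>
      tdist S \<tau> v - \<tau> v - M v < t \<and> t \<le> tdist S \<tau> v + M v)} p1 p2"
    (is "reach ?G p1 p2")
proof -
  let ?d = "tdist S \<tau>"
  have tau: "\<And>n. 0 \<le> \<tau> n" using adm by (simp add: adm_def)
  note step = tdist_step[where \<tau> = \<tau>, OF tau]
    and source = tdist_source[where \<tau> = \<tau>, OF tau]
    and sink = tdist_sink[where \<tau> = \<tau>, OF tau adm]
  define U where "U = S \<union> {v\<in>VG - sphere 0 1. ?d v < t}"
  have US: "U \<inter> sphere 0 1 = S" using S by (auto simp: U_def)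
  have U_inner: "u \<in> inner_nodes \<and> u \<notin> S \<and> ?d u < t" if "u \<in> U" "u \<notin> S" for u
    using that by (auto simp: U_def inner_nodes_def)
  have V_inner: "v \<in> inner_nodes" if "v \<in> VG" "v \<notin> sphere 0 1" for v
    using that by (auto simp: inner_nodes_def)
  have VF_VG: "v \<in> VG" if "f \<in> F" "v \<in> VF f" for f v using that by (auto simp: VG_def)
  \<comment> \<open>A single step out of \<open>U\<close> overshoots the level by less than the
    value of the node entered; from a source, it is \<open>0 < t\<close> that makes the inequality
    strict.\<close>
  have near: "?d n < t + \<tau> n" if "adjT u n" "u \<in> U" "n \<in> inner_nodes" for u n
  proof (cases "u \<in> S")
    case True then show ?thesis using source[of u S n] that t by simp
  next
    case False then show ?thesis using step[of u n S] that U_inner[of u] by simp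
  qed
  have cross: "v \<in> ?G" if uv: "adjG u v" "u \<in> U" "v \<notin> U" for u v
  proof -
    obtain f where f: "f \<in> F" "u \<in> VF f" "v \<in> VF f" using adjG_VF[OF uv(1)] .
    have ad: "adjT u v" using uv(1) by (simp add: adjT_def)
    have vS: "v \<notin> S" using uv(3) by (auto simp: U_def)
    have vS': "v \<notin> S'"
    proof
      assume v: "v \<in> S'"
      show False
      proof (cases "u \<in> S")
        case True then show False using sep[OF f(1)] f v by blast
      next
        case False
        then show False using sink[of u v] U_inner[OF uv(2)] ad v t by force
      qed
    qed
    have "?d v - \<tau> v - M v < t \<and> t \<le> ?d v + M v" if v: "v \<notin> sphere 0 1"
    proof -
      have "?d v < t + \<tau> v" using near[OF ad uv(2) V_inner] VF_VG[OF f(1,3)] v by blast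
      moreover have "t \<le> ?d v" using uv(3) VF_VG[OF f(1,3)] v by (auto simp: U_def)
      ultimately show ?thesis using M0[of v] by simp
    qed
    then show ?thesis using vS vS' VF_VG[OF f(1,3)] by simp
  qed
  \<comment> \<open>Without inner vertices the second alternative is trivial. With pairwise
    adjacency every outer vertex is entered by a crossing edge. In the remaining case the distance
    of the centre decides.\<close>
  have face: "VF f - U \<subseteq> ?G \<or> VF f \<inter> U \<subseteq> ?G" if f: "f \<in> F" for f
  proof (cases "VF f \<inter> U = {}")
    case False
    then obtain u where u: "u \<in> VF f" "u \<in> U" by blast
    show ?thesis
      using M[OF f]
    proof
      assume all: "\<forall>u\<in>VF f. \<forall>v\<in>VF f. u \<noteq> v \<longrightarrow> adjG u v"
      have "VF f - U \<subseteq> ?G"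
      proof
        fix v assume v: "v \<in> VF f - U"
        then have "u \<noteq> v" using u by auto
        then have "adjG u v" using all u v by simp
        then show "v \<in> ?G" using cross[of u v] u v by simp
      qed
      then show ?thesis ..
    next
      assume Mf: "\<forall>v\<in>VF f. \<tau> (c f) \<le> M v"
      have dc: "?d (c f) < t + \<tau> (c f)" using near[of u "c f"] incident_c[OF f u(1)] u(2) c_inner[OF f] by blast
      have cS: "c f \<notin> S" using inner_nodes_sphere c_inner[OF f] S by blast
      have dv: "?d v \<le> ?d (c f) + \<tau> v" "?d (c f) \<le> ?d v + \<tau> (c f)"
        if "v \<in> VF f" "v \<notin> sphere 0 1" for v
        using step[of "c f" v S] step[of v "c f" S] incident_c[OF f that(1)] c_inner[OF f]
          V_inner[OF VF_VG[OF f that(1)] that(2)] by auto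
      have outU: "t \<le> ?d v" if "v \<in> VF f - U" "v \<notin> sphere 0 1" for v
        using that VF_VG[OF f] by (auto simp: U_def)
      show ?thesis
      proof (cases "?d (c f) < t")
        case True
        \<comment> \<open>The centre is below the level, so every outer vertex is one step away from
          a node below it. A vertex of \<open>S'\<close> on the rim would put the centre at distance
          at least 1.\<close>
        have "VF f - U \<subseteq> ?G"
        proof
          fix v assume v: "v \<in> VF f - U"
          then have "v \<notin> S" by (auto simp: U_def)
          moreover have "v \<notin> S'"
          proof
            assume "v \<in> S'"
            then have "1 \<le> ?d (c f)" using sink[of "c f" v] c_inner[OF f] cS incident_c[OF f] v by blast
            then show False using True t by simp
          qed
          moreover have "?d v - \<tau> v - M v < t \<and> t \<le> ?d v + M v" if "v \<notin> sphere 0 1"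
            using dv(1)[of v] outU[OF v that] v that True M0[of v] by auto
          ultimately show "v \<in> ?G" using v VF_VG[OF f] by blast
        qed
        then show ?thesis ..
      next
        case cf: False
        show ?thesis
        proof (cases "VF f \<inter> S' = {}")
          case True
          \<comment> \<open>The centre exceeds the level by less than its own value, and an outer
            vertex adds its value to that; \<open>M\<close> absorbs the share of the centre.\<close>
          have "VF f - U \<subseteq> ?G"
          proof
            fix v assume v: "v \<in> VF f - U"
            have "?d v - \<tau> v - M v < t \<and> t \<le> ?d v + M v" if "v \<notin> sphere 0 1"
              using dv(1)[of v] outU[OF v that] v that dc M0[of v] Mf by force
            moreover have "v \<notin> S \<union> S'" using v True by (auto simp: U_def)
            ultimately show "v \<in> ?G" using v VF_VG[OF f] by blast
          qed
          then show ?thesis ..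
        next
          case False
          then have noS: "VF f \<inter> S = {}" using sep[OF f] by blast
          \<comment> \<open>The outer vertices now include points of \<open>S'\<close>, which are
            excluded from the level set. The inner ones are not in \<open>S\<close> by
            \<open>sep\<close>, and they lie below the level by at most the value of the
            centre.\<close>
          have "VF f \<inter> U \<subseteq> ?G"
          proof
            fix v assume v: "v \<in> VF f \<inter> U"
            then have vi: "v \<notin> S" "v \<notin> sphere 0 1" "?d v < t" using noS US U_inner by blast+
            then have "?d v - \<tau> v - M v < t \<and> t \<le> ?d v + M v"
              using dv(2)[of v] v cf Mf M0[of v] tau[of v] by force
            then show "v \<in> ?G" using vi v S' VF_VG[OF f] by blast
          qed
          then show ?thesis ..
        qed
      qed
    qed
  qed blast
  \<comment> \<open>On the circle the sublevel set is just \<open>S\<close>, so boundary crossings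
    do not depend on the level.\<close>
  have EBU: "{e\<in>EB. \<exists>u v. ends e = {u, v} \<and> u \<in> U \<and> v \<notin> U} = {e1, e2}"
  proof -
    have "x \<in> U \<longleftrightarrow> x \<in> S" if "e \<in> EB" "x \<in> ends e" for e x
      using ends_EB[OF that(1)] that(2) US by blast
    then have "{e\<in>EB. \<exists>u v. ends e = {u, v} \<and> u \<in> U \<and> v \<notin> U} = {e\<in>EB. \<exists>u v. ends e = {u, v} \<and> u \<in> S \<and> v \<notin> S}"
      by (auto 0 5)
    then show ?thesis using EBc by simp
  qed
  have p1G: "p1 \<in> ?G" using p1 e1 by auto
  show ?thesis
  proof (rule reach_terminal[where U = U, OF _ _ EBU ne e1(1) _ _ e2(1) _ _ p1G])
    show "s1 \<in> U" "s2 \<in> U" using e1 e2 by (auto simp: U_def)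
    show "p1 \<notin> U" "p2 \<notin> U" using e1 e2 p1 p2 US by auto
    show "VF f - U \<subseteq> ?G \<or> VF f \<inter> U \<subseteq> ?G" if "f \<in> F" for f by (rule face[OF that])
    show "v \<in> ?G" if "adjG u v" "u \<in> U" "v \<notin> U" for u v by (rule cross[OF that])
  qed
qed

end

lemma sum_set_le_sum_list:
  fixes f :: "'b \<Rightarrow> real"
  assumes "\<And>x. x \<in> set xs \<Longrightarrow> 0 \<le> f x" shows "sum f (set xs) \<le> sum_list (map f xs)"
  using assms
proof (induction xs)
  case (Cons x xs)
  then show ?case by (cases "x \<in> set xs") (auto simp: insert_absorb add_increasing)
qed simp

lemma set_ends_interior:
  assumes "2 \<le> length p"
  shows "set p = {hd p, last p} \<union> set (butlast (tl p))"
proof -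
  obtain x m where xm: "p = x # m" "m \<noteq> []" using assms by (cases p) (auto simp: Suc_le_eq)
  then have "p = x # butlast m @ [last m]" by simp
  then have "set p = {x, last m} \<union> set (butlast m)" by (metis list.simps(15) set_append list.set(1) insert_is_Un Un_commute Un_assoc)
  then show ?thesis using xm by simp
qed

section \<open>Integration over levels and charging of centre values\<close>

context disc_map begin

definition adjE :: "complex \<Rightarrow> complex \<Rightarrow> bool" where
  "adjE u v \<longleftrightarrow> (\<exists>e\<in>E. ends e = {u, v})"

definition cpath :: "complex list \<Rightarrow> bool" where
  "cpath p \<longleftrightarrow> 2 \<le> length p \<and> set p \<subseteq> V \<and> successively adjE p \<and>
     hd p \<in> sphere 0 1 \<and> last p \<in> sphere 0 1 \<and> set (butlast (tl p)) \<inter> sphere 0 1 = {}"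

lemma VG_V: "VG \<subseteq> V" by (auto simp: VG_def VF_def)

lemma finite_VG: "finite VG" using VG_V finV by (rule finite_subset)

lemma finite_inner_nodes: "finite inner_nodes"
  using finite_VG finF by (simp add: inner_nodes_def)

lemma c_V: "f \<in> F \<Longrightarrow> c f \<notin> V" using c_C C_graph by blast

lemma TP_inner: "TP S S' \<subseteq> Pow inner_nodes"
  by (auto simp: TP_def tpath_def)

lemma joined_sym: "joined u v \<Longrightarrow> joined v u"
  by (auto simp: joined_def incident_def insert_commute)

lemma adjT_joined: "adjT u v \<Longrightarrow> joined u v"
  using EG_E by (auto simp: adjT_def joined_def adjG_def)

lemma sum_interior:
  assumes "cpath q" "distinct q" and z: "\<forall>v\<in>V \<inter> sphere 0 1. \<mu> v = 0"
  shows "path_length \<mu> q = sum \<mu> (set q - sphere 0 1)"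
proof -
  have "path_length \<mu> q = sum \<mu> (set q)"
    using assms(2) by (simp add: path_length_def sum_list_distinct_conv_sum_set)
  also have "\<dots> = sum \<mu> (set q - sphere 0 1)"
    using assms(1) z by (intro sum.mono_neutral_right) (auto simp: cpath_def)
  finally show ?thesis .
qed

text \<open>At every level, \<open>level_reach\<close> yields a walk from \<open>A\<close> to
  \<open>B\<close>; shortened, it belongs to \<open>\<Gamma>\<close>, so the inner vertices of the
  level set have \<open>\<mu>\<close>-sum at least 1. The fattened range of \<open>v\<close> has
  length \<open>\<tau> v + 2 * M v\<close>. \<open>Z\<close> holds the points of the circle outside
  all four terminal sets, and no vertex lies there.\<close>

lemma level_inequality:
  assumes S: "S \<subseteq> sphere 0 1" and S': "S' \<subseteq> sphere 0 1"
    and sep: "\<And>f. f \<in> F \<Longrightarrow> VF f \<inter> S = {} \<or> VF f \<inter> S' = {}"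
    and adm: "adm (TP S S') \<tau>" and M0: "\<And>v. 0 \<le> M v"
    and M: "\<And>f. f \<in> F \<Longrightarrow> (\<forall>v\<in>VF f. \<tau> (c f) \<le> M v) \<or>
       (\<forall>u\<in>VF f. \<forall>v\<in>VF f. u \<noteq> v \<longrightarrow> adjG u v)"
    and EBc: "{e\<in>EB. \<exists>u v. ends e = {u, v} \<and> u \<in> S \<and> v \<notin> S} = {e1, e2}" and ne: "e1 \<noteq> e2"
    and e1: "ends e1 = {s1, p1}" "s1 \<in> S" "p1 \<notin> S \<union> S'" and e2: "ends e2 = {s2, p2}" "s2 \<in> S" "p2 \<notin> S \<union> S'"
    and p1: "p1 \<in> A" and p2: "p2 \<in> B" and AB: "A \<inter> B = {}" "sphere 0 1 = S \<union> S' \<union> A \<union> B \<union> Z"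
    and Z: "V \<inter> Z = {}"
    and ABs: "A \<union> B \<subseteq> sphere 0 1" "A \<inter> (S \<union> S') = {}" "B \<inter> (S \<union> S') = {}"
    and \<Gamma>: "\<And>q. cpath q \<Longrightarrow> hd q \<in> A \<Longrightarrow> last q \<in> B \<Longrightarrow> q \<in> \<Gamma>"
    and \<mu>: "admissible V \<Gamma> (V \<inter> sphere 0 1) \<mu>"
  shows "1 \<le> (\<Sum>v\<in>VG - sphere 0 1. \<mu> v * (\<tau> v + 2 * M v))"
proof -
  let ?W = "VG - sphere 0 1"
  let ?lo = "\<lambda>v. tdist S \<tau> v - \<tau> v - M v" and ?hi = "\<lambda>v. tdist S \<tau> v + M v"
  have tau: "0 \<le> \<tau> n" for n using adm by (simp add: adm_def)
  have e12: "e1 \<in> EB" "e2 \<in> EB" using EBc by auto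
  have p12: "p1 \<in> VG \<inter> sphere 0 1" "p2 \<in> VG \<inter> sphere 0 1"
  proof -
    have "ends e \<subseteq> VG \<inter> sphere 0 1" if "e \<in> EB" for e
    proof -
      obtain f where "f \<in> F" "e \<in> EF f" using EB_EG \<open>e \<in> EB\<close> unfolding EG_def by blast
      then have "ends e \<subseteq> VG" using ends_VF by (auto simp: VG_def)
      then show ?thesis using ends_EB[OF that] by blast
    qed
    then show "p1 \<in> VG \<inter> sphere 0 1" "p2 \<in> VG \<inter> sphere 0 1" using e12 e1(1) e2(1) by blast+
  qed
  have "1 \<le> (\<Sum>v\<in>?W. \<mu> v * (?hi v - ?lo v))"
  proof (rule sum_mult_interval_length_ge_1)
    show "finite ?W" using finite_VG by simp
    show "0 \<le> \<mu> v" if "v \<in> ?W" for v using \<mu> that VG_V by (auto simp: admissible_def)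
    show "?lo v \<le> ?hi v" for v using tau[of v] M0[of v] by simp
    fix t :: real assume t: "0 < t" "t \<le> 1"
    let ?G = "{v\<in>VG. v \<notin> S \<union> S' \<and> (v \<notin> sphere 0 1 \<longrightarrow> ?lo v < t \<and> t \<le> ?hi v)}"
    have "reach ?G p1 p2"
      by (rule level_reach[OF S S' sep adm t M0 M EBc ne e1 e2 p12])
    then obtain w where w: "w \<noteq> []" "hd w = p1" "last w = p2" "successively adjG w" "set w \<subseteq> ?G"
      by (auto simp: reach_def)
    obtain q where q: "successively adjG q" "2 \<le> length q" "hd q \<in> A" "last q \<in> B" "distinct q"
      "set q \<subseteq> set w" "set (butlast (tl q)) \<inter> (A \<union> B) = {}"
      using successively_shortcut[OF w(4,1), of A B] w p1 p2 AB(1) by metis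
    have qG: "set q \<subseteq> ?G" using q(6) w(5) by blast
    have qV: "set q \<subseteq> V" using qG VG_V by auto
    have "successively adjE q"
      using q(1) by (rule successively_mono) (use EG_E in \<open>auto simp: adjG_def adjE_def\<close>)
    moreover have "set (butlast (tl q)) \<inter> sphere 0 1 = {}"
    proof -
      have "set (butlast (tl q)) \<subseteq> set q" using q(2) set_ends_interior by blast
      then have "set (butlast (tl q)) \<inter> (S \<union> S' \<union> Z) = {}" using qG qV Z by blast
      then show ?thesis using q(7) AB(2) by blast
    qed
    ultimately have cq: "cpath q" using q qV ABs(1) by (auto simp: cpath_def)
    then have "1 \<le> path_length \<mu> q" using \<Gamma>[OF cq q(3,4)] \<mu> by (simp add: admissible_def)
    also have "\<dots> = sum \<mu> (set q - sphere 0 1)"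
      using \<mu> by (intro sum_interior[OF cq q(5)]) (simp add: admissible_def)
    also have "\<dots> \<le> (\<Sum>v\<in>{v\<in>?W. ?lo v < t \<and> t \<le> ?hi v}. \<mu> v)"
    proof (rule sum_mono2)
      show "finite {v\<in>?W. ?lo v < t \<and> t \<le> ?hi v}" using finite_VG by simp
      show "set q - sphere 0 1 \<subseteq> {v\<in>?W. ?lo v < t \<and> t \<le> ?hi v}" using qG by auto
      show "0 \<le> \<mu> v" if "v \<in> {v\<in>?W. ?lo v < t \<and> t \<le> ?hi v} - (set q - sphere 0 1)" for v
        using \<mu> that VG_V by (auto simp: admissible_def)
    qed
    finally show "1 \<le> (\<Sum>v\<in>{v\<in>?W. ?lo v < t \<and> t \<le> ?hi v}. \<mu> v)" .
  qed
  also have "\<dots> = (\<Sum>v\<in>?W. \<mu> v * (\<tau> v + 2 * M v))" by (intro sum.cong) auto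
  finally show ?thesis .
qed

text \<open>The inserted 0 gives the maximum a value at vertices lying on no rim.\<close>

definition face_max :: "(complex \<Rightarrow> real) \<Rightarrow> complex \<Rightarrow> real" where
  "face_max \<tau> v = Max (insert 0 ((\<lambda>f. \<tau> (c f)) ` {f\<in>F. v \<in> VF f}))"

lemma face_max: "0 \<le> face_max \<tau> v" "f \<in> F \<Longrightarrow> v \<in> VF f \<Longrightarrow> \<tau> (c f) \<le> face_max \<tau> v"
  unfolding face_max_def using finF by (auto intro!: Max_ge)

lemma face_max_square_le:
  assumes "\<And>n. 0 \<le> \<tau> n"
  shows "(face_max \<tau> v)\<^sup>2 \<le> (\<Sum>f\<in>{f\<in>F. v \<in> VF f}. (\<tau> (c f))\<^sup>2)"
proof -
  have "face_max \<tau> v \<in> insert 0 ((\<lambda>f. \<tau> (c f)) ` {f\<in>F. v \<in> VF f})"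
    unfolding face_max_def using finF by (intro Max_in) auto
  then consider "face_max \<tau> v = 0" | f where "f \<in> F" "v \<in> VF f" "face_max \<tau> v = \<tau> (c f)" by auto
  then show ?thesis
  proof cases
    case 1 then show ?thesis by (simp add: sum_nonneg)
  next
    case 2
    then show ?thesis using finF by (auto intro!: member_le_sum)
  qed
qed

text \<open>Weighted Cauchy--Schwarz: \<open>(\<tau> + 2 M)\<^sup>2 \<le> (1 + 4 N) (\<tau>\<^sup>2 + M\<^sup>2 / N)\<close>, and every face value is
  charged by at most \<open>N\<close> vertices.\<close>

lemma sqn_face_max_le:
  assumes tau: "\<And>n. 0 \<le> \<tau> n" and N: "\<And>f. f \<in> F \<Longrightarrow> card (VF f) \<le> N" and "0 < N"
  shows "sqn (VG - sphere 0 1) (\<lambda>v. \<tau> v + 2 * face_max \<tau> v) \<le> (4 * real N + 1) * sqn inner_nodes \<tau>"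
proof -
  let ?W = "VG - sphere 0 1" and ?M = "face_max \<tau>"
  have finW: "finite ?W" using finite_VG by simp
  have pt: "(\<tau> v + 2 * ?M v)\<^sup>2 \<le> (4 * real N + 1) * ((\<tau> v)\<^sup>2 + (?M v)\<^sup>2 / N)" for v
  proof -
    \<comment> \<open>This square, divided by \<open>N\<close>, is exactly the difference of the two
      sides.\<close>
    have "0 \<le> (2 * N * \<tau> v - ?M v)\<^sup>2" by simp
    then have "0 \<le> (2 * N * \<tau> v - ?M v)\<^sup>2 / N" by simp
    also have "\<dots> = (4 * real N + 1) * ((\<tau> v)\<^sup>2 + (?M v)\<^sup>2 / N) - (\<tau> v + 2 * ?M v)\<^sup>2"
      using \<open>0 < N\<close> by (simp add: power2_eq_square field_simps)
    finally show ?thesis by simp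
  qed
  have "(\<Sum>v\<in>?W. (?M v)\<^sup>2) \<le> (\<Sum>v\<in>?W. \<Sum>f\<in>{f\<in>F. v \<in> VF f}. (\<tau> (c f))\<^sup>2)"
    by (intro sum_mono face_max_square_le tau)
  \<comment> \<open>Exchanging the sums collects the charges face by face: a centre is charged once
    for each inner vertex on its rim, at most \<open>N\<close> times.\<close>
  also have "\<dots> = (\<Sum>f\<in>F. \<Sum>v\<in>{v\<in>?W. v \<in> VF f}. (\<tau> (c f))\<^sup>2)"
    using finW finF by (rule sum.swap_restrict)
  also have "\<dots> \<le> (\<Sum>f\<in>F. N * (\<tau> (c f))\<^sup>2)"
  proof (rule sum_mono)
    fix f assume f: "f \<in> F"
    have "card {v\<in>?W. v \<in> VF f} \<le> card (VF f)"
      using finV by (intro card_mono) (auto simp: VF_def)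
    then have "card {v\<in>?W. v \<in> VF f} \<le> N" using N[OF f] by simp
    then show "(\<Sum>v\<in>{v\<in>?W. v \<in> VF f}. (\<tau> (c f))\<^sup>2) \<le> N * (\<tau> (c f))\<^sup>2"
      by (simp add: mult_right_mono)
  qed
  also have "\<dots> = N * (\<Sum>x\<in>c ` F. (\<tau> x)\<^sup>2)"
    using inj_c by (simp add: sum.reindex sum_distrib_left)
  finally have MN: "(\<Sum>v\<in>?W. (?M v)\<^sup>2) / N \<le> (\<Sum>x\<in>c ` F. (\<tau> x)\<^sup>2)"
    using \<open>0 < N\<close> by (simp add: field_simps)
  have "sqn ?W (\<lambda>v. \<tau> v + 2 * ?M v) \<le> (\<Sum>v\<in>?W. (4 * real N + 1) * ((\<tau> v)\<^sup>2 + (?M v)\<^sup>2 / N))"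
    unfolding sqn_def by (intro sum_mono pt)
  also have "\<dots> = (4 * real N + 1) * ((\<Sum>v\<in>?W. (\<tau> v)\<^sup>2) + (\<Sum>v\<in>?W. (?M v)\<^sup>2) / N)"
    by (simp add: sum_distrib_left sum.distrib sum_divide_distrib distrib_left)
  also have "\<dots> \<le> (4 * real N + 1) * ((\<Sum>v\<in>?W. (\<tau> v)\<^sup>2) + (\<Sum>x\<in>c ` F. (\<tau> x)\<^sup>2))"
    using MN by (intro mult_left_mono add_left_mono) auto
  also have "(\<Sum>v\<in>?W. (\<tau> v)\<^sup>2) + (\<Sum>x\<in>c ` F. (\<tau> x)\<^sup>2) = sqn inner_nodes \<tau>"
    unfolding sqn_def inner_nodes_def using finW finF c_V VG_V
    by (subst sum.union_disjoint) auto
  finally show ?thesis .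
qed

end

text \<open>\<open>\<alpha>\<close> is the angle of \<open>a\<close> and \<open>\<beta>\<close> the
  fraction of a full turn leading from \<open>a\<close> to \<open>b\<close>, so the parameters below
  and above \<open>\<beta>\<close> describe the two open arcs.\<close>

locale disc_quad = disc_map +
  fixes \<alpha> \<beta> :: real
  assumes \<beta>: "0 < \<beta>" "\<beta> < 1"
    and a_V: "cis \<alpha> \<in> V" and b_V: "cis (\<alpha> + 2 * pi * \<beta>) \<in> V"
    and nonadj: "\<not> adjE (cis \<alpha>) (cis (\<alpha> + 2 * pi * \<beta>))"
begin

abbreviation "a \<equiv> cis \<alpha>"
abbreviation "b \<equiv> cis (\<alpha> + 2 * pi * \<beta>)"
definition "arcL = (\<lambda>t. cis (\<alpha> + 2 * pi * t)) ` {0<..<\<beta>}"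
definition "arcR = (\<lambda>t. cis (\<alpha> + 2 * pi * t)) ` {\<beta><..<1}"

lemma id_circle: "continuous_on (sphere 0 1) (\<lambda>x::complex. x)" "inj_on (\<lambda>x::complex. x) (sphere 0 1)"
  "(\<lambda>x. x) ` sphere 0 1 \<subseteq> V \<union> \<Union>E"
  using sphere_graph by auto

lemma loop_a: "graph_loop V E (\<lambda>t. cis (\<alpha> + 2 * pi * t))"
  and loop_a_image: "(\<lambda>t. cis (\<alpha> + 2 * pi * t)) ` {0..1} = sphere 0 1"
  using circle_loop[OF id_circle a_V] by simp_all

lemma loop_b: "graph_loop V E (\<lambda>t. cis (\<alpha> + 2 * pi * \<beta> + 2 * pi * t))"
  and loop_b_image: "(\<lambda>t. cis (\<alpha> + 2 * pi * \<beta> + 2 * pi * t)) ` {0..1} = sphere 0 1"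
  using circle_loop[OF id_circle b_V] by simp_all

lemma cis_shift_neq:
  assumes "0 \<le> s" "s < t" "t < 1" shows "cis (\<alpha> + 2 * pi * s) \<noteq> cis (\<alpha> + 2 * pi * t)"
proof (rule cis_neq_of_less)
  have "2 * pi * s < 2 * pi * t" "2 * pi * t < 2 * pi * 1" "0 \<le> 2 * pi * s" using assms by auto
  then show "\<alpha> + 2 * pi * s < \<alpha> + 2 * pi * t" "\<alpha> + 2 * pi * t < \<alpha> + 2 * pi * s + 2 * pi" by linarith+
qed

lemma a_b: "a \<noteq> b" using cis_shift_neq[of 0 \<beta>] \<beta> by simp

lemma cis_shift_1: "cis (\<alpha> + 2 * pi * 1) = a"
  by (simp add: complex_eq_iff)

lemma sphere_arcs: "sphere 0 1 = {a, b} \<union> arcL \<union> arcR"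
proof -
  have "{0..1} = {0, 1, \<beta>} \<union> {0<..<\<beta>} \<union> {\<beta><..<1}" using \<beta> by auto
  then have "sphere 0 1 = (\<lambda>t. cis (\<alpha> + 2 * pi * t)) ` ({0, 1, \<beta>} \<union> {0<..<\<beta>} \<union> {\<beta><..<1})"
    using loop_a_image by simp
  also have "\<dots> = {a, b} \<union> arcL \<union> arcR"
    using cis_shift_1 by (simp add: image_Un arcL_def arcR_def)
  finally show ?thesis .
qed

lemma arcs_disj: "a \<notin> arcL" "a \<notin> arcR" "b \<notin> arcL" "b \<notin> arcR" "arcL \<inter> arcR = {}"
proof -
  have "cis (\<alpha> + 2 * pi * t) \<noteq> a" if "0 < t" "t < 1" for t
    using cis_shift_neq[of 0 t] that by auto
  then have "a \<notin> (\<lambda>t. cis (\<alpha> + 2 * pi * t)) ` {0<..<1}" by force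
  moreover have "arcL \<subseteq> (\<lambda>t. cis (\<alpha> + 2 * pi * t)) ` {0<..<1}"
    "arcR \<subseteq> (\<lambda>t. cis (\<alpha> + 2 * pi * t)) ` {0<..<1}"
    unfolding arcL_def arcR_def using \<beta> by (intro image_mono; auto)+
  ultimately show "a \<notin> arcL" "a \<notin> arcR" by blast+
  show "b \<notin> arcL"
  proof
    assume "b \<in> arcL"
    then obtain t where t: "0 < t" "t < \<beta>" "b = cis (\<alpha> + 2 * pi * t)" by (auto simp: arcL_def)
    then show False using cis_shift_neq[of t \<beta>] \<beta> by simp
  qed
  show "b \<notin> arcR"
  proof
    assume "b \<in> arcR"
    then obtain t where t: "\<beta> < t" "t < 1" "b = cis (\<alpha> + 2 * pi * t)" by (auto simp: arcR_def)
    then show False using cis_shift_neq[of \<beta> t] \<beta> by simp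
  qed
  have "cis (\<alpha> + 2 * pi * s) \<noteq> cis (\<alpha> + 2 * pi * t)" if "0 < s" "s < \<beta>" "\<beta> < t" "t < 1" for s t
    using cis_shift_neq[of s t] that by simp
  then show "arcL \<inter> arcR = {}" by (auto simp: arcL_def arcR_def)
qed

lemma arcs_sphere: "arcL \<subseteq> sphere 0 1" "arcR \<subseteq> sphere 0 1" "a \<in> sphere 0 1" "b \<in> sphere 0 1"
  using sphere_arcs by auto

text \<open>Disjoint node lists would have disjoint drawings, yet the curves in them join interlaced
  pairs of points on the circle inside the disk.\<close>

lemma crossing_oriented:
  assumes p: "p \<noteq> []" "successively joined p" "set p \<subseteq> V \<union> c ` F" "hd p = a" "last p = b"
    and q: "q \<noteq> []" "successively joined q" "set q \<subseteq> V \<union> c ` F" "hd q \<in> arcL" "last q \<in> arcR"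
  shows "set p \<inter> set q \<noteq> {}"
proof
  assume no: "set p \<inter> set q = {}"
  obtain f where f: "path f" "pathstart f = a" "pathfinish f = b" "path_image f \<subseteq> drawing p"
    using drawing_path[OF p(1,2)] p by auto
  obtain g where g: "path g" "pathstart g = hd q" "pathfinish g = last q" "path_image g \<subseteq> drawing q"
    using drawing_path[OF q(1,2)] by auto
  obtain s where s: "0 < s" "s < \<beta>" "hd q = cis (\<alpha> + 2 * pi * s)" using q(4) by (auto simp: arcL_def)
  obtain t where t: "\<beta> < t" "t < 1" "last q = cis (\<alpha> + 2 * pi * t)" using q(5) by (auto simp: arcR_def)
  have "path_image f \<inter> path_image g \<noteq> {}"
  proof (rule disk_paths_meet[OF f(1) g(1) _ _ f(2,3)])
    show "path_image f \<subseteq> cball 0 1" "path_image g \<subseteq> cball 0 1"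
      using f(4) g(4) drawing_disk p(3) q(3) by blast+
    show "pathstart g = cis (\<alpha> + 2 * pi * s)" "pathfinish g = cis (\<alpha> + 2 * pi * t)" using g s t by auto
    show "\<alpha> < \<alpha> + 2 * pi * s" "\<alpha> + 2 * pi * s < \<alpha> + 2 * pi * \<beta>" "\<alpha> + 2 * pi * \<beta> < \<alpha> + 2 * pi * t"
      "\<alpha> + 2 * pi * t < \<alpha> + 2 * pi" using s t by auto
  qed
  then show False using f(4) g(4) drawing_disj[OF p(3) q(3) no] by blast
qed

lemma successively_rev_sym:
  "successively R p \<Longrightarrow> (\<And>x y. R x y \<Longrightarrow> R y x) \<Longrightarrow> successively R (rev p)"
  by (simp add: successively_mono)

lemma crossing:
  assumes p: "p \<noteq> []" "successively joined p" "set p \<subseteq> V \<union> c ` F" "{hd p, last p} = {a, b}"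
    and q: "q \<noteq> []" "successively joined q" "set q \<subseteq> V \<union> c ` F"
      "hd q \<in> arcL \<and> last q \<in> arcR \<or> hd q \<in> arcR \<and> last q \<in> arcL"
  shows "set p \<inter> set q \<noteq> {}"
proof -
  obtain p' where p': "p' \<noteq> []" "successively joined p'" "set p' = set p" "hd p' = a" "last p' = b"
  proof (cases "hd p = a")
    case True
    then show thesis using that[of p] p a_b by (auto simp: doubleton_eq_iff)
  next
    case False
    then show thesis using that[of "rev p"] p successively_rev_sym[OF p(2) joined_sym]
      by (auto simp: doubleton_eq_iff hd_rev last_rev)
  qed
  obtain q' where q': "q' \<noteq> []" "successively joined q'" "set q' = set q" "hd q' \<in> arcL" "last q' \<in> arcR"
  proof (cases "hd q \<in> arcL")
    case True
    then show thesis using that[of q] q arcs_disj by auto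
  next
    case False
    then show thesis using that[of "rev q"] q successively_rev_sym[OF q(2) joined_sym]
      by (auto simp: hd_rev last_rev)
  qed
  show ?thesis using crossing_oriented[of p' q'] p' q' p(3) q(3) by simp
qed

end

section \<open>Area inequalities in the plane\<close>

context disc_quad begin

text \<open>Together with \<open>GS\<close>, the planar form of the two path families;
  \<open>connecting_paths_\<kappa>\<close> and \<open>separating_paths_\<kappa>\<close> identify
  them with the original ones.\<close>

definition GC :: "complex list set" where
  "GC = {p. cpath p \<and> {hd p, last p} = {a, b}}"

definition GS :: "complex list set" where
  "GS = {p. cpath p \<and> (hd p \<in> arcL \<and> last p \<in> arcR \<or> hd p \<in> arcR \<and> last p \<in> arcL)}"

lemma adjE_joined: "successively adjE p \<Longrightarrow> successively joined p"
  by (erule successively_mono) (auto simp: adjE_def joined_def)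

lemma cpath_sphere: "cpath p \<Longrightarrow> x \<in> set p \<Longrightarrow> x \<in> sphere 0 1 \<Longrightarrow> x = hd p \<or> x = last p"
  using set_ends_interior[of p] by (auto simp: cpath_def)

lemma GS_disj:
  assumes q: "q \<in> GS" shows "a \<notin> set q \<and> b \<notin> set q"
proof -
  have "z \<notin> set q" if z: "z \<in> {a, b}" for z
  proof
    assume "z \<in> set q"
    moreover have "z \<in> sphere 0 1" using z arcs_sphere by blast
    ultimately have "z = hd q \<or> z = last q" using q cpath_sphere[of q z] by (simp add: GS_def)
    then have "z \<in> arcL \<union> arcR" using q by (auto simp: GS_def)
    then show False using z arcs_disj by blast
  qed
  then show ?thesis by blast
qed

lemma GC_ends:
  assumes p: "p \<in> GC" and x: "x \<in> set p" "x \<in> sphere 0 1" shows "x \<in> {a, b}"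
proof -
  have "cpath p" and ab: "{hd p, last p} = {a, b}" using p by (simp_all add: GC_def)
  then have "x \<in> {hd p, last p}" using cpath_sphere[OF _ x] by blast
  then show ?thesis unfolding ab .
qed

lemma GC_disj:
  assumes p: "p \<in> GC" and x: "x \<in> arcL \<union> arcR" shows "x \<notin> set p"
proof
  assume "x \<in> set p"
  moreover have "x \<in> sphere 0 1" using x arcs_sphere by blast
  ultimately have "x \<in> {a, b}" using GC_ends[OF p] by blast
  then show False using x arcs_disj by blast
qed

text \<open>A common node cannot be on the circle: there the first path has only \<open>a\<close>
  and \<open>b\<close>, which the second one avoids. So the meeting survives the removal of boundary
  vertices, where metrics vanish.\<close>

lemma GC_GS_meet:
  assumes p: "p \<in> GC" and q: "q \<in> GS" shows "(set p - sphere 0 1) \<inter> (set q - sphere 0 1) \<noteq> {}"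
proof -
  have "set p \<inter> set q \<noteq> {}"
    using p q by (intro crossing adjE_joined) (auto simp: GC_def GS_def cpath_def)
  then obtain x where x: "x \<in> set p" "x \<in> set q" by blast
  have "x \<notin> sphere 0 1"
  proof
    assume "x \<in> sphere 0 1"
    then have "x \<in> {a, b}" using GC_ends[OF p x(1)] by blast
    then show False using GS_disj[OF q] x by auto
  qed
  then show ?thesis using x by blast
qed

text \<open>Otherwise \<open>a\<close>, the centre of the face and \<open>b\<close> would form a
  crossing partner for a path of \<open>GS\<close>, but that path contains neither \<open>a\<close>
  nor \<open>b\<close> nor any centre.\<close>

lemma no_face_ab:
  assumes "GS \<noteq> {}" "f \<in> F" shows "a \<notin> VF f \<or> b \<notin> VF f"
proof (rule ccontr)
  assume "\<not> ?thesis"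
  then have ab: "a \<in> VF f" "b \<in> VF f" by auto
  obtain q where q: "q \<in> GS" using assms(1) by blast
  have "set [a, c f, b] \<inter> set q \<noteq> {}"
  proof (rule crossing)
    show "successively joined [a, c f, b]"
      using adjT_joined incident_c[OF assms(2)] ab by auto
    show "set [a, c f, b] \<subseteq> V \<union> c ` F" using assms(2) a_V b_V by auto
    show "successively joined q" using q adjE_joined by (auto simp: GS_def cpath_def)
  qed (use q in \<open>auto simp: GS_def cpath_def\<close>)
  moreover have "c f \<notin> set q" using c_V[OF assms(2)] q by (auto simp: GS_def cpath_def)
  ultimately show False using GS_disj[OF q] by auto
qed

text \<open>The dual of \<open>no_face_ab\<close>: a list through the centre from one arc to the
  other would miss every path of \<open>GC\<close>.\<close>

lemma no_face_arcs:
  assumes "GC \<noteq> {}" "f \<in> F" shows "VF f \<inter> arcL = {} \<or> VF f \<inter> arcR = {}"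
proof (rule ccontr)
  assume "\<not> ?thesis"
  then obtain x y where xy: "x \<in> VF f" "x \<in> arcL" "y \<in> VF f" "y \<in> arcR" by auto
  obtain p where p: "p \<in> GC" using assms(1) by blast
  have "set p \<inter> set [x, c f, y] \<noteq> {}"
  proof (rule crossing)
    show "successively joined [x, c f, y]"
      using adjT_joined incident_c[OF assms(2)] xy by auto
    show "set [x, c f, y] \<subseteq> V \<union> c ` F" using assms(2) xy by (auto simp: VF_def)
    show "successively joined p" using p adjE_joined by (auto simp: GC_def cpath_def)
  qed (use p xy in \<open>auto simp: GC_def cpath_def\<close>)
  moreover have "c f \<notin> set p" using c_V[OF assms(2)] p by (auto simp: GC_def cpath_def)
  ultimately show False using GC_disj[OF p] xy by auto
qed

lemma EB_loop: "{e\<in>E. e \<subseteq> sphere 0 1 \<and> x \<in> ends e} = {e\<in>EB. x \<in> ends e}"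
  by (auto simp: EB_def)

lemma edges_a:
  obtains e0 e1 u0 u1 where "e0 \<noteq> e1" "ends e0 = {a, u0}" "ends e1 = {a, u1}"
    "u0 \<in> arcL" "u1 \<in> arcR" "{e\<in>EB. a \<in> ends e} = {e0, e1}"
proof (rule graph_loop.base_edges[OF loop_a, of \<beta>])
  show "ends e \<noteq> {cis (\<alpha> + 2 * pi * 0), b}" if "e \<in> E" for e
    using nonadj that by (auto simp: adjE_def)
  fix e0 e1 u0 u1
  assume "e0 \<noteq> e1" "ends e0 = {cis (\<alpha> + 2 * pi * 0), u0}" "ends e1 = {cis (\<alpha> + 2 * pi * 0), u1}"
    "u0 \<in> (\<lambda>t. cis (\<alpha> + 2 * pi * t)) ` {0<..<\<beta>}" "u1 \<in> (\<lambda>t. cis (\<alpha> + 2 * pi * t)) ` {\<beta><..<1}"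
    "{e\<in>E. e \<subseteq> (\<lambda>t. cis (\<alpha> + 2 * pi * t)) ` {0..1} \<and> cis (\<alpha> + 2 * pi * 0) \<in> ends e} = {e0, e1}"
  then show thesis
    using that unfolding loop_a_image EB_loop arcL_def arcR_def by simp
qed (use \<beta> b_V in auto)

lemma edges_b:
  obtains e0 e1 u0 u1 where "e0 \<noteq> e1" "ends e0 = {b, u0}" "ends e1 = {b, u1}"
    "u0 \<in> arcL" "u1 \<in> arcR" "{e\<in>EB. b \<in> ends e} = {e0, e1}"
proof -
  let ?g = "\<lambda>t. cis (\<alpha> + 2 * pi * \<beta> + 2 * pi * t)"
  have g0: "?g 0 = b" by simp
  have per: "cis (x + 2 * pi) = cis x" for x by (simp add: complex_eq_iff)
  have g1: "?g (1 - \<beta>) = a"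
    using per[of \<alpha>] by (simp add: algebra_simps)
  have R: "?g ` {0<..<1 - \<beta>} \<subseteq> arcR"
  proof
    fix x assume "x \<in> ?g ` {0<..<1 - \<beta>}"
    then obtain t where t: "0 < t" "t < 1 - \<beta>" "x = ?g t" by auto
    then have "x = cis (\<alpha> + 2 * pi * (\<beta> + t))" by (simp add: algebra_simps)
    then show "x \<in> arcR" using t \<beta> by (auto simp: arcR_def)
  qed
  have L: "?g ` {1 - \<beta><..<1} \<subseteq> arcL"
  proof
    fix x assume "x \<in> ?g ` {1 - \<beta><..<1}"
    then obtain t where t: "1 - \<beta> < t" "t < 1" "x = ?g t" by auto
    have "?g t = cis (\<alpha> + 2 * pi * (\<beta> + t - 1) + 2 * pi)" by (simp add: algebra_simps)
    then have "x = cis (\<alpha> + 2 * pi * (\<beta> + t - 1))" using t per by metis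
    moreover have "\<beta> + t - 1 \<in> {0<..<\<beta>}" using t by auto
    ultimately show "x \<in> arcL" unfolding arcL_def by blast
  qed
  show thesis
  proof (rule graph_loop.base_edges[OF loop_b, of "1 - \<beta>"])
    show "ends e \<noteq> {?g 0, ?g (1 - \<beta>)}" if "e \<in> E" for e
      using nonadj that unfolding g0 g1 by (auto simp: adjE_def insert_commute)
    show "?g (1 - \<beta>) \<in> V" using a_V unfolding g1 .
    fix e0 e1 u0 u1
    assume *: "e0 \<noteq> e1" "ends e0 = {?g 0, u0}" "ends e1 = {?g 0, u1}"
      "u0 \<in> ?g ` {0<..<1 - \<beta>}" "u1 \<in> ?g ` {1 - \<beta><..<1}"
      "{e\<in>E. e \<subseteq> ?g ` {0..1} \<and> ?g 0 \<in> ends e} = {e0, e1}"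
    \<comment> \<open>Starting from \<open>b\<close> the loop passes through \<open>arcR\<close>
      before \<open>arcL\<close>, so the two edges change roles compared with
      \<open>edges_a\<close>.\<close>
    have "{e\<in>EB. b \<in> ends e} = {e1, e0}"
      using *(6) unfolding loop_b_image EB_loop g0 by (simp add: insert_commute)
    moreover have "u1 \<in> arcL" using *(5) L by (rule subsetD[rotated])
    moreover have "u0 \<in> arcR" using *(4) R by (rule subsetD[rotated])
    ultimately show thesis using that[of e1 e0 u1 u0] *(1-3) by simp
  qed (use \<beta> in auto)
qed

lemma boundary_edge_sides:
  assumes "e \<in> EB" "ends e = {u, w}" "u \<in> arcL" shows "w \<notin> arcR"
proof -
  have "w \<notin> (\<lambda>t. cis (\<alpha> + 2 * pi * t)) ` {\<beta><..<1}"
  proof (rule graph_loop.loop_edge_sides[OF loop_a, of \<beta> e u])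
    show "ends e \<noteq> {cis (\<alpha> + 2 * pi * 0), b}" if "e \<in> E" for e
      using nonadj that by (auto simp: adjE_def)
    show "e \<subseteq> (\<lambda>t. cis (\<alpha> + 2 * pi * t)) ` {0..1}" using assms(1) unfolding loop_a_image by (simp add: EB_def)
    show "u \<in> (\<lambda>t. cis (\<alpha> + 2 * pi * t)) ` {0<..<\<beta>}" using assms(3) by (simp add: arcL_def)
  qed (use \<beta> b_V assms in \<open>auto simp: EB_def\<close>)
  then show ?thesis by (simp add: arcR_def)
qed

abbreviation "SL \<equiv> V \<inter> arcL"
abbreviation "SR \<equiv> V \<inter> arcR"

text \<open>The two boundary edges leaving \<open>{a}\<close> end in different arcs, because
  \<open>a\<close> and \<open>b\<close> are not adjacent; a walk between these ends is therefore a
  separating one.\<close>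

lemma ab_level:
  assumes GSne: "GS \<noteq> {}" and adm: "adm (TP {a} {b}) \<tau>" and M0: "\<And>v. 0 \<le> M v"
    and M: "\<And>f. f \<in> F \<Longrightarrow> (\<forall>v\<in>VF f. \<tau> (c f) \<le> M v) \<or>
       (\<forall>u\<in>VF f. \<forall>v\<in>VF f. u \<noteq> v \<longrightarrow> adjG u v)"
    and \<mu>: "admissible V GS (V \<inter> sphere 0 1) \<mu>"
  shows "1 \<le> (\<Sum>v\<in>VG - sphere 0 1. \<mu> v * (\<tau> v + 2 * M v))"
proof -
  obtain e0 e1 u0 u1 where e: "e0 \<noteq> e1" "ends e0 = {a, u0}" "ends e1 = {a, u1}"
    "u0 \<in> arcL" "u1 \<in> arcR" "{e\<in>EB. a \<in> ends e} = {e0, e1}" using edges_a .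
  have EBc: "{e\<in>EB. \<exists>u v. ends e = {u, v} \<and> u \<in> {a} \<and> v \<notin> {a}} = {e0, e1}"
  proof -
    have "(\<exists>u v. ends e = {u, v} \<and> u \<in> {a} \<and> v \<notin> {a}) \<longleftrightarrow> a \<in> ends e" if "e \<in> EB" for e
    proof -
      have "e \<in> E" using that by (simp add: EB_def)
      then obtain u v where uv: "ends e = {u, v}" "u \<noteq> v" by (rule ends_pair)
      show ?thesis unfolding uv(1) using uv(2) by (auto simp: doubleton_eq_iff)
    qed
    then have "{e\<in>EB. \<exists>u v. ends e = {u, v} \<and> u \<in> {a} \<and> v \<notin> {a}} = {e\<in>EB. a \<in> ends e}"
      by (intro Collect_cong conj_cong) auto
    then show ?thesis using e(6) by simp
  qed
  show ?thesis
  proof (rule level_inequality[of "{a}" "{b}" \<tau> M e0 e1 a u0 a u1 arcL arcR "{}" GS \<mu>])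
    show "VF f \<inter> {a} = {} \<or> VF f \<inter> {b} = {}" if "f \<in> F" for f using no_face_ab[OF GSne that] by blast
    show "(\<forall>v\<in>VF f. \<tau> (c f) \<le> M v) \<or> (\<forall>u\<in>VF f. \<forall>v\<in>VF f. u \<noteq> v \<longrightarrow> adjG u v)" if "f \<in> F" for f
      by (rule M[OF that])
    show "u0 \<notin> {a} \<union> {b}" "u1 \<notin> {a} \<union> {b}" using e(4,5) arcs_disj by auto
    show "sphere 0 1 = {a} \<union> {b} \<union> arcL \<union> arcR \<union> {}" using sphere_arcs by auto
    show "q \<in> GS" if "cpath q" "hd q \<in> arcL" "last q \<in> arcR" for q using that by (simp add: GS_def)
    show "arcL \<union> arcR \<subseteq> sphere 0 1" "{a} \<subseteq> sphere 0 1" "{b} \<subseteq> sphere 0 1" using arcs_sphere by auto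
    show "arcL \<inter> ({a} \<union> {b}) = {}" "arcR \<inter> ({a} \<union> {b}) = {}" using arcs_disj by auto
  qed (use adm M0 EBc e \<mu> arcs_disj(5) in simp_all)
qed

text \<open>Distances are measured from the vertices of one arc. Exactly two boundary edges leave
  that arc, one ending at \<open>a\<close> and one at \<open>b\<close>, so the walk joins
  \<open>a\<close> to \<open>b\<close>.\<close>

lemma arcs_level:
  assumes GCne: "GC \<noteq> {}" and adm: "adm (TP SL SR) \<tau>" and M0: "\<And>v. 0 \<le> M v"
    and M: "\<And>f. f \<in> F \<Longrightarrow> (\<forall>v\<in>VF f. \<tau> (c f) \<le> M v) \<or>
       (\<forall>u\<in>VF f. \<forall>v\<in>VF f. u \<noteq> v \<longrightarrow> adjG u v)"
    and \<mu>: "admissible V GC (V \<inter> sphere 0 1) \<mu>"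
  shows "1 \<le> (\<Sum>v\<in>VG - sphere 0 1. \<mu> v * (\<tau> v + 2 * M v))"
proof -
  obtain e0 e1 u0 u1 where e: "e0 \<noteq> e1" "ends e0 = {a, u0}" "ends e1 = {a, u1}"
    "u0 \<in> arcL" "u1 \<in> arcR" "{e\<in>EB. a \<in> ends e} = {e0, e1}" using edges_a .
  obtain d0 d1 w0 w1 where d: "d0 \<noteq> d1" "ends d0 = {b, w0}" "ends d1 = {b, w1}"
    "w0 \<in> arcL" "w1 \<in> arcR" "{e\<in>EB. b \<in> ends e} = {d0, d1}" using edges_b .
  have EB: "e0 \<in> EB" "d0 \<in> EB" using e(6) d(6) by blast+
  have inV: "u0 \<in> V" "w0 \<in> V" using ends_EB[OF EB(1)] ends_EB[OF EB(2)] e(2) d(2) by auto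
  have e0': "ends e0 = {u0, a}" and d0': "ends d0 = {w0, b}" using e(2) d(2) by auto
  have EBc: "{e\<in>EB. \<exists>u v. ends e = {u, v} \<and> u \<in> SL \<and> v \<notin> SL} = {e0, d0}"
  proof
    show "{e0, d0} \<subseteq> {e\<in>EB. \<exists>u v. ends e = {u, v} \<and> u \<in> SL \<and> v \<notin> SL}"
    proof -
      have "\<exists>u v. ends e0 = {u, v} \<and> u \<in> SL \<and> v \<notin> SL"
        using e0' inV(1) e(4) arcs_disj(1) by blast
      moreover have "\<exists>u v. ends d0 = {u, v} \<and> u \<in> SL \<and> v \<notin> SL"
        using d0' inV(2) d(4) arcs_disj(3) by blast
      ultimately show ?thesis using EB by blast
    qed
    \<comment> \<open>No boundary edge joins the two arcs, so a leaving edge ends at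
      \<open>a\<close> or \<open>b\<close>; of the two boundary edges there, one leads to the other
      arc.\<close>
    show "{e\<in>EB. \<exists>u v. ends e = {u, v} \<and> u \<in> SL \<and> v \<notin> SL} \<subseteq> {e0, d0}"
    proof
      fix x assume "x \<in> {e\<in>EB. \<exists>u v. ends e = {u, v} \<and> u \<in> SL \<and> v \<notin> SL}"
      then obtain u v where x: "x \<in> EB" "ends x = {u, v}" "u \<in> SL" "v \<notin> SL" by auto
      have "v \<in> V \<inter> sphere 0 1" using ends_EB[OF x(1)] x(2) by blast
      moreover have "v \<notin> arcR" using boundary_edge_sides[OF x(1,2)] x(3) by blast
      ultimately consider "v = a" | "v = b" using sphere_arcs x(4) by blast
      then show "x \<in> {e0, d0}"
      proof cases
        case 1
        then have "x \<in> {e0, e1}" using e(6) x by blast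
        moreover have "x \<noteq> e1"
        proof
          assume "x = e1"
          then have "{u, a} = {a, u1}" using e(3) x(2) 1 by simp
          then have "u = u1" using x(3) arcs_disj by (auto simp: doubleton_eq_iff)
          then show False using e(5) x(3) arcs_disj by blast
        qed
        ultimately show ?thesis by blast
      next
        case 2
        then have "x \<in> {d0, d1}" using d(6) x by blast
        moreover have "x \<noteq> d1"
        proof
          assume "x = d1"
          then have "{u, b} = {b, w1}" using d(3) x(2) 2 by simp
          then have "u = w1" using x(3) arcs_disj by (auto simp: doubleton_eq_iff)
          then show False using d(5) x(3) arcs_disj by blast
        qed
        ultimately show ?thesis by blast
      qed
    qed
  qed
  have ne: "e0 \<noteq> d0"
  proof
    assume "e0 = d0"
    then have "{a, u0} = {b, w0}" using e(2) d(2) by simp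
    then show False using a_b d(4) arcs_disj by (auto simp: doubleton_eq_iff)
  qed
  have abdisj: "{a} \<inter> {b} = {}" using a_b by simp
  show ?thesis
  proof (rule level_inequality[of SL SR \<tau> M e0 d0 u0 a w0 b "{a}" "{b}" "arcL \<union> arcR - V" GC \<mu>])
    show "VF f \<inter> SL = {} \<or> VF f \<inter> SR = {}" if "f \<in> F" for f using no_face_arcs[OF GCne that] by blast
    show "(\<forall>v\<in>VF f. \<tau> (c f) \<le> M v) \<or> (\<forall>u\<in>VF f. \<forall>v\<in>VF f. u \<noteq> v \<longrightarrow> adjG u v)" if "f \<in> F" for f
      by (rule M[OF that])
    show "sphere 0 1 = SL \<union> SR \<union> {a} \<union> {b} \<union> (arcL \<union> arcR - V)" using sphere_arcs by auto
    show "q \<in> GC" if "cpath q" "hd q \<in> {a}" "last q \<in> {b}" for q using that by (simp add: GC_def)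
    show "SL \<subseteq> sphere 0 1" "SR \<subseteq> sphere 0 1" "{a} \<union> {b} \<subseteq> sphere 0 1" using arcs_sphere by auto
    show "{a} \<inter> (SL \<union> SR) = {}" "{b} \<inter> (SL \<union> SR) = {}" "a \<notin> SL \<union> SR" "b \<notin> SL \<union> SR"
      using arcs_disj by auto
    show "u0 \<in> SL" "w0 \<in> SL" using e(4) d(4) inV by auto
    show "{e\<in>EB. \<exists>u v. ends e = {u, v} \<and> u \<in> SL \<and> v \<notin> SL} = {e0, d0}" by (rule EBc)
    show "V \<inter> (arcL \<union> arcR - V) = {}" by blast
  qed (use adm M0 ne e0' d0' \<mu> abdisj in simp_all)
qed

text \<open>Adding the final terminal turns both lists into crossing partners. The terminals of the
  two lists are distinct points of the circle and inner nodes are off the circle, so the common node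
  is inner for both.\<close>

lemma TP_meet:
  assumes "G \<in> TP {a} {b}" "H \<in> TP SL SR" shows "G \<inter> H \<noteq> {}"
proof -
  obtain p y where p: "G = set (tl p)" "tpath {a} p" "adjT (last p) b"
    using assms(1) by (auto simp: TP_def)
  obtain q z where q: "H = set (tl q)" "tpath SL q" "z \<in> SR" "adjT (last q) z"
    using assms(2) by (auto simp: TP_def)
  have pc: "p = a # tl p" using p(2) by (cases p) (auto simp: tpath_def)
  obtain x where x: "x \<in> SL" "q = x # tl q" using q(2) by (cases q) (auto simp: tpath_def)
  have jp: "successively joined (p @ [b])"
    using p adjT_joined by (auto simp: tpath_def successively_append_iff elim: successively_mono)
  have jq: "successively joined (q @ [z])"
    using q adjT_joined by (auto simp: tpath_def successively_append_iff elim: successively_mono)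
  have inn: "set (tl p) \<subseteq> inner_nodes" "set (tl q) \<subseteq> inner_nodes" using p q by (auto simp: tpath_def)
  have innV: "inner_nodes \<subseteq> V \<union> c ` F" using VG_V by (auto simp: inner_nodes_def)
  have sp: "set (p @ [b]) = {a, b} \<union> set (tl p)" by (subst pc) auto
  have sq: "set (q @ [z]) = {x, z} \<union> set (tl q)" by (subst x(2)) auto
  have "set (p @ [b]) \<inter> set (q @ [z]) \<noteq> {}"
  proof (rule crossing[OF _ jp _ _ _ jq])
    show "set (p @ [b]) \<subseteq> V \<union> c ` F" unfolding sp using inn(1) innV a_V b_V by blast
    show "set (q @ [z]) \<subseteq> V \<union> c ` F" unfolding sq using inn(2) innV x(1) q(3) by blast
    show "{hd (p @ [b]), last (p @ [b])} = {a, b}" by (subst pc) simp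
    have "hd (q @ [z]) = x" by (subst x(2)) simp
    then show "hd (q @ [z]) \<in> arcL \<and> last (q @ [z]) \<in> arcR \<or> hd (q @ [z]) \<in> arcR \<and> last (q @ [z]) \<in> arcL"
      using x q by simp
  qed simp_all
  then obtain n where n: "n \<in> {a, b} \<union> set (tl p)" "n \<in> {x, z} \<union> set (tl q)"
    unfolding sp sq by blast
  have "{a, b} \<inter> inner_nodes = {}" "{x, z} \<inter> inner_nodes = {}"
    using inner_nodes_sphere arcs_sphere x q by blast+
  moreover have "{a, b} \<inter> {x, z} = {}" using arcs_disj x q by blast
  ultimately have "n \<in> set (tl p)" "n \<in> set (tl q)" using n inn by blast+
  then show ?thesis using p(1) q(1) by blast
qed

lemma area_mono_sqn:
  assumes "W \<subseteq> V" shows "sqn W \<mu> \<le> area V \<mu>"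
  unfolding sqn_def area_def using finV assms by (intro sum_mono2) auto

text \<open>Distances from \<open>a\<close> alone suffice. A metric for \<open>GC\<close> is
  extended to the centres in such a way that it is admissible for the enlarged family, and since the
  vertices of a triangle are pairwise adjacent, \<open>ab_level\<close> applies with
  \<open>M = 0\<close>.\<close>

lemma area_product_ge_1:
  assumes GSne: "GS \<noteq> {}"
    and \<rho>: "admissible V GC (V \<inter> sphere 0 1) \<rho>" and \<mu>: "admissible V GS (V \<inter> sphere 0 1) \<mu>"
    and tri: "\<And>f. f \<in> F \<Longrightarrow> card (VF f) \<le> 3"
  shows "1 \<le> area V \<rho> * area V \<mu>"
proof -
  \<comment> \<open>A centre of value 2 makes every list through it long enough at once; any value
    from 1 on would do.\<close>
  define \<tau> where "\<tau> = (\<lambda>n. if n \<in> c ` F then 2 else if n \<in> V - sphere 0 1 then \<rho> n else 0)"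
  have tau: "0 \<le> \<tau> n" for n using \<rho> by (auto simp: \<tau>_def admissible_def)
  have "1 \<le> sum \<tau> G" if G: "G \<in> TP {a} {b}" for G
  proof -
    obtain p where p: "G = set (tl p)" "tpath {a} p" "tl p \<noteq> []" "adjT (last p) b"
      using G by (auto simp: TP_def)
    show ?thesis
    proof (cases "G \<inter> c ` F = {}")
      case False
      then obtain n where n: "n \<in> G" "n \<in> c ` F" by blast
      have "\<tau> n \<le> sum \<tau> G" using n p(1) tau by (intro member_le_sum) auto
      then show ?thesis using n by (simp add: \<tau>_def)
    next
      case True
      have pc: "p = a # tl p" using p(2) by (cases p) (auto simp: tpath_def)
      have inn: "G \<subseteq> VG - sphere 0 1" using p(1,2) True by (auto simp: tpath_def inner_nodes_def)
      have noc: "set (p @ [b]) \<inter> c ` F = {}"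
      proof -
        have "set (p @ [b]) = {a, b} \<union> G" using p(1) by (subst pc) auto
        moreover have "x \<notin> c ` F" if "x \<in> V" for x using c_V that by auto
        then have "{a, b} \<inter> c ` F = {}" using a_V b_V by simp
        ultimately show ?thesis using True by blast
      qed
      have "successively adjT (p @ [b])"
        using p by (auto simp: tpath_def successively_append_iff)
      then have "successively adjE (p @ [b])"
      proof (rule successively_mono)
        fix u v assume uv: "u \<in> set (p @ [b])" "v \<in> set (p @ [b])" "adjT u v"
        then have "\<not> incident u v" using noc by (auto simp: incident_def)
        then have "adjG u v" using uv(3) by (simp add: adjT_def)
        then show "adjE u v" using EG_E by (auto simp: adjG_def adjE_def)
      qed
      \<comment> \<open>A list without centres uses edges only; shortened, it is a proper path with
        its inner nodes in \<open>G\<close>.\<close>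
      then obtain q where q: "successively adjE q" "2 \<le> length q" "hd q \<in> {a}" "last q \<in> {b}" "distinct q"
          "set q \<subseteq> set (p @ [b])" "set (butlast (tl q)) \<inter> ({a} \<union> {b}) = {}"
      proof (rule successively_shortcut[of adjE "p @ [b]" "{a}" "{b}"])
        show "hd (p @ [b]) \<in> {a}" by (subst pc) simp
      qed (use a_b in auto)
      have sp: "set (p @ [b]) = {a, b} \<union> G" using p(1) by (subst pc) auto
      have qi: "set (butlast (tl q)) \<subseteq> G"
      proof -
        have "set (butlast (tl q)) \<subseteq> set q" using set_ends_interior[OF q(2)] by blast
        then show ?thesis using q(6,7) sp by blast
      qed
      have qG: "set q - sphere 0 1 \<subseteq> G"
      proof
        fix n assume n: "n \<in> set q - sphere 0 1"
        then have "n \<in> {a, b} \<union> G" using q(6) unfolding sp by (simp add: subset_iff)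
        then show "n \<in> G" using n arcs_sphere(3,4) by auto
      qed
      have cq: "cpath q"
        unfolding cpath_def
      proof (intro conjI)
        show "set q \<subseteq> V"
          by (rule order_trans[OF q(6)]) (unfold sp, use inn VG_V a_V b_V in auto)
        show "set (butlast (tl q)) \<inter> sphere 0 1 = {}" using qi inn by blast
      qed (use q arcs_sphere in auto)
      then have "q \<in> GC" using q by (simp add: GC_def)
      then have "1 \<le> path_length \<rho> q" using \<rho> by (simp add: admissible_def)
      also have "\<dots> = sum \<rho> (set q - sphere 0 1)"
        using \<rho> by (intro sum_interior[OF cq q(5)]) (simp add: admissible_def)
      also have "\<dots> = sum \<tau> (set q - sphere 0 1)"
      proof (rule sum.cong)
        fix n assume n: "n \<in> set q - sphere 0 1"
        then have "n \<in> G" using qG by blast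
        then have "n \<in> V - sphere 0 1" "n \<notin> c ` F" using inn VG_V True by blast+
        then show "\<rho> n = \<tau> n" by (simp add: \<tau>_def)
      qed simp
      also have "\<dots> \<le> sum \<tau> G"
        using qG p(1) tau by (intro sum_mono2) auto
      finally show ?thesis .
    qed
  qed
  then have adm: "adm (TP {a} {b}) \<tau>" using tau by (simp add: adm_def)
  have "1 \<le> (\<Sum>v\<in>VG - sphere 0 1. \<mu> v * (\<tau> v + 2 * (\<lambda>_. 0) v))"
  proof (rule ab_level[OF GSne adm _ _ \<mu>])
    show "(\<forall>v\<in>VF f. \<tau> (c f) \<le> 0) \<or> (\<forall>u\<in>VF f. \<forall>v\<in>VF f. u \<noteq> v \<longrightarrow> adjG u v)" if "f \<in> F" for f
    proof -
      have "adjG u v" if "u \<in> VF f" "v \<in> VF f" "u \<noteq> v" for u v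
        using triangle_face[OF \<open>f \<in> F\<close> tri[OF \<open>f \<in> F\<close>] that] \<open>f \<in> F\<close>
        unfolding adjG_def EG_def by blast
      then show ?thesis by blast
    qed
  qed simp
  also have "\<dots> = (\<Sum>v\<in>VG - sphere 0 1. \<mu> v * \<rho> v)"
    using VG_V c_V by (intro sum.cong) (auto simp: \<tau>_def)
  finally have "1 \<le> sqn (VG - sphere 0 1) \<mu> * sqn (VG - sphere 0 1) \<rho>" by (rule sum_mult_square_le)
  also have "\<dots> \<le> area V \<mu> * area V \<rho>"
    using VG_V by (intro mult_mono area_mono_sqn sqn_nonneg order_trans[OF sqn_nonneg area_mono_sqn]) auto
  finally show ?thesis by (simp add: mult.commute)
qed

text \<open>\<open>1 / (?K * area V \<mu>)\<close> bounds from below every density admissible for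
  the enlarged lists from \<open>a\<close> to \<open>b\<close>, and likewise \<open>\<rho>\<close>
  for the lists between the arcs. Members of these two families meet, so the product of the bounds
  is at most 1.\<close>

lemma area_product_ge:
  assumes GSne: "GS \<noteq> {}" and GCne: "GC \<noteq> {}"
    and \<rho>: "admissible V GC (V \<inter> sphere 0 1) \<rho>" and \<mu>: "admissible V GS (V \<inter> sphere 0 1) \<mu>"
    and N: "\<And>f. f \<in> F \<Longrightarrow> card (VF f) \<le> N" "0 < N"
  shows "1 \<le> (4 * real N + 1)\<^sup>2 * (area V \<rho> * area V \<mu>)"
proof -
  let ?W = "VG - sphere 0 1" and ?K = "4 * real N + 1"
  have fm: "(\<forall>v\<in>VF f. \<tau> (c f) \<le> face_max \<tau> v) \<or> (\<forall>u\<in>VF f. \<forall>v\<in>VF f. u \<noteq> v \<longrightarrow> adjG u v)"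
    if "f \<in> F" for f \<tau> using face_max(2)[OF that] by blast
  have bound: "1 \<le> ?K * area V \<nu> * sqn inner_nodes \<tau>"
    if "1 \<le> (\<Sum>v\<in>?W. \<nu> v * (\<tau> v + 2 * face_max \<tau> v))" "\<And>n. 0 \<le> \<tau> n" for \<nu> \<tau>
  proof -
    have "1 \<le> sqn ?W \<nu> * sqn ?W (\<lambda>v. \<tau> v + 2 * face_max \<tau> v)"
      by (rule sum_mult_square_le[OF that(1)])
    also have "\<dots> \<le> area V \<nu> * (?K * sqn inner_nodes \<tau>)"
      using VG_V
      by (intro mult_mono area_mono_sqn sqn_face_max_le that(2) N sqn_nonneg
          order_trans[OF sqn_nonneg area_mono_sqn]) auto
    finally show ?thesis by (simp add: mult_ac)
  qed
  have tS: "1 \<le> ?K * area V \<mu> * sqn inner_nodes \<tau>" if "adm (TP {a} {b}) \<tau>" for \<tau>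
    using that by (intro bound ab_level[OF GSne that _ fm \<mu>] face_max(1)) (auto simp: adm_def)
  have tC: "1 \<le> ?K * area V \<rho> * sqn inner_nodes \<tau>" if "adm (TP SL SR) \<tau>" for \<tau>
    using that by (intro bound arcs_level[OF GCne that _ fm \<rho>] face_max(1)) (auto simp: adm_def)
  have area0: "0 \<le> area V \<nu>" for \<nu> by (simp add: area_def sum_nonneg)
  have nonempty: "0 < ?K * area V \<nu>" if "1 \<le> ?K * area V \<nu> * x" "0 \<le> x" for \<nu> :: "complex \<Rightarrow> real" and x
  proof -
    have "0 \<le> ?K * area V \<nu>" using area0 by simp
    moreover have "?K * area V \<nu> \<noteq> 0" using that by auto
    ultimately show ?thesis by (metis order_le_less)
  qed
  \<comment> \<open>Some admissible density is needed to see that the areas are nonzero before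
    dividing by them.\<close>
  have one: "adm \<G> (\<lambda>_. 1)" if "{} \<notin> \<G>" "\<G> \<subseteq> Pow inner_nodes" for \<G>
  proof -
    have "1 \<le> sum (\<lambda>_. 1 :: real) G" if "G \<in> \<G>" for G
    proof -
      have "G \<noteq> {}" "finite G"
        using that \<open>{} \<notin> \<G>\<close> \<open>\<G> \<subseteq> Pow inner_nodes\<close> finite_inner_nodes finite_subset by blast+
      then show ?thesis by (simp add: Suc_le_eq card_gt_0_iff)
    qed
    then show ?thesis by (simp add: adm_def)
  qed
  have ne: "{} \<notin> TP S S'" for S S' by (auto simp: TP_def)
  have kS: "0 < ?K * area V \<mu>"
    by (rule nonempty[OF tS[OF one[OF ne TP_inner]] sqn_nonneg])
  have kC: "0 < ?K * area V \<rho>"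
    by (rule nonempty[OF tC[OF one[OF ne TP_inner]] sqn_nonneg])
  have "1 / (?K * area V \<mu>) * (1 / (?K * area V \<rho>)) \<le> 1"
  proof (rule adm_product_le_1[OF finite_inner_nodes TP_inner TP_inner TP_meet])
    show "1 / (?K * area V \<mu>) \<le> sqn inner_nodes \<tau>" if "adm (TP {a} {b}) \<tau>" for \<tau>
      using tS[OF that] kS by (simp add: divide_le_eq mult_ac)
    show "1 / (?K * area V \<rho>) \<le> sqn inner_nodes \<tau>" if "adm (TP SL SR) \<tau>" for \<tau>
      using tC[OF that] kC by (simp add: divide_le_eq mult_ac)
  qed (use kS kC in simp_all)
  then have "1 \<le> (?K * area V \<mu>) * (?K * area V \<rho>)" using kS kC by (simp add: divide_le_eq)
  then show ?thesis by (simp add: power2_eq_square mult_ac)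
qed

text \<open>Passes from node sets to lists: a repeated node only increases the length of a list, and
  values on the circle are set to 0 without changing the interior sums.\<close>

lemma admissible_extend:
  assumes \<Gamma>: "\<And>p. p \<in> \<Gamma> \<Longrightarrow> set p \<subseteq> V" and adm: "adm {set p - sphere 0 1 | p. p \<in> \<Gamma>} \<tau>"
  shows "admissible V \<Gamma> (V \<inter> sphere 0 1) (\<lambda>v. if v \<in> sphere 0 1 then 0 else \<tau> v)"
    and "area V (\<lambda>v. if v \<in> sphere 0 1 then 0 else \<tau> v) = sqn (V - sphere 0 1) \<tau>"
proof -
  let ?\<rho> = "\<lambda>v. if v \<in> sphere 0 1 then 0 else \<tau> v"
  have nn: "0 \<le> ?\<rho> v" for v using adm by (simp add: adm_def)
  have "1 \<le> path_length ?\<rho> p" if "p \<in> \<Gamma>" for p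
  proof -
    have "1 \<le> sum \<tau> (set p - sphere 0 1)" using adm that by (auto simp: adm_def)
    also have "\<dots> = sum ?\<rho> (set p)" by (intro sum.mono_neutral_cong_left) auto
    also have "\<dots> \<le> path_length ?\<rho> p"
      unfolding path_length_def by (rule sum_set_le_sum_list) (rule nn)
    finally show ?thesis .
  qed
  then show "admissible V \<Gamma> (V \<inter> sphere 0 1) ?\<rho>" using nn by (simp add: admissible_def)
  show "area V ?\<rho> = sqn (V - sphere 0 1) \<tau>"
    unfolding area_def sqn_def using finV by (intro sum.mono_neutral_cong_right) auto
qed

lemma area_lower_product_le_1:
  assumes lowC: "\<And>\<rho>. admissible V GC (V \<inter> sphere 0 1) \<rho> \<Longrightarrow> x \<le> area V \<rho>"
    and lowS: "\<And>\<mu>. admissible V GS (V \<inter> sphere 0 1) \<mu> \<Longrightarrow> y \<le> area V \<mu>"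
    and pos: "0 < x" "0 < y"
  shows "x * y \<le> 1"
proof (rule adm_product_le_1[where \<Omega> = "V - sphere 0 1" and \<G> = "{set p - sphere 0 1 | p. p \<in> GC}"
      and \<H> = "{set p - sphere 0 1 | p. p \<in> GS}"])
  have V: "set p \<subseteq> V" if "p \<in> GC \<union> GS" for p using that by (auto simp: GC_def GS_def cpath_def)
  show "x \<le> sqn (V - sphere 0 1) \<tau>" if "adm {set p - sphere 0 1 | p. p \<in> GC} \<tau>" for \<tau>
    using lowC[OF admissible_extend(1)[OF _ that]] admissible_extend(2)[OF _ that] V by simp
  show "y \<le> sqn (V - sphere 0 1) \<tau>" if "adm {set p - sphere 0 1 | p. p \<in> GS} \<tau>" for \<tau>
    using lowS[OF admissible_extend(1)[OF _ that]] admissible_extend(2)[OF _ that] V by simp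
  show "{set p - sphere 0 1 | p. p \<in> GC} \<subseteq> Pow (V - sphere 0 1)"
    "{set p - sphere 0 1 | p. p \<in> GS} \<subseteq> Pow (V - sphere 0 1)" using V by blast+
  show "G \<inter> H \<noteq> {}" if "G \<in> {set p - sphere 0 1 | p. p \<in> GC}" "H \<in> {set p - sphere 0 1 | p. p \<in> GS}" for G H
    using that GC_GS_meet by auto
qed (use finV pos in auto)

text \<open>A path of either family meets one of the other family off the circle, so it has an inner
  vertex and the constant 1 off the circle is admissible.\<close>

lemma admissible_exists:
  assumes "GC \<noteq> {}" "GS \<noteq> {}"
  shows "\<exists>\<rho>. admissible V GC (V \<inter> sphere 0 1) \<rho>" "\<exists>\<mu>. admissible V GS (V \<inter> sphere 0 1) \<mu>"
proof -
  have "adm {set p - sphere 0 1 | p. p \<in> \<Gamma>} (\<lambda>_. 1)" if ne: "\<And>p. p \<in> \<Gamma> \<Longrightarrow> set p - sphere 0 1 \<noteq> {}" for \<Gamma>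
  proof -
    have "1 \<le> sum (\<lambda>_. 1 :: real) (set p - sphere 0 1)" if "p \<in> \<Gamma>" for p
    proof -
      have "0 < card (set p - sphere 0 1)" using ne[OF that] by (simp add: card_gt_0_iff)
      then show ?thesis by simp
    qed
    then show ?thesis by (auto simp: adm_def)
  qed
  moreover have "set p - sphere 0 1 \<noteq> {}" if "p \<in> GC" for p using GC_GS_meet[OF that] assms(2) by blast
  moreover have "set p - sphere 0 1 \<noteq> {}" if "p \<in> GS" for p using GC_GS_meet[OF _ that] assms(1) by blast
  ultimately have "adm {set p - sphere 0 1 | p. p \<in> GC} (\<lambda>_. 1)" "adm {set p - sphere 0 1 | p. p \<in> GS} (\<lambda>_. 1)"
    by blast+
  then show "\<exists>\<rho>. admissible V GC (V \<inter> sphere 0 1) \<rho>" "\<exists>\<mu>. admissible V GS (V \<inter> sphere 0 1) \<mu>"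
    using admissible_extend(1)[of GC] admissible_extend(1)[of GS] by (force simp: GC_def GS_def cpath_def)+
qed

end

section \<open>Charts of a polygon\<close>

locale disk_chart =
  fixes X :: "'a topology" and D :: "'a cells" and k :: "complex \<Rightarrow> 'a" and \<kappa> :: "'a \<Rightarrow> complex"
  assumes maps: "homeomorphic_maps closed_disk X k \<kappa>" and CW: "finite_CW_complex X D"
begin

lemma chart:
  shows cont_\<kappa>: "continuous_map X (top_of_set (cball 0 1)) \<kappa>"
    and cont_k: "continuous_map (top_of_set (cball 0 1)) X k"
    and \<kappa>_k: "z \<in> cball 0 1 \<Longrightarrow> \<kappa> (k z) = z"
    and k_\<kappa>: "x \<in> topspace X \<Longrightarrow> k (\<kappa> x) = x"
  using maps by (auto simp: homeomorphic_maps_def closed_disk_def)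

lemma \<kappa>_disk: "x \<in> topspace X \<Longrightarrow> \<kappa> x \<in> cball 0 1"
  using cont_\<kappa> by (auto simp: continuous_map_def)

lemma k_X: "z \<in> cball 0 1 \<Longrightarrow> k z \<in> topspace X"
  using cont_k by (auto simp: continuous_map_def)

lemma inj_\<kappa>: "inj_on \<kappa> (topspace X)"
  using k_\<kappa> by (intro inj_on_inverseI)

lemma \<kappa>_surj: "\<kappa> ` topspace X = cball 0 1"
  using \<kappa>_disk \<kappa>_k k_X by (force simp: image_iff)

lemma cell_X: "e \<in> D n \<Longrightarrow> e \<subseteq> topspace X"
  using CW by (auto simp: finite_CW_complex_def)

lemma cells_disj: "d \<in> D m \<Longrightarrow> e \<in> D n \<Longrightarrow> (m, d) \<noteq> (n, e) \<Longrightarrow> d \<inter> e = {}"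
  using CW by (auto simp: finite_CW_complex_def)

lemma cell_map:
  assumes "e \<in> D n" shows "\<exists>\<phi>. characteristic_map X D n e \<phi>"
proof -
  have "\<forall>n. \<forall>e\<in>D n. \<exists>\<phi>. characteristic_map X D n e \<phi>"
    using CW unfolding finite_CW_complex_def by (elim conjE)
  from bspec[OF spec[OF this] assms] show ?thesis .
qed

lemma finite_cells: "finite (D n)"
proof -
  have "finite (SIGMA n:UNIV. D n)" using CW by (simp add: finite_CW_complex_def)
  then have "finite (Pair n ` D n)" by (rule rev_finite_subset) auto
  then show ?thesis by (rule finite_imageD) (auto intro: inj_onI)
qed

lemma \<kappa>_disj: "S \<subseteq> topspace X \<Longrightarrow> T \<subseteq> topspace X \<Longrightarrow> S \<inter> T = {} \<Longrightarrow> \<kappa> ` S \<inter> \<kappa> ` T = {}"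
  using inj_\<kappa> by (auto dest!: inj_onD)

lemma \<kappa>_closure:
  assumes "S \<subseteq> topspace X" shows "\<kappa> ` (X closure_of S) = closure (\<kappa> ` S)"
proof -
  have hm: "homeomorphic_map X (top_of_set (cball 0 1)) \<kappa>"
    using maps by (simp add: homeomorphic_maps_map closed_disk_def)
  have sub: "\<kappa> ` S \<subseteq> cball 0 1" using assms \<kappa>_disk by blast
  then have "closure (\<kappa> ` S) \<subseteq> cball 0 1" by (intro closure_minimal) auto
  then show ?thesis
    using homeomorphic_map_closure_of[OF hm assms] sub
    by (simp add: closure_of_subtopology Int_absorb1)
qed

text \<open>The balls of \<open>characteristic_map\<close> consist of sequences of reals;
  \<open>\<iota>\<close> replaces them by an interval for edges and by a complex disk for
  faces.\<close>

lemma cell_param: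
  assumes \<phi>: "characteristic_map X D n e \<phi>" and e: "e \<subseteq> topspace X"
    and \<iota>: "continuous_map (top_of_set T) (unit_ball n) \<iota>" "inj_on \<iota> I" "\<iota> ` I = open_unit_ball n" "I \<subseteq> T"
  shows "continuous_on T (\<kappa> \<circ> \<phi> \<circ> \<iota>)" "inj_on (\<kappa> \<circ> \<phi> \<circ> \<iota>) I" "(\<kappa> \<circ> \<phi> \<circ> \<iota>) ` I = \<kappa> ` e"
proof -
  have c: "continuous_map (unit_ball n) X \<phi>"
    and hm: "homeomorphic_map (subtopology (unit_ball n) (open_unit_ball n)) (subtopology X e) \<phi>"
    using \<phi> by (auto simp: characteristic_map_def)
  have "continuous_map (top_of_set T) (top_of_set (cball 0 1)) (\<kappa> \<circ> (\<phi> \<circ> \<iota>))"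
    using continuous_map_compose[OF continuous_map_compose[OF \<iota>(1) c] cont_\<kappa>] .
  then show "continuous_on T (\<kappa> \<circ> \<phi> \<circ> \<iota>)" by (simp add: o_assoc)
  have ob: "topspace (subtopology (unit_ball n) (open_unit_ball n)) = open_unit_ball n"
    by (auto simp: unit_ball_def open_unit_ball_def)
  have im: "\<phi> ` open_unit_ball n = e"
    using homeomorphic_imp_surjective_map[OF hm] ob e by (simp add: Int_absorb1)
  have "inj_on \<phi> (open_unit_ball n)"
    using homeomorphic_imp_injective_map[OF hm] ob by simp
  then have "inj_on (\<phi> \<circ> \<iota>) I" using \<iota>(2,3) by (intro comp_inj_on) auto
  moreover have *: "(\<phi> \<circ> \<iota>) ` I = e" using im \<iota>(3) by (metis image_comp)
  ultimately show "inj_on (\<kappa> \<circ> \<phi> \<circ> \<iota>) I"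
    using inj_on_subset[OF inj_\<kappa> e] comp_inj_on[of "\<phi> \<circ> \<iota>" I \<kappa>] by (simp add: o_assoc)
  show "(\<kappa> \<circ> \<phi> \<circ> \<iota>) ` I = \<kappa> ` e" using * by (metis image_comp)
qed

text \<open>The zero-dimensional ball has the zero sequence as its only point.\<close>

lemma vertex_cell: assumes "e \<in> D 0" shows "\<exists>x. e \<subseteq> {x}"
proof -
  obtain \<phi> where \<phi>: "characteristic_map X D 0 e \<phi>" using cell_map[OF assms] by blast
  have hm: "homeomorphic_map (subtopology (unit_ball 0) (open_unit_ball 0)) (subtopology X e) \<phi>"
    using \<phi> by (auto simp: characteristic_map_def)
  have "e = \<phi> ` topspace (subtopology (unit_ball 0) (open_unit_ball 0))"
    using homeomorphic_imp_surjective_map[OF hm] cell_X[OF assms] by (simp add: Int_absorb1)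
  also have "\<dots> \<subseteq> \<phi> ` {\<lambda>_. 0}"
    by (intro image_mono) (auto simp: unit_ball_def open_unit_ball_def topspace_Euclidean_space)
  finally show ?thesis by auto
qed

lemma finite_vertices: "finite (vertices D)"
proof -
  have "finite e" if "e \<in> D 0" for e using vertex_cell[OF that] finite_subset by blast
  then show ?thesis unfolding vertices_def using finite_cells by (intro finite_Union) auto
qed

lemma vertices_X: "vertices D \<subseteq> topspace X"
  using cell_X by (auto simp: vertices_def)

lemma edge_param:
  assumes e: "e \<in> D 1"
  obtains \<psi> where "continuous_on {-1..1::real} \<psi>" "inj_on \<psi> {-1<..<1}" "\<psi> ` {-1<..<1} = \<kappa> ` e"
    "\<psi> (-1) \<in> \<kappa> ` vertices D" "\<psi> 1 \<in> \<kappa> ` vertices D"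
proof -
  obtain \<phi> where \<phi>: "characteristic_map X D 1 e \<phi>" using cell_map[OF e] by blast
  define \<iota> :: "real \<Rightarrow> nat \<Rightarrow> real" where "\<iota> = (\<lambda>t i. if i < 1 then t else 0)"
  have "continuous_map (top_of_set {-1..1}) (Euclidean_space 1) \<iota>"
    unfolding \<iota>_def by (subst continuous_map_componentwise_Euclidean_space) auto
  moreover have "\<iota> \<in> {-1..1} \<rightarrow> {x. (\<Sum>i<1. x i ^ 2) \<le> 1}"
    by (auto simp: \<iota>_def abs_square_le_1 abs_le_iff)
  ultimately have c: "continuous_map (top_of_set {-1..1}) (unit_ball 1) \<iota>"
    by (simp add: unit_ball_def continuous_map_in_subtopology image_subset_iff_funcset)
  have inj: "inj_on \<iota> {-1<..<1}" by (intro inj_onI) (auto simp: \<iota>_def dest: fun_cong[of _ _ 0])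
  have im: "\<iota> ` {-1<..<1} = open_unit_ball 1"
  proof
    show "\<iota> ` {-1<..<1} \<subseteq> open_unit_ball 1"
      by (auto simp: \<iota>_def open_unit_ball_def topspace_Euclidean_space abs_square_less_1)
    show "open_unit_ball 1 \<subseteq> \<iota> ` {-1<..<1}"
    proof
      fix x assume x: "x \<in> open_unit_ball 1"
      then have "\<bar>x 0\<bar> < 1" by (simp add: open_unit_ball_def abs_square_less_1)
      moreover have "x = \<iota> (x 0)" using x by (auto simp: \<iota>_def open_unit_ball_def topspace_Euclidean_space fun_eq_iff)
      ultimately show "x \<in> \<iota> ` {-1<..<1}" by (metis abs_less_iff greaterThanLessThan_iff imageI minus_less_iff)
    qed
  qed
  have sp: "\<phi> (\<iota> t) \<in> vertices D" if "t^2 = 1" for t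
  proof -
    have "\<iota> t \<in> unit_sphere 1" using that by (auto simp: \<iota>_def unit_sphere_def topspace_Euclidean_space)
    then have "\<phi> (\<iota> t) \<in> (\<Union>m<1. \<Union>(D m))" using \<phi> unfolding characteristic_map_def by blast
    then show ?thesis by (auto simp: vertices_def)
  qed
  have sub: "{-1<..<1} \<subseteq> {-1..1::real}" by auto
  show thesis
    by (rule that[OF cell_param[OF \<phi> cell_X[OF e] c inj im sub]]) (use sp in simp_all)
qed

text \<open>Injectivity is claimed on the open disk only, as the attaching circle may run along a
  slit in both directions.\<close>

lemma face_param:
  assumes f: "f \<in> D 2"
  obtains \<psi> where "continuous_on (cball (0::complex) 1) \<psi>" "inj_on \<psi> (ball 0 1)" "\<psi> ` ball 0 1 = \<kappa> ` f"
    "\<psi> ` sphere 0 1 \<subseteq> \<kappa> ` (vertices D \<union> \<Union>(D 1))"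
proof -
  obtain \<phi> where \<phi>: "characteristic_map X D 2 f \<phi>" using cell_map[OF f] by blast
  define \<iota> :: "complex \<Rightarrow> nat \<Rightarrow> real" where "\<iota> = (\<lambda>z i. if i < 2 then (if i = 0 then Re z else Im z) else 0)"
  have sum2: "(\<Sum>i<2. x i ^ 2) = (x 0)\<^sup>2 + (x (Suc 0))\<^sup>2" for x :: "nat \<Rightarrow> real"
    by (simp add: numeral_2_eq_2)
  have sum\<iota>: "(\<Sum>i<2. \<iota> z i ^ 2) = (norm z)\<^sup>2" for z
    unfolding sum2 by (simp add: \<iota>_def cmod_power2)
  have "continuous_map (top_of_set (cball 0 1)) (Euclidean_space 2) \<iota>"
    unfolding \<iota>_def by (subst continuous_map_componentwise_Euclidean_space) (auto intro!: continuous_intros)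
  moreover have "\<iota> \<in> cball 0 1 \<rightarrow> {x. (\<Sum>i<2. x i ^ 2) \<le> 1}"
    by (auto simp: sum\<iota> abs_square_le_1)
  ultimately have c: "continuous_map (top_of_set (cball 0 1)) (unit_ball 2) \<iota>"
    by (simp add: unit_ball_def continuous_map_in_subtopology image_subset_iff_funcset)
  have \<iota>_inj: "z = w" if "\<iota> z = \<iota> w" for z w
    using fun_cong[OF that, of 0] fun_cong[OF that, of 1] by (simp add: \<iota>_def complex_eq_iff)
  then have inj: "inj_on \<iota> (ball 0 1)" by (intro inj_onI)
  have \<iota>_top: "\<iota> z \<in> topspace (Euclidean_space 2)" for z by (simp add: \<iota>_def topspace_Euclidean_space)
  have im: "\<iota> ` ball 0 1 = open_unit_ball 2"
  proof
    show "\<iota> ` ball 0 1 \<subseteq> open_unit_ball 2"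
      using \<iota>_top by (auto simp: open_unit_ball_def sum\<iota> abs_square_less_1)
    show "open_unit_ball 2 \<subseteq> \<iota> ` ball 0 1"
    proof
      fix x assume x: "x \<in> open_unit_ball 2"
      let ?z = "Complex (x 0) (x 1)"
      have x0: "x i = 0" if "2 \<le> i" for i
        using x that by (simp add: open_unit_ball_def topspace_Euclidean_space)
      have "x i = \<iota> ?z i" for i
      proof -
        consider "i = 0" | "i = 1" | "2 \<le> i" by linarith
        then show ?thesis by cases (simp_all add: \<iota>_def x0)
      qed
      then have xz: "x = \<iota> ?z" by (intro ext)
      moreover have "(\<Sum>i<2. x i ^ 2) < 1" using x by (simp add: open_unit_ball_def)
      ultimately have "(norm ?z)\<^sup>2 < 1" by (metis sum\<iota>)
      then have "?z \<in> ball 0 1" by (simp add: abs_square_less_1)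
      then have "\<iota> ?z \<in> \<iota> ` ball 0 1" by (rule imageI)
      then show "x \<in> \<iota> ` ball 0 1" by (simp only: xz[symmetric])
    qed
  qed
  have sp: "(\<kappa> \<circ> \<phi> \<circ> \<iota>) ` sphere 0 1 \<subseteq> \<kappa> ` (vertices D \<union> \<Union>(D 1))"
  proof
    fix y assume "y \<in> (\<kappa> \<circ> \<phi> \<circ> \<iota>) ` sphere 0 1"
    then obtain z where z: "norm z = 1" "y = \<kappa> (\<phi> (\<iota> z))" by auto
    have "\<iota> z \<in> unit_sphere 2" using z \<iota>_top by (simp add: unit_sphere_def sum\<iota>)
    then have "\<phi> (\<iota> z) \<in> (\<Union>m<2. \<Union>(D m))" using \<phi> unfolding characteristic_map_def by blast
    then have "\<phi> (\<iota> z) \<in> vertices D \<union> \<Union>(D 1)" by (auto simp: vertices_def less_2_cases_iff)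
    then show "y \<in> \<kappa> ` (vertices D \<union> \<Union>(D 1))" using z by blast
  qed
  show thesis by (rule that[OF cell_param[OF \<phi> cell_X[OF f] c inj im ball_subset_cball] sp])
qed

text \<open>Another homeomorphism followed by \<open>\<kappa>\<close> is a homeomorphism of the
  closed disk onto itself; by \<open>interior_disk_image\<close> it preserves the open disk, hence
  the circle.\<close>

lemma boundary_eq: "disk_boundary X = k ` sphere 0 1"
proof
  have "homeomorphic_map closed_disk X k" using maps by (simp add: homeomorphic_maps_map)
  then show "k ` sphere 0 1 \<subseteq> disk_boundary X" by (auto simp: disk_boundary_def)
  show "disk_boundary X \<subseteq> k ` sphere 0 1"
  proof
    fix x assume "x \<in> disk_boundary X"
    then obtain h z where h: "homeomorphic_map closed_disk X h" and z: "norm z = 1" "x = h z"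
      by (auto simp: disk_boundary_def)
    have hs: "h ` cball 0 1 = topspace X" "inj_on h (cball 0 1)"
      using homeomorphic_imp_surjective_map[OF h] homeomorphic_imp_injective_map[OF h]
      by (auto simp: closed_disk_def)
    have hX: "continuous_map (top_of_set (cball 0 1)) X h"
      using homeomorphic_imp_continuous_map[OF h] by (simp add: closed_disk_def)
    let ?g = "\<kappa> \<circ> h"
    have "continuous_map (top_of_set (cball 0 1)) (top_of_set (cball 0 1)) ?g"
      by (rule continuous_map_compose[OF hX cont_\<kappa>])
    then have g: "continuous_on (cball 0 1) ?g" by simp
    have inj: "inj_on ?g (cball 0 1)" using hs inj_\<kappa> by (intro comp_inj_on) auto
    have im: "?g ` cball 0 1 = cball 0 1" by (metis hs(1) \<kappa>_surj image_comp)
    have "ball 0 1 = ?g ` ball 0 1" using interior_disk_image[OF g inj] im by simp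
    have "\<kappa> x \<notin> ball 0 1"
    proof
      assume "\<kappa> x \<in> ball 0 1"
      then have "\<kappa> x \<in> ?g ` ball 0 1" using \<open>ball 0 1 = ?g ` ball 0 1\<close> by simp
      then obtain w where w: "w \<in> ball 0 1" "?g w = ?g z" using z(2) by auto
      then have "w = z" using inj_onD[OF inj w(2)] z by simp
      then show False using w z by simp
    qed
    moreover have xX: "x \<in> topspace X" using hs z by auto
    ultimately have "\<kappa> x \<in> sphere 0 1" using \<kappa>_disk[OF xX] by auto
    then show "x \<in> k ` sphere 0 1" using k_\<kappa>[OF xX] imageI[of "\<kappa> x" "sphere 0 1" k] by simp
  qed
qed

end

section \<open>The subdivision seen through the chart\<close>

locale disk_subdivision = disk_chart +
  assumes simple: "simple_skeleton X D"
    and faces_cover: "topspace X = (\<Union>f\<in>D 2. X closure_of f)"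
    and faces_disks: "\<And>f. f \<in> D 2 \<Longrightarrow> closed_disk homeomorphic_space subtopology X (X closure_of f)"
begin

lemma cells_\<kappa>_disj:
  "d \<in> D m \<Longrightarrow> e \<in> D n \<Longrightarrow> (m, d) \<noteq> (n, e) \<Longrightarrow> \<kappa> ` d \<inter> \<kappa> ` e = {}"
  by (intro \<kappa>_disj cell_X cells_disj)

lemma vertices_\<kappa>_disj:
  assumes "e \<in> D n" "n \<noteq> 0" shows "\<kappa> ` e \<inter> \<kappa> ` vertices D = {}"
proof -
  have "e \<inter> d = {}" if "d \<in> D 0" for d
    by (rule cells_disj[OF assms(1) that]) (use assms(2) in simp)
  then have "e \<inter> vertices D = {}" by (auto simp: vertices_def)
  then show ?thesis by (intro \<kappa>_disj cell_X[OF assms(1)] vertices_X)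
qed

lemma edge_ends_X: "e \<in> D 1 \<Longrightarrow> edge_ends X e \<subseteq> topspace X"
  using closure_of_subset_topspace[of X e] by (auto simp: edge_ends_def)

lemma ends_\<kappa>:
  assumes "e \<in> D 1" shows "ends (\<kappa> ` e) = \<kappa> ` edge_ends X e"
proof -
  have eX: "e \<subseteq> topspace X" using assms by (rule cell_X)
  have "ends (\<kappa> ` e) = \<kappa> ` (X closure_of e) - \<kappa> ` e"
    unfolding ends_def \<kappa>_closure[OF eX] ..
  also have "\<dots> = \<kappa> ` edge_ends X e"
    unfolding edge_ends_def
    by (rule inj_on_image_set_diff[symmetric, OF inj_\<kappa>]) (use eX closure_of_subset_topspace[of X e] in auto)
  finally show ?thesis .
qed

text \<open>The characteristic map is injective inside, its end values are vertices off the open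
  edge, and simplicity makes them two distinct points; so the closed edge is an arc.\<close>

lemma edge_arc_\<kappa>:
  assumes e: "e \<in> D 1"
  shows "\<exists>g. arc g \<and> pathstart g \<in> \<kappa> ` vertices D \<and> pathfinish g \<in> \<kappa> ` vertices D
          \<and> \<kappa> ` e = path_image g - {pathstart g, pathfinish g}"
proof -
  obtain \<psi> where \<psi>: "continuous_on {-1..1::real} \<psi>" "inj_on \<psi> {-1<..<1}" "\<psi> ` {-1<..<1} = \<kappa> ` e"
    "\<psi> (-1) \<in> \<kappa> ` vertices D" "\<psi> 1 \<in> \<kappa> ` vertices D"
    by (rule edge_param[OF e])
  have new: "\<psi> (-1) \<notin> \<kappa> ` e" "\<psi> 1 \<notin> \<kappa> ` e"
    using vertices_\<kappa>_disj[OF e] \<psi>(4,5) by auto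
  have split: "{-1..1} = {-1<..<1} \<union> {-1, 1::real}" by auto
  have "\<psi> ` {-1..1} = \<psi> ` {-1<..<1} \<union> {\<psi> (-1), \<psi> 1}" unfolding split by (simp add: image_Un)
  then have im: "\<psi> ` {-1..1} = \<kappa> ` e \<union> {\<psi> (-1), \<psi> 1}" using \<psi>(3) by simp
  have "closed (\<psi> ` {-1..1})"
    using \<psi>(1) by (intro compact_imp_closed compact_continuous_image) auto
  then have "closure (\<kappa> ` e) \<subseteq> \<psi> ` {-1..1}" using im by (intro closure_minimal) auto
  moreover have "\<psi> ` closure {-1<..<1} \<subseteq> closure (\<kappa> ` e)"
    using \<psi>(1,3) closure_subset[of "\<kappa> ` e"] by (intro image_closure_subset) auto
  ultimately have "closure (\<kappa> ` e) = \<psi> ` {-1..1}" by auto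
  then have ends: "ends (\<kappa> ` e) = {\<psi> (-1), \<psi> 1}" using im new by (auto simp: ends_def)
  have "card (edge_ends X e) = 2" using simple e by (auto simp: simple_skeleton_def)
  then have "card (ends (\<kappa> ` e)) = 2"
    unfolding ends_\<kappa>[OF e] using card_image[OF inj_on_subset[OF inj_\<kappa> edge_ends_X[OF e]]] by simp
  then have ne: "\<psi> (-1) \<noteq> \<psi> 1" unfolding ends by auto
  have inj: "inj_on \<psi> {-1..1}"
  proof -
    have "inj_on \<psi> {-1, 1}" using ne by (auto simp: inj_on_def)
    moreover have "{-1<..<1} - {-1, 1} = {-1<..<1::real}" "{-1, 1} - {-1<..<1} = {-1, 1::real}" by auto
    moreover have "\<psi> ` {-1<..<1} \<inter> \<psi> ` {-1, 1} = {}" using \<psi>(3) new by simp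
    ultimately show ?thesis unfolding split inj_on_Un using \<psi>(2) by simp
  qed
  define g where "g = \<psi> \<circ> (\<lambda>t. 2 * t - 1)"
  have sh: "(\<lambda>t. 2 * t - 1) ` {0..1} = {-1..1::real}"
  proof
    show "{-1..1::real} \<subseteq> (\<lambda>t. 2 * t - 1) ` {0..1}"
    proof
      fix s :: real assume "s \<in> {-1..1}"
      then show "s \<in> (\<lambda>t. 2 * t - 1) ` {0..1}" by (intro image_eqI[of _ _ "(s + 1) / 2"]) (auto simp: field_simps)
    qed
  qed auto
  have "continuous_on {0..1} g"
    unfolding g_def using \<psi>(1) sh by (intro continuous_on_compose continuous_intros) auto
  moreover have "inj_on g {0..1}"
    unfolding g_def using inj sh by (intro comp_inj_on) (auto simp: inj_on_def)
  ultimately have "arc g" by (simp add: arc_def path_def)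
  moreover have "pathstart g = \<psi> (-1)" "pathfinish g = \<psi> 1"
    by (simp_all add: g_def pathstart_def pathfinish_def)
  moreover have "path_image g = \<psi> ` {-1..1}"
    unfolding path_image_def g_def using sh by (metis image_comp)
  ultimately show ?thesis using im new \<psi>(4,5) by (intro exI[of _ g]) auto
qed

lemma plane_graph_\<kappa>: "plane_graph (\<kappa> ` vertices D) ((`) \<kappa> ` D 1)"
proof
  show "finite (\<kappa> ` vertices D)" "finite ((`) \<kappa> ` D 1)"
    using finite_vertices finite_cells by auto
  show "inj_on ends ((`) \<kappa> ` D 1)"
  proof (rule inj_onI)
    fix x y assume "x \<in> (`) \<kappa> ` D 1" "y \<in> (`) \<kappa> ` D 1" and eq: "ends x = ends y"
    then obtain d e where de: "d \<in> D 1" "x = \<kappa> ` d" "e \<in> D 1" "y = \<kappa> ` e" by auto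
    then have "\<kappa> ` edge_ends X d = \<kappa> ` edge_ends X e" using eq ends_\<kappa> by simp
    then have "edge_ends X d = edge_ends X e"
      using inj_on_image_eq_iff[OF inj_\<kappa> edge_ends_X[OF de(1)] edge_ends_X[OF de(3)]] by simp
    then have "d = e" using simple de by (auto simp: simple_skeleton_def dest: inj_onD)
    then show "x = y" using de by simp
  qed
next
  fix x assume "x \<in> (`) \<kappa> ` D 1"
  then obtain d where d: "d \<in> D 1" "x = \<kappa> ` d" by auto
  show "\<exists>g. arc g \<and> pathstart g \<in> \<kappa> ` vertices D \<and> pathfinish g \<in> \<kappa> ` vertices D
          \<and> x = path_image g - {pathstart g, pathfinish g}"
    unfolding d(2) by (rule edge_arc_\<kappa>[OF d(1)])
  show "x \<inter> \<kappa> ` vertices D = {}" unfolding d(2) by (rule vertices_\<kappa>_disj[OF d(1)]) simp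
  fix y assume "y \<in> (`) \<kappa> ` D 1" and ne: "x \<noteq> y"
  then obtain e where e: "e \<in> D 1" "y = \<kappa> ` e" by auto
  have "d \<noteq> e" using d e ne by auto
  then show "x \<inter> y = {}" unfolding d(2) e(2) by (intro cells_\<kappa>_disj[OF d(1) e(1)]) simp
qed

definition face_map :: "'a set \<Rightarrow> complex \<Rightarrow> complex" where
  "face_map f = \<kappa> \<circ> (SOME h. homeomorphic_map closed_disk (subtopology X (X closure_of f)) h)"

lemma face_map:
  assumes f: "f \<in> D 2"
  shows "continuous_on (cball 0 1) (face_map f)" "inj_on (face_map f) (cball 0 1)"
    "face_map f ` cball 0 1 = \<kappa> ` (X closure_of f)"
proof -
  let ?Y = "subtopology X (X closure_of f)"
  define h where "h = (SOME h. homeomorphic_map closed_disk ?Y h)"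
  have "\<exists>h. homeomorphic_map closed_disk ?Y h"
    using faces_disks[OF f] by (simp add: homeomorphic_space)
  then have hm: "homeomorphic_map closed_disk ?Y h" unfolding h_def by (rule someI_ex)
  have c: "continuous_map closed_disk ?Y h" by (rule homeomorphic_imp_continuous_map[OF hm])
  have i: "inj_on h (cball 0 1)"
    using homeomorphic_imp_injective_map[OF hm] by (simp add: closed_disk_def)
  have im: "h ` cball 0 1 = X closure_of f"
    using homeomorphic_imp_surjective_map[OF hm] closure_of_subset_topspace[of X f]
    by (simp add: closed_disk_def Int_absorb1)
  have fm: "face_map f = \<kappa> \<circ> h" by (simp add: face_map_def h_def)
  have "continuous_map (top_of_set (cball 0 1)) X h"
    using continuous_map_into_fulltopology[OF c] by (simp add: closed_disk_def)
  then have "continuous_map (top_of_set (cball 0 1)) (top_of_set (cball 0 1)) (\<kappa> \<circ> h)"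
    using cont_\<kappa> by (rule continuous_map_compose)
  then show "continuous_on (cball 0 1) (face_map f)" by (simp add: fm)
  show "inj_on (face_map f) (cball 0 1)"
    unfolding fm using i inj_on_subset[OF inj_\<kappa> closure_of_subset_topspace[of X f]] im
    by (intro comp_inj_on) auto
  show "face_map f ` cball 0 1 = \<kappa> ` (X closure_of f)"
    unfolding fm using im by (metis image_comp)
qed

text \<open>The open cell is open in the plane, so it lies in the interior of its closure, which is
  the open disk of \<open>face_map\<close>. A rim point is therefore outside the open cell and must
  come from the circle of the characteristic map, whose image lies in the graph.\<close>

lemma face_structure:
  assumes f: "f \<in> D 2"
  shows open_face: "open (\<kappa> ` f)" and face_ball: "\<kappa> ` f \<subseteq> face_map f ` ball 0 1"
    and face_rim: "face_map f ` sphere 0 1 \<subseteq> \<kappa> ` vertices D \<union> \<Union>((`) \<kappa> ` D 1)"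
    and face_center: "\<exists>z\<in>\<kappa> ` f. \<forall>v\<in>face_map f ` sphere 0 1.
      \<exists>\<gamma>. path \<gamma> \<and> pathstart \<gamma> = z \<and> pathfinish \<gamma> = v \<and> path_image \<gamma> \<subseteq> insert v (\<kappa> ` f)"
proof -
  obtain \<psi> where \<psi>: "continuous_on (cball (0::complex) 1) \<psi>" "inj_on \<psi> (ball 0 1)" "\<psi> ` ball 0 1 = \<kappa> ` f"
    "\<psi> ` sphere 0 1 \<subseteq> \<kappa> ` (vertices D \<union> \<Union>(D 1))"
    by (rule face_param[OF f])
  have "open (\<psi> ` ball 0 1)"
    using continuous_on_subset[OF \<psi>(1) ball_subset_cball] \<psi>(2) by (intro invariance_of_domain) auto
  then show op: "open (\<kappa> ` f)" using \<psi>(3) by simp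
  have cl: "face_map f ` cball 0 1 = closure (\<kappa> ` f)"
    using face_map(3)[OF f] \<kappa>_closure[OF cell_X[OF f]] by simp
  have "\<kappa> ` f \<subseteq> interior (face_map f ` cball 0 1)"
    unfolding cl using op by (intro interior_maximal closure_subset)
  then show ball: "\<kappa> ` f \<subseteq> face_map f ` ball 0 1"
    using interior_disk_image[OF face_map(1,2)[OF f]] by simp
  have "closed (\<psi> ` cball 0 1)"
    using \<psi>(1) by (intro compact_imp_closed compact_continuous_image) auto
  moreover have "\<kappa> ` f \<subseteq> \<psi> ` cball 0 1" using \<psi>(3) by (metis ball_subset_cball image_mono)
  ultimately have "closure (\<kappa> ` f) \<subseteq> \<psi> ` cball 0 1" by (intro closure_minimal)
  moreover have "\<psi> ` cball 0 1 = \<kappa> ` f \<union> \<psi> ` sphere 0 1"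
  proof -
    have "cball 0 1 = ball 0 1 \<union> sphere (0::complex) 1" by auto
    then show ?thesis using \<psi>(3) by (simp add: image_Un)
  qed
  ultimately have sub: "face_map f ` cball 0 1 \<subseteq> \<kappa> ` f \<union> \<psi> ` sphere 0 1" using cl by simp
  have disj: "face_map f ` sphere 0 1 \<inter> face_map f ` ball 0 1 = {}"
    using inj_on_image_Int[OF face_map(2)[OF f], of "sphere 0 1" "ball 0 1"] by auto
  have rim: "face_map f ` sphere 0 1 \<subseteq> \<psi> ` sphere 0 1"
  proof
    fix z assume z: "z \<in> face_map f ` sphere 0 1"
    then have "z \<in> face_map f ` cball 0 1" by (rule subsetD[OF image_mono[OF sphere_cball]])
    then have "z \<in> \<kappa> ` f \<union> \<psi> ` sphere 0 1" by (rule subsetD[OF sub])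
    moreover have "z \<notin> face_map f ` ball 0 1" using z disj by (metis IntI empty_iff)
    then have "z \<notin> \<kappa> ` f" by (rule contra_subsetD[OF ball])
    ultimately show "z \<in> \<psi> ` sphere 0 1" by simp
  qed
  note rim
  also have "\<psi> ` sphere 0 1 \<subseteq> \<kappa> ` (vertices D \<union> \<Union>(D 1))" by (rule \<psi>(4))
  also have "\<dots> = \<kappa> ` vertices D \<union> \<Union>((`) \<kappa> ` D 1)" by (simp add: image_Un image_Union)
  finally show "face_map f ` sphere 0 1 \<subseteq> \<kappa> ` vertices D \<union> \<Union>((`) \<kappa> ` D 1)" .
  show "\<exists>z\<in>\<kappa> ` f. \<forall>v\<in>face_map f ` sphere 0 1.
      \<exists>\<gamma>. path \<gamma> \<and> pathstart \<gamma> = z \<and> pathfinish \<gamma> = v \<and> path_image \<gamma> \<subseteq> insert v (\<kappa> ` f)"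
  proof (intro bexI ballI)
    show "\<psi> 0 \<in> \<kappa> ` f" using \<psi>(3) by force
    fix v assume "v \<in> face_map f ` sphere 0 1"
    then obtain s where s: "norm s = 1" "v = \<psi> s" using rim by auto
    \<comment> \<open>Spokes are radii of the characteristic map: they stay in the open cell up to
      their last point, whereas radii of \<open>face_map\<close> could run into a slit.\<close>
    have "closed_segment 0 s \<subseteq> insert s (ball 0 1)"
    proof
      fix z assume "z \<in> closed_segment 0 s"
      then obtain u where u: "0 \<le> u" "u \<le> 1" "z = u *\<^sub>R s" by (auto simp: in_segment)
      then have "norm z = u" using s by simp
      then show "z \<in> insert s (ball 0 1)" using u by (cases "u = 1") auto
    qed
    then have im: "\<psi> ` closed_segment 0 s \<subseteq> insert v (\<kappa> ` f)" using \<psi>(3) s by (metis image_insert image_mono)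
    have "closed_segment 0 s \<subseteq> cball 0 1" using s by (intro closed_segment_subset) auto
    then have "path (\<psi> \<circ> linepath 0 s)"
      using continuous_on_subset[OF \<psi>(1)] by (intro path_continuous_image) auto
    then show "\<exists>\<gamma>. path \<gamma> \<and> pathstart \<gamma> = \<psi> 0 \<and> pathfinish \<gamma> = v \<and> path_image \<gamma> \<subseteq> insert v (\<kappa> ` f)"
      using im s by (intro exI[of _ "\<psi> \<circ> linepath 0 s"]) (auto simp: pathstart_compose pathfinish_compose path_image_compose)
  qed
qed

definition face_point :: "'a set \<Rightarrow> complex" where
  "face_point f = (SOME z. z \<in> \<kappa> ` f \<and> (\<forall>v\<in>face_map f ` sphere 0 1.
      \<exists>\<gamma>. path \<gamma> \<and> pathstart \<gamma> = z \<and> pathfinish \<gamma> = v \<and> path_image \<gamma> \<subseteq> insert v (\<kappa> ` f)))"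

lemma face_point:
  assumes "f \<in> D 2"
  shows "face_point f \<in> \<kappa> ` f \<and> (\<forall>v\<in>face_map f ` sphere 0 1.
      \<exists>\<gamma>. path \<gamma> \<and> pathstart \<gamma> = face_point f \<and> pathfinish \<gamma> = v \<and> path_image \<gamma> \<subseteq> insert v (\<kappa> ` f))"
  unfolding face_point_def by (rule someI_ex) (use face_center[OF assms] in \<open>simp only: Bex_def\<close>)

lemma disc_map_\<kappa>:
  "disc_map (\<kappa> ` vertices D) ((`) \<kappa> ` D 1) (D 2) face_map ((`) \<kappa>) face_point"
proof (intro disc_map.intro plane_graph_\<kappa> disc_map_axioms.intro)
  show "finite (D 2)" by (rule finite_cells)
  show "\<kappa> ` vertices D \<subseteq> cball 0 1" using vertices_X \<kappa>_disk by blast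
  show "e \<subseteq> cball 0 1" if "e \<in> (`) \<kappa> ` D 1" for e
  proof -
    obtain d where d: "d \<in> D 1" "e = \<kappa> ` d" using \<open>e \<in> (`) \<kappa> ` D 1\<close> by auto
    show ?thesis unfolding d(2) using cell_X[OF d(1)] \<kappa>_disk by blast
  qed
  have "(\<Union>f\<in>D 2. face_map f ` cball 0 1) = (\<Union>f\<in>D 2. \<kappa> ` (X closure_of f))"
    using face_map(3) by simp
  also have "\<dots> = \<kappa> ` topspace X" unfolding faces_cover by (simp only: image_UN)
  finally show "(\<Union>f\<in>D 2. face_map f ` cball 0 1) = cball 0 1" using \<kappa>_surj by simp
next
  fix f assume f: "f \<in> D 2"
  show "continuous_on (cball 0 1) (face_map f)" "inj_on (face_map f) (cball 0 1)"
    by (rule face_map[OF f])+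
  show "face_map f ` sphere 0 1 \<subseteq> \<kappa> ` vertices D \<union> \<Union>((`) \<kappa> ` D 1)" by (rule face_rim[OF f])
  show "\<kappa> ` f \<subseteq> face_map f ` ball 0 1" by (rule face_ball[OF f])
  show "face_point f \<in> \<kappa> ` f" using face_point[OF f] by simp
  have "\<kappa> ` f \<inter> \<kappa> ` e = {}" if "e \<in> D 1" for e by (rule cells_\<kappa>_disj[OF f that]) simp
  then show "\<kappa> ` f \<inter> (\<kappa> ` vertices D \<union> \<Union>((`) \<kappa> ` D 1)) = {}"
    using vertices_\<kappa>_disj[OF f] by auto
  show "\<exists>\<gamma>. path \<gamma> \<and> pathstart \<gamma> = face_point f \<and> pathfinish \<gamma> = v \<and> path_image \<gamma> \<subseteq> insert v (\<kappa> ` f)"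
    if "v \<in> face_map f ` sphere 0 1" for v
    using bspec[OF conjunct2[OF face_point[OF f]] that] .
next
  fix f g assume f: "f \<in> D 2" and g: "g \<in> D 2" and ne: "f \<noteq> g"
  have cl: "face_map u ` cball 0 1 = closure (\<kappa> ` u)" if "u \<in> D 2" for u
    using face_map(3)[OF that] \<kappa>_closure[OF cell_X[OF that]] by simp
  \<comment> \<open>An open set disjoint from a set is disjoint from its closure. This is used first
    for the open cell of \<open>g\<close> and then for the open disk of \<open>f\<close>.\<close>
  have "\<kappa> ` g \<inter> \<kappa> ` f = {}" by (rule cells_\<kappa>_disj[OF g f]) (use ne in simp)
  then have "\<kappa> ` g \<inter> closure (\<kappa> ` f) = {}" using open_Int_closure_eq_empty[OF open_face[OF g]] by simp
  moreover have "face_map f ` ball 0 1 \<subseteq> closure (\<kappa> ` f)"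
    using cl[OF f] by (metis ball_subset_cball image_mono)
  ultimately have "face_map f ` ball 0 1 \<inter> \<kappa> ` g = {}" by blast
  moreover have "open (face_map f ` ball 0 1)"
    using interior_disk_image[OF face_map(1,2)[OF f]] open_interior by metis
  ultimately have "face_map f ` ball 0 1 \<inter> closure (\<kappa> ` g) = {}" using open_Int_closure_eq_empty by blast
  then show "face_map f ` ball 0 1 \<inter> face_map g ` cball 0 1 = {}" using cl[OF g] by simp
qed

text \<open>Rim vertices are among those counted by the complexity; vertices in slits may make the
  inequality strict.\<close>

lemma card_face_vertices:
  assumes f: "f \<in> D 2"
  shows "card (\<kappa> ` vertices D \<inter> face_map f ` sphere 0 1)
    \<le> card (vertices (restrict_cells D (X closure_of f)))"
proof -
  let ?W = "vertices (restrict_cells D (X closure_of f))"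
  have W: "?W \<subseteq> vertices D" by (auto simp: vertices_def restrict_cells_def)
  have "\<kappa> ` vertices D \<inter> face_map f ` sphere 0 1 \<subseteq> \<kappa> ` ?W"
  proof
    fix z assume z: "z \<in> \<kappa> ` vertices D \<inter> face_map f ` sphere 0 1"
    then obtain v where v: "v \<in> vertices D" "z = \<kappa> v" by auto
    have "z \<in> face_map f ` sphere 0 1" using z by simp
    then have "z \<in> face_map f ` cball 0 1" by (rule subsetD[OF image_mono[OF sphere_cball]])
    then have "z \<in> \<kappa> ` (X closure_of f)" unfolding face_map(3)[OF f] .
    then have "v \<in> X closure_of f"
      using v vertices_X closure_of_subset_topspace[of X f] inj_\<kappa> by (auto dest: inj_onD)
    moreover obtain e where e: "e \<in> D 0" "v \<in> e" using v by (auto simp: vertices_def)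
    moreover have "e = {v}" using vertex_cell[OF e(1)] e(2) by auto
    ultimately have "v \<in> ?W" by (auto simp: vertices_def restrict_cells_def)
    then show "z \<in> \<kappa> ` ?W" using v by simp
  qed
  then have "card (\<kappa> ` vertices D \<inter> face_map f ` sphere 0 1) \<le> card (\<kappa> ` ?W)"
    by (rule card_mono[OF finite_imageI[OF finite_subset[OF W finite_vertices]]])
  also have "\<dots> = card ?W" using W vertices_X by (intro card_image inj_on_subset[OF inj_\<kappa>]) auto
  finally show ?thesis .
qed

end

section \<open>Extremal width and its transfer along a chart\<close>

lemma unit_circle_pair:
  assumes "norm z = 1" "norm w = 1" "z \<noteq> w"
  obtains \<alpha> \<beta> where "0 < \<beta>" "\<beta> < 1" "z = cis \<alpha>" "w = cis (\<alpha> + 2 * pi * \<beta>)"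
proof -
  let ?t = "Arg2pi (w / z)"
  have "norm (w / z) = 1" using assms by (simp add: norm_divide)
  then have wz: "w / z = cis ?t" by (metis complex_norm_eq_1_exp cis_conv_exp)
  have z: "z = cis (Arg2pi z)" using assms by (metis complex_norm_eq_1_exp cis_conv_exp)
  have "z \<noteq> 0" using assms by auto
  then have "w = z * cis ?t" using wz by (simp add: field_simps)
  then have w: "w = cis (Arg2pi z + ?t)" using z by (metis cis_mult)
  have "?t \<noteq> 0" using wz assms by auto
  then have "0 < ?t" using Arg2pi_ge_0[of "w / z"] by simp
  show thesis
    by (rule that[of "?t / (2 * pi)" "Arg2pi z"]) (use \<open>0 < ?t\<close> Arg2pi_lt_2pi[of "w / z"] z w in auto)
qed

text \<open>Replaces a pair of components by a relation between two points, which is easier to carry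
  through the chart.\<close>

lemma separated_components:
  "(\<exists>A B. A \<in> connected_components_of Y \<and> B \<in> connected_components_of Y \<and> A \<noteq> B \<and> x \<in> A \<and> y \<in> B)
    \<longleftrightarrow> x \<in> topspace Y \<and> y \<in> topspace Y \<and> \<not> connected_component_of Y x y" (is "?L \<longleftrightarrow> ?R")
proof
  assume ?L
  then obtain A B where AB: "A \<in> connected_components_of Y" "B \<in> connected_components_of Y" "A \<noteq> B"
    "x \<in> A" "y \<in> B" by blast
  have *: "S = connected_component_of_set Y z \<and> z \<in> topspace Y"
    if S: "S \<in> connected_components_of Y" "z \<in> S" for S z
  proof -
    obtain s where "S = connected_component_of_set Y s" using S by (auto simp: connected_components_of_def)
    moreover have "connected_component_of Y s z" using S calculation by simp
    ultimately show ?thesis using connected_component_of_equiv[of Y s z] by simp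
  qed
  have "connected_component_of_set Y x \<noteq> connected_component_of_set Y y" using *[OF AB(1,4)] *[OF AB(2,5)] AB(3) by simp
  then show ?R using *[OF AB(1,4)] *[OF AB(2,5)] connected_component_of_equiv[of Y x y] by auto
next
  assume R: ?R
  let ?A = "connected_component_of_set Y x" and ?B = "connected_component_of_set Y y"
  show ?L
  proof (intro exI conjI)
    show "?A \<in> connected_components_of Y" "?B \<in> connected_components_of Y"
      using R by (simp_all add: connected_component_in_connected_components_of)
    show "x \<in> ?A" and y: "y \<in> ?B" using R by (simp_all add: connected_component_of_refl)
    have "y \<notin> ?A" using R by simp
    then show "?A \<noteq> ?B" using y by metis
  qed
qed

lemma extremal_width_inj_image:
  assumes inj: "inj_on f V" and \<Gamma>: "\<And>p. p \<in> \<Gamma> \<Longrightarrow> set p \<subseteq> V" and W: "W \<subseteq> V"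
  shows "extremal_width (f ` V) (map f ` \<Gamma>) (f ` W) = extremal_width V \<Gamma> W"
proof (rule antisym)
  let ?g = "inv_into V f"
  have g: "?g (f v) = v" if "v \<in> V" for v using inj that by simp
  have ar: "area (f ` V) \<mu> = area V (\<mu> \<circ> f)" for \<mu>
    unfolding area_def using inj by (subst sum.reindex) auto
  have len: "path_length \<mu> (map f p) = path_length (\<mu> \<circ> f) p" for \<mu> p
    by (simp add: path_length_def comp_def)
  have adm: "admissible (f ` V) (map f ` \<Gamma>) (f ` W) \<mu> \<longleftrightarrow> admissible V \<Gamma> W (\<mu> \<circ> f)" for \<mu>
    by (simp add: admissible_def len)
  show "extremal_width V \<Gamma> W \<le> extremal_width (f ` V) (map f ` \<Gamma>) (f ` W)"
    unfolding extremal_width_def using adm ar by (intro INF_mono) auto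
  have "\<exists>\<nu>. admissible (f ` V) (map f ` \<Gamma>) (f ` W) \<nu> \<and> area (f ` V) \<nu> = area V \<mu>"
    if \<mu>: "admissible V \<Gamma> W \<mu>" for \<mu>
  proof (intro exI conjI)
    have eq: "(\<mu> \<circ> ?g \<circ> f) v = \<mu> v" if "v \<in> V" for v using g[OF that] by simp
    have "path_length (\<mu> \<circ> ?g \<circ> f) p = path_length \<mu> p" if "p \<in> \<Gamma>" for p
      unfolding path_length_def using \<Gamma>[OF that] eq by (intro arg_cong[of _ _ sum_list] map_cong) auto
    then show "admissible (f ` V) (map f ` \<Gamma>) (f ` W) (\<mu> \<circ> ?g)"
      unfolding adm using \<mu> eq W unfolding admissible_def by (metis subsetD)
    show "area (f ` V) (\<mu> \<circ> ?g) = area V \<mu>"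
      unfolding ar unfolding area_def using eq by (intro sum.cong) auto
  qed
  then show "extremal_width (f ` V) (map f ` \<Gamma>) (f ` W) \<le> extremal_width V \<Gamma> W"
    unfolding extremal_width_def by (intro INF_mono) (metis mem_Collect_eq order_refl)
qed

text \<open>An admissible metric excludes the value infinity, so the width becomes a real greatest
  lower bound, described by its two defining properties.\<close>

lemma extremal_width_real:
  assumes ex: "\<exists>\<mu>. admissible V \<Gamma> W \<mu>"
  obtains I where "extremal_width V \<Gamma> W = ennreal I" "0 \<le> I"
    "\<forall>\<mu>. admissible V \<Gamma> W \<mu> \<longrightarrow> I \<le> area V \<mu>"
    "\<forall>x. (\<forall>\<mu>. admissible V \<Gamma> W \<mu> \<longrightarrow> x \<le> area V \<mu>) \<longrightarrow> x \<le> I"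
proof -
  let ?S = "area V ` {\<mu>. admissible V \<Gamma> W \<mu>}"
  have ne: "?S \<noteq> {}" using ex by auto
  have nn: "0 \<le> area V \<mu>" for \<mu> unfolding area_def by (intro sum_nonneg) simp
  then have bdd: "bdd_below ?S" by (intro bdd_belowI[of _ 0]) auto
  have low: "Inf ?S \<le> area V \<mu>" if "admissible V \<Gamma> W \<mu>" for \<mu>
    using that bdd by (intro cInf_lower) auto
  have great: "x \<le> Inf ?S" if "\<And>\<mu>. admissible V \<Gamma> W \<mu> \<Longrightarrow> x \<le> area V \<mu>" for x
    using ne that by (intro cInf_greatest) auto
  have I0: "0 \<le> Inf ?S" using nn by (intro great)
  have "extremal_width V \<Gamma> W = ennreal (Inf ?S)"
  proof (rule antisym)
    show "ennreal (Inf ?S) \<le> extremal_width V \<Gamma> W"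
      unfolding extremal_width_def using low by (intro INF_greatest ennreal_leI) auto
    show "extremal_width V \<Gamma> W \<le> ennreal (Inf ?S)"
    proof (rule ennreal_le_epsilon)
      fix e :: real assume e: "0 < e"
      then have "Inf ?S < Inf ?S + e" by simp
      then obtain \<mu> where \<mu>: "admissible V \<Gamma> W \<mu>" "area V \<mu> < Inf ?S + e"
        using cInf_lessD[OF ne, of "Inf ?S + e"] by auto
      have "extremal_width V \<Gamma> W \<le> ennreal (area V \<mu>)"
        unfolding extremal_width_def using \<mu>(1) by (intro INF_lower) simp
      also have "\<dots> \<le> ennreal (Inf ?S + e)" using \<mu>(2) by (intro ennreal_leI) simp
      also have "\<dots> = ennreal (Inf ?S) + ennreal e" using I0 e by (intro ennreal_plus) auto
      finally show "extremal_width V \<Gamma> W \<le> ennreal (Inf ?S) + ennreal e" .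
    qed
  qed
  then show thesis by (rule that) (use I0 low great in blast)+
qed

text \<open>The infimum is taken in one factor at a time: first over \<open>\<mu>\<close> for fixed
  \<open>\<rho>\<close>, which gives a bound on \<open>y\<close> and its positivity, then over
  \<open>\<rho>\<close>.\<close>

lemma greatest_lower_bounds_product_ge:
  fixes f g :: "_ \<Rightarrow> real"
  assumes nn: "\<And>\<mu>. 0 \<le> f \<mu>" "0 \<le> x" "0 \<le> y" and K: "0 < K"
    and x: "\<And>t. (\<And>\<rho>. P \<rho> \<Longrightarrow> t \<le> f \<rho>) \<Longrightarrow> t \<le> x"
    and y: "\<And>t. (\<And>\<mu>. Q \<mu> \<Longrightarrow> t \<le> f \<mu>) \<Longrightarrow> t \<le> y"
    and PQ: "\<exists>\<rho>. P \<rho>" "\<exists>\<mu>. Q \<mu>"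
    and prod: "\<And>\<rho> \<mu>. P \<rho> \<Longrightarrow> Q \<mu> \<Longrightarrow> 1 \<le> K * (f \<rho> * f \<mu>)"
  shows "1 \<le> K * (x * y)"
proof -
  have pos: "0 < f \<rho>" if "P \<rho>" for \<rho>
  proof -
    obtain \<mu> where "Q \<mu>" using PQ(2) by blast
    then have "f \<rho> \<noteq> 0" using prod[OF that, of \<mu>] by auto
    then show ?thesis using nn(1)[of \<rho>] by simp
  qed
  have y1: "1 / (K * f \<rho>) \<le> y" if "P \<rho>" for \<rho>
    using prod[OF that] pos[OF that] K by (intro y) (simp add: field_simps)
  obtain \<rho> where "P \<rho>" using PQ(1) by blast
  then have "0 < 1 / (K * f \<rho>)" using pos K by simp
  then have y0: "0 < y" using y1[OF \<open>P \<rho>\<close>] by linarith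
  have "1 / (K * y) \<le> x"
    using y1 pos K y0 by (intro x) (simp add: field_simps)
  then show ?thesis using K y0 by (simp add: field_simps)
qed

context disc_quad begin

lemma connected_arcs: "connected arcL" "connected arcR"
  unfolding arcL_def arcR_def by (intro connected_continuous_image continuous_intros connected_Ioo)+

text \<open>The two closed arcs cover the circle and meet in \<open>a\<close> and \<open>b\<close>
  only, so they separate any set avoiding these points.\<close>

lemma arcs_separated:
  assumes T: "connected T" "T \<subseteq> sphere 0 1 - {a, b}"
  shows "T \<inter> arcL = {} \<or> T \<inter> arcR = {}"
proof -
  let ?g = "\<lambda>t. cis (\<alpha> + 2 * pi * t)"
  have "{0..\<beta>} = insert 0 (insert \<beta> {0<..<\<beta>})" "{\<beta>..1} = insert 1 (insert \<beta> {\<beta><..<1})"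
    using \<beta> by auto
  then have L: "?g ` {0..\<beta>} = insert a (insert b arcL)" and R: "?g ` {\<beta>..1} = insert a (insert b arcR)"
    using cis_shift_1 by (simp_all add: arcL_def arcR_def)
  have "closed (?g ` {0..\<beta>})" "closed (?g ` {\<beta>..1})"
    by (intro compact_imp_closed compact_continuous_image continuous_intros compact_Icc)+
  moreover have "?g ` {0..\<beta>} \<inter> ?g ` {\<beta>..1} \<inter> T = {}"
    unfolding L R using arcs_disj T by auto
  moreover have "T \<subseteq> ?g ` {0..\<beta>} \<union> ?g ` {\<beta>..1}"
    unfolding L R using T sphere_arcs by auto
  ultimately have "?g ` {0..\<beta>} \<inter> T = {} \<or> ?g ` {\<beta>..1} \<inter> T = {}"
    by (intro connected_closedD[OF T(1)])
  then show ?thesis unfolding L R by auto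
qed

end

section \<open>Transfer of boundary, adjacency and path families\<close>

context disk_subdivision begin

lemma sphere_iff: "x \<in> topspace X \<Longrightarrow> \<kappa> x \<in> sphere 0 1 \<longleftrightarrow> x \<in> disk_boundary X"
proof
  assume x: "x \<in> topspace X"
  show "x \<in> disk_boundary X" if "\<kappa> x \<in> sphere 0 1"
    unfolding boundary_eq using imageI[OF that, of k] k_\<kappa>[OF x] by simp
  show "\<kappa> x \<in> sphere 0 1" if bd: "x \<in> disk_boundary X"
  proof -
    obtain z where "z \<in> sphere 0 1" "x = k z" using bd unfolding boundary_eq by auto
    then show ?thesis using \<kappa>_k[of z] by simp
  qed
qed

lemma boundary_X: "disk_boundary X \<subseteq> topspace X"
  unfolding boundary_eq using k_X by auto

lemma adjacent_iff:
  assumes "x \<in> topspace X" "y \<in> topspace X"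
  shows "(\<exists>e\<in>(`) \<kappa> ` D 1. ends e = {\<kappa> x, \<kappa> y}) \<longleftrightarrow> adjacent X D x y"
proof -
  have "ends (\<kappa> ` e) = {\<kappa> x, \<kappa> y} \<longleftrightarrow> edge_ends X e = {x, y}" if "e \<in> D 1" for e
    using inj_on_image_eq_iff[OF inj_\<kappa> edge_ends_X[OF that], of "{x, y}"] assms
    by (simp add: ends_\<kappa>[OF that])
  then show ?thesis by (simp add: adjacent_def)
qed

end

locale subdivision_quad = disk_subdivision +
  fixes \<alpha> \<beta> :: real and u w :: 'a
  assumes \<beta>: "0 < \<beta>" "\<beta> < 1"
    and u: "u \<in> vertices D" "\<kappa> u = cis \<alpha>"
    and w: "w \<in> vertices D" "\<kappa> w = cis (\<alpha> + 2 * pi * \<beta>)"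
    and nonadjacent: "\<not> adjacent X D u w"
begin

sublocale Q: disc_quad "\<kappa> ` vertices D" "(`) \<kappa> ` D 1" "D 2" face_map "(`) \<kappa>" face_point \<alpha> \<beta>
proof (intro disc_quad.intro disc_map_\<kappa> disc_quad_axioms.intro \<beta>)
  show "cis \<alpha> \<in> \<kappa> ` vertices D" "cis (\<alpha> + 2 * pi * \<beta>) \<in> \<kappa> ` vertices D"
    using imageI[OF u(1), of \<kappa>] imageI[OF w(1), of \<kappa>] u(2) w(2) by simp_all
  show "\<not> disc_map.adjE ((`) \<kappa> ` D 1) (cis \<alpha>) (cis (\<alpha> + 2 * pi * \<beta>))"
    using adjacent_iff[of u w] u w nonadjacent vertices_X
    by (auto simp: disc_map.adjE_def[OF disc_map_\<kappa>] simp del: One_nat_def)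
qed

lemma adjE_iff: "x \<in> vertices D \<Longrightarrow> y \<in> vertices D \<Longrightarrow> Q.adjE (\<kappa> x) (\<kappa> y) \<longleftrightarrow> adjacent X D x y"
  unfolding Q.adjE_def by (intro adjacent_iff subsetD[OF vertices_X])

lemma cpath_iff:
  assumes p: "set p \<subseteq> vertices D" shows "Q.cpath (map \<kappa> p) \<longleftrightarrow> proper_path X D p"
proof (cases "2 \<le> length p")
  case True
  then have ne: "p \<noteq> []" by auto
  have in_p: "hd p \<in> set p" "last p \<in> set p" "set (butlast (tl p)) \<subseteq> set p"
    using ne by (auto dest: in_set_butlastD list.set_sel(2))
  have bd: "\<kappa> x \<in> sphere 0 1 \<longleftrightarrow> x \<in> disk_boundary X" if "x \<in> set p" for x
    using sphere_iff p vertices_X that by blast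
  have "successively Q.adjE (map \<kappa> p) \<longleftrightarrow> successively (adjacent X D) p"
    unfolding successively_map using adjE_iff p by (intro successively_cong) auto
  moreover have "set (butlast (tl (map \<kappa> p))) \<inter> sphere 0 1 = {} \<longleftrightarrow> set (butlast (tl p)) \<inter> disk_boundary X = {}"
  proof -
    have "set (butlast (tl (map \<kappa> p))) = \<kappa> ` set (butlast (tl p))"
      by (simp add: map_tl[symmetric] map_butlast[symmetric])
    then have "set (butlast (tl (map \<kappa> p))) \<inter> sphere 0 1 = {} \<longleftrightarrow> (\<forall>x\<in>set (butlast (tl p)). \<kappa> x \<notin> sphere 0 1)"
      by (simp only: disjoint_iff) blast
    also have "\<dots> \<longleftrightarrow> (\<forall>x\<in>set (butlast (tl p)). x \<notin> disk_boundary X)"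
      by (rule ball_cong[OF refl]) (simp only: bd[OF subsetD[OF in_p(3)]])
    also have "\<dots> \<longleftrightarrow> set (butlast (tl p)) \<inter> disk_boundary X = {}" by blast
    finally show ?thesis .
  qed
  moreover have "hd (map \<kappa> p) \<in> sphere 0 1 \<longleftrightarrow> hd p \<in> disk_boundary X"
    unfolding hd_map[OF ne] by (rule bd[OF in_p(1)])
  moreover have "last (map \<kappa> p) \<in> sphere 0 1 \<longleftrightarrow> last p \<in> disk_boundary X"
    unfolding last_map[OF ne] by (rule bd[OF in_p(2)])
  moreover have "set (map \<kappa> p) \<subseteq> \<kappa> ` vertices D" using p by auto
  ultimately show ?thesis
    unfolding Q.cpath_def proper_path_def skeleton_path_def using True p by (simp only: length_map simp_thms)
next
  case False
  then show ?thesis by (simp add: Q.cpath_def proper_path_def skeleton_path_def del: One_nat_def)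
qed

lemma paths_image:
  assumes "\<And>p. p \<in> \<Gamma> \<Longrightarrow> set p \<subseteq> vertices D" "\<And>q. q \<in> G \<Longrightarrow> set q \<subseteq> \<kappa> ` vertices D"
    and iff: "\<And>p. set p \<subseteq> vertices D \<Longrightarrow> map \<kappa> p \<in> G \<longleftrightarrow> p \<in> \<Gamma>"
  shows "map \<kappa> ` \<Gamma> = G"
proof
  show "map \<kappa> ` \<Gamma> \<subseteq> G" using assms(1) iff by auto
  show "G \<subseteq> map \<kappa> ` \<Gamma>"
  proof
    fix q assume q: "q \<in> G"
    have "k y \<in> vertices D \<and> \<kappa> (k y) = y" if y: "y \<in> set q" for y
    proof -
      obtain x where "x \<in> vertices D" "y = \<kappa> x" using assms(2)[OF q] y by auto
      then show ?thesis using k_\<kappa>[OF subsetD[OF vertices_X]] by simp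
    qed
    then have "map \<kappa> (map k q) = q" "set (map k q) \<subseteq> vertices D" by (auto intro: map_idI)
    then show "q \<in> map \<kappa> ` \<Gamma>" using q iff by (metis imageI)
  qed
qed

lemma connecting_paths_\<kappa>: "map \<kappa> ` connecting_paths X D u w = Q.GC"
proof (rule paths_image)
  fix p assume p: "set p \<subseteq> vertices D"
  show "map \<kappa> p \<in> Q.GC \<longleftrightarrow> p \<in> connecting_paths X D u w"
  proof (cases "proper_path X D p")
    case True
    then have ne: "p \<noteq> []" by (auto simp: proper_path_def skeleton_path_def)
    have "{\<kappa> (hd p), \<kappa> (last p)} = {\<kappa> u, \<kappa> w} \<longleftrightarrow> {hd p, last p} = {u, w}"
      using inj_on_image_eq_iff[OF inj_\<kappa>, of "{hd p, last p}" "{u, w}"] vertices_X p ne u(1) w(1)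
        hd_in_set[OF ne] last_in_set[OF ne] by (simp add: subset_iff)
    then show ?thesis
      using True ne cpath_iff[OF p] u(2) w(2)
      by (simp add: Q.GC_def connecting_paths_def hd_map last_map del: One_nat_def)
  next
    case False
    then show ?thesis using cpath_iff[OF p] by (simp add: Q.GC_def connecting_paths_def del: One_nat_def)
  qed
qed (auto simp: connecting_paths_def proper_path_def skeleton_path_def Q.GC_def Q.cpath_def simp del: One_nat_def)

text \<open>Each open arc is connected, so \<open>k\<close> carries it into one component;
  conversely, a connected set meeting both would be mapped by \<open>\<kappa>\<close> to one
  excluded by \<open>Q.arcs_separated\<close>.\<close>

lemma separated_iff:
  assumes x: "x \<in> disk_boundary X" and y: "y \<in> disk_boundary X"
  shows "(\<exists>A B. A \<in> connected_components_of (subtopology X (disk_boundary X - {u, w})) \<and>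
                B \<in> connected_components_of (subtopology X (disk_boundary X - {u, w})) \<and>
                A \<noteq> B \<and> x \<in> A \<and> y \<in> B)
    \<longleftrightarrow> \<kappa> x \<in> Q.arcL \<and> \<kappa> y \<in> Q.arcR \<or> \<kappa> x \<in> Q.arcR \<and> \<kappa> y \<in> Q.arcL"
proof -
  let ?Y = "subtopology X (disk_boundary X - {u, w})"
  have tY: "topspace ?Y = disk_boundary X - {u, w}" using boundary_X by auto
  have uw: "u \<in> topspace X" "w \<in> topspace X" using u w vertices_X by auto
  have pos: "z \<in> topspace ?Y \<longleftrightarrow> \<kappa> z \<in> Q.arcL \<union> Q.arcR" if z: "z \<in> disk_boundary X" for z
  proof -
    have zX: "z \<in> topspace X" using z boundary_X by auto
    have "\<kappa> z = cis \<alpha> \<longleftrightarrow> z = u" "\<kappa> z = cis (\<alpha> + 2 * pi * \<beta>) \<longleftrightarrow> z = w"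
      using inj_on_eq_iff[OF inj_\<kappa> zX uw(1)] inj_on_eq_iff[OF inj_\<kappa> zX uw(2)] u(2) w(2) by simp_all
    moreover have "\<kappa> z \<in> {cis \<alpha>, cis (\<alpha> + 2 * pi * \<beta>)} \<union> Q.arcL \<union> Q.arcR"
      using sphere_iff[OF zX] z Q.sphere_arcs by blast
    ultimately show ?thesis unfolding tY using Q.arcs_disj z by auto
  qed
  have same: "connected_component_of ?Y x y"
    if S: "connected S" "S \<subseteq> sphere 0 1 - {cis \<alpha>, cis (\<alpha> + 2 * pi * \<beta>)}" "\<kappa> x \<in> S" "\<kappa> y \<in> S" for S
  proof -
    have Sc: "S \<subseteq> cball 0 1" using S(2) by auto
    have "connectedin (top_of_set (cball 0 1)) S"
      using S(1) Sc by (simp add: connectedin_subtopology)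
    then have "connectedin X (k ` S)" by (rule connectedin_continuous_map_image[OF cont_k])
    moreover have "k ` S \<subseteq> disk_boundary X - {u, w}"
    proof
      fix z assume "z \<in> k ` S"
      then obtain s where s: "s \<in> S" "z = k s" by auto
      then have "\<kappa> z = s" using \<kappa>_k[of s] Sc by auto
      then have "z \<noteq> u" "z \<noteq> w" using s(1) S(2) u(2) w(2) by auto
      then show "z \<in> disk_boundary X - {u, w}" using s S(2) by (auto simp: boundary_eq)
    qed
    ultimately have "connectedin ?Y (k ` S)" by (simp add: connectedin_subtopology)
    moreover have "x \<in> k ` S" "y \<in> k ` S"
      using imageI[OF S(3), of k] imageI[OF S(4), of k] k_\<kappa> x y boundary_X by auto
    ultimately show ?thesis unfolding connected_component_of_def by blast
  qed
  have arcs: "Q.arcL \<subseteq> sphere 0 1 - {cis \<alpha>, cis (\<alpha> + 2 * pi * \<beta>)}"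
    "Q.arcR \<subseteq> sphere 0 1 - {cis \<alpha>, cis (\<alpha> + 2 * pi * \<beta>)}"
    using Q.arcs_disj Q.sphere_arcs by auto
  have different: "\<not> connected_component_of ?Y x y"
    if "\<kappa> x \<in> Q.arcL \<and> \<kappa> y \<in> Q.arcR \<or> \<kappa> x \<in> Q.arcR \<and> \<kappa> y \<in> Q.arcL"
  proof
    assume "connected_component_of ?Y x y"
    then obtain T where T: "connectedin ?Y T" "x \<in> T" "y \<in> T" by (auto simp: connected_component_of_def)
    then have TX: "connectedin X T" and Tb: "T \<subseteq> disk_boundary X - {u, w}"
      by (auto simp: connectedin_subtopology)
    have "connectedin (top_of_set (cball 0 1)) (\<kappa> ` T)"
      by (rule connectedin_continuous_map_image[OF cont_\<kappa> TX])
    then have con: "connected (\<kappa> ` T)" by (simp add: connectedin_subtopology)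
    have "\<kappa> z \<in> sphere 0 1 - {cis \<alpha>, cis (\<alpha> + 2 * pi * \<beta>)}" if "z \<in> T" for z
    proof -
      have z: "z \<in> disk_boundary X" "z \<in> topspace ?Y" using that Tb tY by auto
      then show ?thesis using pos[OF z(1)] arcs by blast
    qed
    then have "\<kappa> ` T \<inter> Q.arcL = {} \<or> \<kappa> ` T \<inter> Q.arcR = {}"
      by (intro Q.arcs_separated con image_subsetI)
    then show False using that imageI[OF T(2), of \<kappa>] imageI[OF T(3), of \<kappa>] by blast
  qed
  show ?thesis
    unfolding separated_components pos[OF x] pos[OF y]
    using different same[OF Q.connected_arcs(1) arcs(1)] same[OF Q.connected_arcs(2) arcs(2)] by blast
qed

lemma separating_paths_\<kappa>: "map \<kappa> ` separating_paths X D u w = Q.GS"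
proof (rule paths_image)
  fix p assume p: "set p \<subseteq> vertices D"
  show "map \<kappa> p \<in> Q.GS \<longleftrightarrow> p \<in> separating_paths X D u w"
  proof (cases "proper_path X D p")
    case True
    then have ne: "p \<noteq> []" and bd: "hd p \<in> disk_boundary X" "last p \<in> disk_boundary X"
      by (auto simp: proper_path_def skeleton_path_def)
    show ?thesis
      using True cpath_iff[OF p] separated_iff[OF bd]
      by (simp add: Q.GS_def separating_paths_def hd_map[OF ne] last_map[OF ne] del: One_nat_def)
  next
    case False
    then show ?thesis using cpath_iff[OF p] by (simp add: Q.GS_def separating_paths_def del: One_nat_def)
  qed
qed (auto simp: separating_paths_def proper_path_def skeleton_path_def Q.GS_def Q.cpath_def simp del: One_nat_def)

lemma EW_\<kappa>:
  assumes "\<And>p. p \<in> \<Gamma> \<Longrightarrow> set p \<subseteq> vertices D"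
  shows "EW X D \<Gamma> = extremal_width (\<kappa> ` vertices D) (map \<kappa> ` \<Gamma>) (\<kappa> ` vertices D \<inter> sphere 0 1)"
proof -
  have "\<kappa> ` vertices D \<inter> sphere 0 1 = \<kappa> ` (vertices D \<inter> disk_boundary X)"
  proof (rule set_eqI)
    fix z show "z \<in> \<kappa> ` vertices D \<inter> sphere 0 1 \<longleftrightarrow> z \<in> \<kappa> ` (vertices D \<inter> disk_boundary X)"
      using sphere_iff subsetD[OF vertices_X] by (auto simp del: mem_sphere mem_sphere_0)
  qed
  then show ?thesis
    unfolding EW_def using extremal_width_inj_image[OF inj_on_subset[OF inj_\<kappa> vertices_X] assms] by simp
qed

lemma EW_product:
  assumes N: "\<And>f. f \<in> D 2 \<Longrightarrow> card (vertices (restrict_cells D (X closure_of f))) \<le> N" "0 < N"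
    and ne: "connecting_paths X D u w \<noteq> {}" "separating_paths X D u w \<noteq> {}"
  obtains x y where "0 < x" "0 < y" "x * y \<le> 1" "1 \<le> (4 * real N + 1)\<^sup>2 * (x * y)"
    "N = 3 \<longrightarrow> x * y = 1"
    "EW X D (connecting_paths X D u w) = ennreal x" "EW X D (separating_paths X D u w) = ennreal y"
proof -
  let ?V = "\<kappa> ` vertices D" and ?W = "\<kappa> ` vertices D \<inter> sphere 0 1"
  let ?K = "(4 * real N + 1)\<^sup>2"
  have GCne: "Q.GC \<noteq> {}" and GSne: "Q.GS \<noteq> {}"
    using ne connecting_paths_\<kappa> separating_paths_\<kappa> by auto
  have VF: "card (Q.VF f) \<le> N" if "f \<in> D 2" for f
    unfolding Q.VF_def using card_face_vertices[OF that] N(1)[OF that] by linarith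
  have EWC: "EW X D (connecting_paths X D u w) = extremal_width ?V Q.GC ?W"
    unfolding connecting_paths_\<kappa>[symmetric]
    by (rule EW_\<kappa>) (auto simp: connecting_paths_def proper_path_def skeleton_path_def)
  have EWS: "EW X D (separating_paths X D u w) = extremal_width ?V Q.GS ?W"
    unfolding separating_paths_\<kappa>[symmetric]
    by (rule EW_\<kappa>) (auto simp: separating_paths_def proper_path_def skeleton_path_def)
  note exC = Q.admissible_exists(1)[OF GCne GSne] and exS = Q.admissible_exists(2)[OF GCne GSne]
  obtain x where x: "extremal_width ?V Q.GC ?W = ennreal x" "0 \<le> x"
    "\<forall>\<mu>. admissible ?V Q.GC ?W \<mu> \<longrightarrow> x \<le> area ?V \<mu>"
    "\<forall>t. (\<forall>\<mu>. admissible ?V Q.GC ?W \<mu> \<longrightarrow> t \<le> area ?V \<mu>) \<longrightarrow> t \<le> x"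
    by (rule extremal_width_real[OF exC])
  obtain y where y: "extremal_width ?V Q.GS ?W = ennreal y" "0 \<le> y"
    "\<forall>\<mu>. admissible ?V Q.GS ?W \<mu> \<longrightarrow> y \<le> area ?V \<mu>"
    "\<forall>t. (\<forall>\<mu>. admissible ?V Q.GS ?W \<mu> \<longrightarrow> t \<le> area ?V \<mu>) \<longrightarrow> t \<le> y"
    by (rule extremal_width_real[OF exS])
  have area_nn: "0 \<le> area ?V \<mu>" for \<mu> unfolding area_def by (intro sum_nonneg) simp
  \<comment> \<open>Used twice, with constant \<open>?K\<close> for the general bound and with
    constant 1 for triangles.\<close>
  note ge = greatest_lower_bounds_product_ge[OF area_nn x(2) y(2) _ x(4)[rule_format] y(4)[rule_format] exC exS]
  have K: "1 \<le> ?K * (x * y)"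
    by (rule ge[OF _ _ _ Q.area_product_ge[OF GSne GCne _ _ VF N(2)]]) auto
  have "x \<noteq> 0" "y \<noteq> 0" using K by auto
  then have pos: "0 < x" "0 < y" using x(2) y(2) by auto
  have le: "x * y \<le> 1"
    by (rule Q.area_lower_product_le_1[OF x(3)[rule_format] y(3)[rule_format] pos])
  have "1 \<le> 1 * (x * y)" if "N = 3"
  proof (rule ge)
    show "1 \<le> 1 * (area ?V \<rho> * area ?V \<mu>)" if "admissible ?V Q.GC ?W \<rho>" "admissible ?V Q.GS ?W \<mu>" for \<rho> \<mu>
      using Q.area_product_ge_1[OF GSne that] VF \<open>N = 3\<close> by simp
  qed auto
  then have "N = 3 \<longrightarrow> x * y = 1" using le by auto
  then show thesis using pos le K x(1) y(1) EWC EWS by (intro that) auto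
qed

end

theorem theorem3p2:
  fixes X :: "'a topology" and C D :: "'a cells" and a b :: 'a and N :: nat
  assumes "polygonal_subdivision X C D"
    and "simple_skeleton X D"
    and "subdivision_complexity X D = N"
    and "a \<in> vertices D \<inter> disk_boundary X"
    and "b \<in> vertices D \<inter> disk_boundary X"
    and "a \<noteq> b" and "\<not> adjacent X D a b"
    and "connecting_paths X D a b \<noteq> {}"
    and "separating_paths X D a b \<noteq> {}"
  shows "(N = 3 \<longrightarrow>
           EW X D (connecting_paths X D a b) * EW X D (separating_paths X D a b) = 1) \<and>
         ennreal (1 / (4 * real N + 1) ^ 2)
           \<le> EW X D (connecting_paths X D a b) * EW X D (separating_paths X D a b) \<and>
         EW X D (connecting_paths X D a b) * EW X D (separating_paths X D a b) \<le> 1 \<and>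
         1 \<le> EL X D (connecting_paths X D a b) * EL X D (separating_paths X D a b) \<and>
         EL X D (connecting_paths X D a b) * EL X D (separating_paths X D a b)
           \<le> ennreal ((4 * real N + 1) ^ 2)"
proof -
  have P: "polygon X C" and S: "finite_CW_complex X D" and two: "2 \<le> card (D 2)"
    and cov: "topspace X = (\<Union>f\<in>D 2. X closure_of f)"
    and faces: "\<And>f. f \<in> D 2 \<Longrightarrow>
      polygon (subtopology X (X closure_of f)) (restrict_cells D (X closure_of f))"
    using assms(1) by (simp_all add: polygonal_subdivision_def subdivision_def)
  obtain k \<kappa> where k: "homeomorphic_maps closed_disk X k \<kappa>"
    using P unfolding polygon_def homeomorphic_space_def by blast
  interpret disk_subdivision X D k \<kappa>
    using k S assms(2) cov faces by unfold_locales (simp_all add: polygon_def)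
  have aX: "a \<in> topspace X" and bX: "b \<in> topspace X" using assms(4,5) vertices_X by auto
  have circ: "norm (\<kappa> a) = 1" "norm (\<kappa> b) = 1"
    using sphere_iff[OF aX] sphere_iff[OF bX] assms(4,5) by simp_all
  have "\<kappa> a \<noteq> \<kappa> b" using inj_on_eq_iff[OF inj_\<kappa> aX bX] assms(6) by simp
  then obtain \<alpha> \<beta> where ab: "0 < \<beta>" "\<beta> < 1" "\<kappa> a = cis \<alpha>" "\<kappa> b = cis (\<alpha> + 2 * pi * \<beta>)"
    using unit_circle_pair[OF circ] by metis
  interpret subdivision_quad X D k \<kappa> \<alpha> \<beta> a b
    using ab assms(4,5,7) by unfold_locales auto
  let ?n = "\<lambda>f. card (vertices (restrict_cells D (X closure_of f)))"
  have le_N: "?n f \<le> N" if "f \<in> D 2" for f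
    using assms(3) that finite_cells unfolding subdivision_complexity_def by (metis Max_ge finite_imageI imageI)
  \<comment> \<open>A face exists and has at least three vertices, so \<open>N\<close> is positive,
    as the charging argument requires.\<close>
  have "D 2 \<noteq> {}" using two by auto
  then obtain f where f: "f \<in> D 2" by blast
  then have "3 \<le> ?n f" using faces by (simp add: polygon_def)
  then have N: "0 < N" using le_N[OF f] by simp
  obtain x y where xy: "0 < x" "0 < y" "x * y \<le> 1" "1 \<le> (4 * real N + 1)\<^sup>2 * (x * y)"
    "N = 3 \<longrightarrow> x * y = 1"
    and EW: "EW X D (connecting_paths X D a b) = ennreal x" "EW X D (separating_paths X D a b) = ennreal y"
    by (rule EW_product[OF le_N N assms(8,9)])
  have EL: "EL X D \<Gamma> = 1 / EW X D \<Gamma>" for \<Gamma> by (simp add: EL_def EW_def extremal_length_def)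
  have inv: "1 / ennreal t = ennreal (1 / t)" if "0 < t" for t
    using divide_ennreal[of 1 t] that by simp
  have EWp: "EW X D (connecting_paths X D a b) * EW X D (separating_paths X D a b) = ennreal (x * y)"
    unfolding EW using xy by (simp add: ennreal_mult)
  have ELp: "EL X D (connecting_paths X D a b) * EL X D (separating_paths X D a b) = ennreal (1 / (x * y))"
    unfolding EL EW using xy by (simp add: inv ennreal_mult[symmetric])
  have K: "0 < (4 * real N + 1)\<^sup>2" by (intro zero_less_power) simp
  have xy0: "0 < x * y" using xy by simp
  have lower: "1 / (4 * real N + 1)\<^sup>2 \<le> x * y" "1 / (x * y) \<le> (4 * real N + 1)\<^sup>2"
    using xy(4) K xy0 by (simp_all add: pos_divide_le_eq mult.commute)
  have upper: "1 \<le> 1 / (x * y)" using xy(3) xy0 by (simp add: pos_le_divide_eq)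
  show ?thesis
    unfolding EWp ELp using lower upper xy(3,5) xy0 by (auto intro: ennreal_leI)
qed

end
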